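(* Let $m\ge 2$, $n\ge1$, $d\ge1$ be integers, let $\mathbf{X}=S^{n-1}\times\cdots\times S^{n-1}$ ($m$ factors) $=\{(\mathbf{x}_1,\dots,\mathbf{x}_m)\in(\mathbb{R}^n)^m:\ 1-\|\mathbf{x}_j\|^2=0,\ j=1,\dots,m\}$, and let $q\in\mathbb{R}[\mathbf{x}_1,\dots,\mathbf{x}_m]$ have degree at most $d$, with $q_{\min}$, $q_{\max}$ its minimum and maximum on $\mathbf{X}$. Then for every integer $t\ge 2nd\sqrt{d}$, $$q_{\min}-\mathrm{lb}(q,\mathcal{T}(\mathbf{X}))_{mt}\le\frac{C_{\mathbf{X}}(n,d,m)}{t^2}(q_{\max}-q_{\min}),\qquad C_{\mathbf{X}}(n,d,m):=m\,2^m n^2d^3\binom{d+m}{m}\gamma(S^{n-1})_d^m.$$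
   Context: $\|\cdot\|$ is the Euclidean norm; $\Sigma$ denotes sums of squares of real polynomials. For an integer $s$, $\mathcal{T}(\mathbf{X})_{2s}:=\{\sigma+\sum_{j=1}^m h_j(1-\|\mathbf{x}_j\|^2):\ \sigma\in\Sigma[\mathbf{x}_1,\dots,\mathbf{x}_m],\ \deg\sigma\le 2s,\ h_j\in\mathbb{R}[\mathbf{x}_1,\dots,\mathbf{x}_m],\ \deg h_j\le 2s-2\}$ and $\mathrm{lb}(q,\mathcal{T}(\mathbf{X}))_s:=\sup\{\tau\in\mathbb{R}: q-\tau\in\mathcal{T}(\mathbf{X})_{2s}\}$. Harmonic constant: equip $S^{n-1}$ with the uniform probability measure, let $H_k$ be the spherical harmonics of degree $k$; every $p\in\mathbb{R}[\mathbf{x}]_d$ satisfies $p=\sum_{k=0}^dp_k$ on $S^{n-1}$ with $p_k\in H_k$; with $\|p\|_{S^{n-1}}=\max_{S^{n-1}}|p|$, $\gamma(S^{n-1})_d:=\max_{p\in\mathbb{R}[\mathbf{x}]_d,\,p\not\equiv0\text{ on }S^{n-1}}\max_{0\le k\le d}\|p_k\|_{S^{n-1}}/\|p\|_{S^{n-1}}$. *)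

theory Defs
  imports "HOL-Analysis.Analysis"
begin

definition mpoly_fun_deg :: "nat \<Rightarrow> (('v::finite \<Rightarrow> real) \<Rightarrow> real) \<Rightarrow> bool" where
  "mpoly_fun_deg d p \<longleftrightarrow>
     (\<exists>(A :: ('v \<Rightarrow> nat) set) (c :: ('v \<Rightarrow> nat) \<Rightarrow> real).
        finite A \<and> (\<forall>\<alpha>\<in>A. (\<Sum>v\<in>UNIV. \<alpha> v) \<le> d) \<and>
        (\<forall>x. p x = (\<Sum>\<alpha>\<in>A. c \<alpha> * (\<Prod>v\<in>UNIV. x v ^ \<alpha> v))))"

definition mpoly_fun_hom :: "nat \<Rightarrow> (('v::finite \<Rightarrow> real) \<Rightarrow> real) \<Rightarrow> bool" where
  "mpoly_fun_hom k p \<longleftrightarrow>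
     (\<exists>(A :: ('v \<Rightarrow> nat) set) (c :: ('v \<Rightarrow> nat) \<Rightarrow> real).
        finite A \<and> (\<forall>\<alpha>\<in>A. (\<Sum>v\<in>UNIV. \<alpha> v) = k) \<and>
        (\<forall>x. p x = (\<Sum>\<alpha>\<in>A. c \<alpha> * (\<Prod>v\<in>UNIV. x v ^ \<alpha> v))))"

definition poly_vec :: "nat \<Rightarrow> (real^'n \<Rightarrow> real) \<Rightarrow> bool" where
  "poly_vec d f \<longleftrightarrow> mpoly_fun_deg d (\<lambda>y::'n \<Rightarrow> real. f (vec_lambda y))"

definition hom_vec :: "nat \<Rightarrow> (real^'n \<Rightarrow> real) \<Rightarrow> bool" where
  "hom_vec k f \<longleftrightarrow> mpoly_fun_hom k (\<lambda>y::'n \<Rightarrow> real. f (vec_lambda y))"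

definition poly_blk :: "nat \<Rightarrow> (real^'n^'m \<Rightarrow> real) \<Rightarrow> bool" where
  "poly_blk d f \<longleftrightarrow>
     mpoly_fun_deg d (\<lambda>y::('m \<times> 'n) \<Rightarrow> real. f (\<chi> j. \<chi> i. y (j, i)))"

definition harmonic_fun :: "(real^'n \<Rightarrow> real) \<Rightarrow> bool" where
  "harmonic_fun f \<longleftrightarrow>
     (\<forall>x. (\<Sum>i\<in>UNIV. deriv (deriv (\<lambda>t. f (x + t *\<^sub>R axis i 1))) 0) = 0)"

definition is_sph_harm :: "nat \<Rightarrow> (real^'n \<Rightarrow> real) \<Rightarrow> bool" where
  "is_sph_harm k h \<longleftrightarrow>
     (\<exists>f. hom_vec k f \<and> harmonic_fun f \<and> (\<forall>x. norm x = 1 \<longrightarrow> h x = f x))"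

definition sph_norm :: "(real^'n \<Rightarrow> real) \<Rightarrow> real" where
  "sph_norm p = Sup ((\<lambda>x. \<bar>p x\<bar>) ` {x. norm x = 1})"

definition gamma_sph :: "('n::finite) itself \<Rightarrow> nat \<Rightarrow> real" where
  "gamma_sph _ d = Sup {sph_norm h / sph_norm p | (p :: real^('n::finite) \<Rightarrow> real) h k.
       poly_vec d p \<and> (\<exists>x. norm x = 1 \<and> p x \<noteq> 0) \<and> k \<le> d \<and>
       (\<exists>H. (\<forall>j\<le>d. is_sph_harm j (H j)) \<and>
            (\<forall>x. norm x = 1 \<longrightarrow> p x = (\<Sum>j\<le>d. H j x)) \<and> h = H k)}"

definition sos_deg :: "nat \<Rightarrow> (real^'n^'m \<Rightarrow> real) \<Rightarrow> bool" where
  "sos_deg k \<sigma> \<longleftrightarrow> poly_blk k \<sigma> \<and>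
     (\<exists>gs. (\<forall>g\<in>set gs. \<exists>e. poly_blk e g) \<and> (\<forall>x. \<sigma> x = (\<Sum>g\<leftarrow>gs. (g x)^2)))"

definition in_T :: "nat \<Rightarrow> (real^'n^'m \<Rightarrow> real) \<Rightarrow> bool" where
  "in_T s f \<longleftrightarrow>
     (\<exists>\<sigma> h. sos_deg (2 * s) \<sigma> \<and> (\<forall>j. poly_blk (2 * s - 2) (h j)) \<and>
        (\<forall>x. f x = \<sigma> x + (\<Sum>j\<in>UNIV. h j x * (1 - (norm (x $ j))^2))))"

text \<open>lb(q, T(X))_s (as an extended real, so that an empty set gives -infinity).\<close>
definition lb_T :: "(real^'n^'m \<Rightarrow> real) \<Rightarrow> nat \<Rightarrow> ereal" where
  "lb_T q s = Sup (ereal ` {\<tau>. in_T s (\<lambda>x. q x - \<tau>)})"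

definition Xset :: "(real^'n^'m) set" where
  "Xset = {x. \<forall>j. norm (x $ j) = 1}"

definition qmin :: "(real^'n^'m \<Rightarrow> real) \<Rightarrow> real" where
  "qmin q = Inf (q ` Xset)"

definition qmax :: "(real^'n^'m \<Rightarrow> real) \<Rightarrow> real" where
  "qmax q = Sup (q ` Xset)"

definition C_X :: "nat \<Rightarrow> nat \<Rightarrow> nat \<Rightarrow> real \<Rightarrow> real" where
  "C_X n d m \<gamma> = real m * 2^m * (real n)^2 * (real d)^3 * real ((d + m) choose m) * \<gamma>^m"

end

theory Submission
  imports Defs
begin

text \<open>The operator \<open>K p(x) = \<integral> \<phi>(x \<bullet> y) p(y) dy\<close> on the sphere, with \<open>\<phi>\<close> the square of a polynomial of degree
  \<open>t\<close>, maps polynomials of degree \<open>d\<close> to such polynomials. Along a great circle \<open>p\<close> is a trigonometric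
  polynomial of degree \<open>d\<close>, so averaging \<open>p\<close> over \<open>y\<close> and its mirror image in \<open>x\<close> changes \<open>p(x)\<close> by at most
  \<open>2 d^3 \<parallel>p\<parallel> (1 - x \<bullet> y)\<close>; for an explicit Jacobi polynomial the mean of \<open>\<phi>(u) (1 - u)\<close> is at most
  \<open>n^2 / t^2\<close>. Hence \<open>\<parallel>K p - p\<parallel> \<le> \<delta> \<parallel>p\<parallel>\<close> with \<open>\<delta> = 2 n^2 d^3 / t^2 \<le> 1/2\<close>, and applying \<open>K\<close> in each of the
  \<open>m\<close> blocks gives an operator whose inverse moves \<open>q\<close> by at most \<open>((1 - \<delta>)^(-m) - 1) \<parallel>q\<parallel>\<close>. The inverse
  image of \<open>q - \<tau>\<close> is therefore nonnegative for \<open>\<tau>\<close> slightly below the minimum, and its image \<open>q - \<tau>\<close> is a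
  limit of sums of squares. The harmonic constant enters only through \<open>1 \<le> \<gamma>\<close>, for which one has to
  know that the supremum defining it is finite.

  Integrals are limits of finite positive combinations of point evaluations. Convergence at finitely many
  points of \<open>X\<close> suffices: a polynomial of bounded degree that is small at suitable points lies in the
  truncated quadratic module after adding a small constant.\<close>

section \<open>Polynomial functions\<close>

text \<open>Smallness at sample points turns into membership because the coefficients of a normal
  form modulo the ideal are finite combinations of point values, and because inside the truncated
  module every monomial of degree at most 2 s is bounded by 1 without exceeding that degree. The
  constant this costs is lost in the supremum. The mean over the sphere comes from the central limit
  theorem for moments: a lattice walk yields the Gaussian moments as sums over pairings, and
  dividing by the moments of the radius leaves those of the sphere. The approximating functionals
  are not rotation invariant; the limit is, since pairings see inner products only. Each
  \<open>K\<close> is inverted by a truncated Neumann series, which uses two facts on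
  \<open>Xset\<close>: positivity makes \<open>K\<close> a contraction, and \<open>K\<close> moves a
  polynomial by at most \<delta> times its norm. Origin of the constants: squaring the lower bound
  on t gives \<delta> \<le> 1/2; then 1/(1 - \<delta>) \<le> 2 yields (1 - \<delta>)^(-m) - 1 \<le>
  m 2^m \<delta>; centring q at the middle of its range makes its norm half the range, and this half
  cancels the 2 in \<delta>.\<close>

lemma mpoly_fun_degI:
  fixes a :: "'i \<Rightarrow> 'v::finite \<Rightarrow> nat"
  assumes "finite I" "\<And>i. i \<in> I \<Longrightarrow> (\<Sum>v\<in>UNIV. a i v) \<le> d"
    and "\<And>x. p x = (\<Sum>i\<in>I. c i * (\<Prod>v\<in>UNIV. x v ^ a i v))"
  shows "mpoly_fun_deg d p"
proof -
  \<comment> \<open>The definition of \<open>mpoly_fun_deg\<close> admits each exponent once, so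
    terms of the family with equal exponents are merged by adding their coefficients.\<close>
  have "p x = (\<Sum>\<alpha>\<in>a ` I. (\<Sum>i\<in>{i\<in>I. a i = \<alpha>}. c i) * (\<Prod>v\<in>UNIV. x v ^ \<alpha> v))" for x
    unfolding assms(3) by (subst sum.image_gen[OF assms(1), of _ a])
      (auto simp: sum_distrib_right intro!: sum.cong)
  then show ?thesis
    unfolding mpoly_fun_deg_def using assms(1,2)
    by (intro exI[of _ "a ` I"] exI[of _ "\<lambda>\<alpha>. \<Sum>i\<in>{i\<in>I. a i = \<alpha>}. c i"]) auto
qed

lemma mpoly_fun_degE:
  assumes "mpoly_fun_deg d p"
  obtains A c where "finite A" "\<And>\<alpha>. \<alpha> \<in> A \<Longrightarrow> (\<Sum>v\<in>UNIV. \<alpha> v) \<le> d"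
    "\<And>x. p x = (\<Sum>\<alpha>\<in>A. c \<alpha> * (\<Prod>v\<in>UNIV. x v ^ \<alpha> v))"
  using assms unfolding mpoly_fun_deg_def by blast

lemma mpoly_mono: "mpoly_fun_deg d p \<Longrightarrow> d \<le> e \<Longrightarrow> mpoly_fun_deg e p"
  unfolding mpoly_fun_deg_def by (meson le_trans)

lemma mpoly_const: "mpoly_fun_deg d (\<lambda>x. c)"
  by (rule mpoly_fun_degI[of "{()}" "\<lambda>_ _. 0" d _ "\<lambda>_. c"]) auto

lemma mpoly_var: "d \<ge> 1 \<Longrightarrow> mpoly_fun_deg d (\<lambda>x. x v)"
  by (rule mpoly_fun_degI[of "{()}" "\<lambda>_ w. if w = v then 1 else 0" d _ "\<lambda>_. 1"])
    (auto simp: if_distrib cong: if_cong)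

lemma mpoly_add:
  assumes "mpoly_fun_deg d p" "mpoly_fun_deg d q"
  shows "mpoly_fun_deg d (\<lambda>x. p x + q x)"
proof -
  obtain A c where A: "finite A" "\<And>\<alpha>. \<alpha> \<in> A \<Longrightarrow> (\<Sum>v\<in>UNIV. \<alpha> v) \<le> d"
    "\<And>x. p x = (\<Sum>\<alpha>\<in>A. c \<alpha> * (\<Prod>v\<in>UNIV. x v ^ \<alpha> v))" using mpoly_fun_degE[OF assms(1)] by blast
  obtain B e where B: "finite B" "\<And>\<alpha>. \<alpha> \<in> B \<Longrightarrow> (\<Sum>v\<in>UNIV. \<alpha> v) \<le> d"
    "\<And>x. q x = (\<Sum>\<alpha>\<in>B. e \<alpha> * (\<Prod>v\<in>UNIV. x v ^ \<alpha> v))" using mpoly_fun_degE[OF assms(2)] by blast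
  show ?thesis
    by (rule mpoly_fun_degI[of "A <+> B" "case_sum id id" d _ "case_sum c e"])
      (use A B in \<open>auto simp: sum.Plus\<close>)
qed

lemma mpoly_cmult:
  assumes "mpoly_fun_deg d p"
  shows "mpoly_fun_deg d (\<lambda>x. b * p x)"
proof -
  obtain A c where A: "finite A" "\<And>\<alpha>. \<alpha> \<in> A \<Longrightarrow> (\<Sum>v\<in>UNIV. \<alpha> v) \<le> d"
    "\<And>x. p x = (\<Sum>\<alpha>\<in>A. c \<alpha> * (\<Prod>v\<in>UNIV. x v ^ \<alpha> v))" using mpoly_fun_degE[OF assms] by blast
  show ?thesis
    by (rule mpoly_fun_degI[of A id d _ "\<lambda>\<alpha>. b * c \<alpha>"])
      (use A in \<open>auto simp: sum_distrib_left mult_ac\<close>)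
qed

lemma mpoly_diff:
  "mpoly_fun_deg d p \<Longrightarrow> mpoly_fun_deg d q \<Longrightarrow> mpoly_fun_deg d (\<lambda>x. p x - q x)"
  using mpoly_add[of d p "\<lambda>x. -1 * q x"] mpoly_cmult[of d q "-1"] by simp

lemma mpoly_sum:
  assumes "\<And>i. i \<in> I \<Longrightarrow> mpoly_fun_deg d (p i)"
  shows "mpoly_fun_deg d (\<lambda>x. \<Sum>i\<in>I. p i x)"
  using assms by (induction I rule: infinite_finite_induct) (auto intro: mpoly_add mpoly_const)

lemma mpoly_mult:
  assumes "mpoly_fun_deg d p" "mpoly_fun_deg d' q"
  shows "mpoly_fun_deg (d + d') (\<lambda>x. p x * q x)"
proof -
  obtain A c where A: "finite A" "\<And>\<alpha>. \<alpha> \<in> A \<Longrightarrow> (\<Sum>v\<in>UNIV. \<alpha> v) \<le> d"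
    "\<And>x. p x = (\<Sum>\<alpha>\<in>A. c \<alpha> * (\<Prod>v\<in>UNIV. x v ^ \<alpha> v))" using mpoly_fun_degE[OF assms(1)] by blast
  obtain B e where B: "finite B" "\<And>\<alpha>. \<alpha> \<in> B \<Longrightarrow> (\<Sum>v\<in>UNIV. \<alpha> v) \<le> d'"
    "\<And>x. q x = (\<Sum>\<alpha>\<in>B. e \<alpha> * (\<Prod>v\<in>UNIV. x v ^ \<alpha> v))" using mpoly_fun_degE[OF assms(2)] by blast
  show ?thesis
  proof (rule mpoly_fun_degI[of "A \<times> B" "\<lambda>(\<alpha>,\<beta>) v. \<alpha> v + \<beta> v" "d + d'" _ "\<lambda>(\<alpha>,\<beta>). c \<alpha> * e \<beta>"])
    show "p x * q x = (\<Sum>i\<in>A \<times> B. (case i of (\<alpha>, \<beta>) \<Rightarrow> c \<alpha> * e \<beta>) *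
        (\<Prod>v\<in>UNIV. x v ^ (case i of (\<alpha>, \<beta>) \<Rightarrow> \<lambda>v. \<alpha> v + \<beta> v) v))" for x
      unfolding A(3) B(3) sum_product sum.cartesian_product
      by (intro sum.cong) (auto simp: power_add prod.distrib)
  qed (use A B in \<open>auto simp: sum.distrib intro!: add_mono\<close>)
qed

lemma mpoly_prod:
  assumes "\<And>i. i \<in> I \<Longrightarrow> mpoly_fun_deg (d i) (p i)"
  shows "mpoly_fun_deg (\<Sum>i\<in>I. d i) (\<lambda>x. \<Prod>i\<in>I. p i x)"
  using assms by (induction I rule: infinite_finite_induct) (auto intro: mpoly_mult mpoly_const)

lemma mpoly_power:
  assumes "mpoly_fun_deg d p"
  shows "mpoly_fun_deg (k * d) (\<lambda>x. p x ^ k)"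
  by (induction k) (auto intro: mpoly_mult mpoly_const assms)

lemma poly_blk_mono: "poly_blk d f \<Longrightarrow> d \<le> e \<Longrightarrow> poly_blk e f"
  unfolding poly_blk_def by (rule mpoly_mono)
lemma poly_blk_const: "poly_blk d (\<lambda>x. c)"
  unfolding poly_blk_def by (rule mpoly_const)
lemma poly_blk_add: "poly_blk d f \<Longrightarrow> poly_blk d g \<Longrightarrow> poly_blk d (\<lambda>x. f x + g x)"
  unfolding poly_blk_def by (rule mpoly_add)
lemma poly_blk_diff: "poly_blk d f \<Longrightarrow> poly_blk d g \<Longrightarrow> poly_blk d (\<lambda>x. f x - g x)"
  unfolding poly_blk_def by (rule mpoly_diff)
lemma poly_blk_cmult: "poly_blk d f \<Longrightarrow> poly_blk d (\<lambda>x. c * f x)"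
  unfolding poly_blk_def by (rule mpoly_cmult)
lemma poly_blk_sum: "(\<And>i. i \<in> I \<Longrightarrow> poly_blk d (f i)) \<Longrightarrow> poly_blk d (\<lambda>x. \<Sum>i\<in>I. f i x)"
  unfolding poly_blk_def by (rule mpoly_sum)
lemma poly_blk_mult: "poly_blk d f \<Longrightarrow> poly_blk e g \<Longrightarrow> poly_blk (d + e) (\<lambda>x. f x * g x)"
  unfolding poly_blk_def by (rule mpoly_mult)
lemma poly_blk_prod:
  "(\<And>i. i \<in> I \<Longrightarrow> poly_blk (d i) (f i)) \<Longrightarrow> poly_blk (\<Sum>i\<in>I. d i) (\<lambda>x. \<Prod>i\<in>I. f i x)"
  unfolding poly_blk_def by (rule mpoly_prod)
lemma poly_blk_power: "poly_blk d f \<Longrightarrow> poly_blk (k * d) (\<lambda>x. f x ^ k)"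
  unfolding poly_blk_def by (rule mpoly_power)
lemma poly_blk_coord: "d \<ge> 1 \<Longrightarrow> poly_blk d (\<lambda>x. x $ j $ i)"
  unfolding poly_blk_def by (simp add: mpoly_var)

definition bmon :: "('m \<times> 'n \<Rightarrow> nat) \<Rightarrow> real^'n^'m \<Rightarrow> real" where
  "bmon \<alpha> x = (\<Prod>v\<in>UNIV. (x $ fst v $ snd v) ^ \<alpha> v)"

text \<open>Every assignment of reals to pairs (j, i) is the coordinate array of a point, so the
  quantifier over assignments in \<open>poly_blk\<close> may range over points.\<close>

lemma poly_blk_iff:
  fixes f :: "real^'n^'m \<Rightarrow> real"
  shows "poly_blk d f \<longleftrightarrow> (\<exists>A c. finite A \<and> (\<forall>\<alpha>\<in>A. (\<Sum>v\<in>UNIV. \<alpha> v) \<le> d) \<and>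
     (\<forall>x. f x = (\<Sum>\<alpha>\<in>A. c \<alpha> * bmon \<alpha> x)))" (is "_ \<longleftrightarrow> ?R")
proof -
  have "(\<forall>y::'m \<times> 'n \<Rightarrow> real. f (\<chi> j. \<chi> i. y (j, i)) = (\<Sum>\<alpha>\<in>A. c \<alpha> * (\<Prod>v\<in>UNIV. y v ^ \<alpha> v)))
     \<longleftrightarrow> (\<forall>x. f x = (\<Sum>\<alpha>\<in>A. c \<alpha> * bmon \<alpha> x))" for A c
  proof
    assume H: "\<forall>y::'m \<times> 'n \<Rightarrow> real. f (\<chi> j. \<chi> i. y (j, i)) = (\<Sum>\<alpha>\<in>A. c \<alpha> * (\<Prod>v\<in>UNIV. y v ^ \<alpha> v))"
    show "\<forall>x. f x = (\<Sum>\<alpha>\<in>A. c \<alpha> * bmon \<alpha> x)"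
    proof
      fix x :: "real^'n^'m"
      show "f x = (\<Sum>\<alpha>\<in>A. c \<alpha> * bmon \<alpha> x)"
        using H[rule_format, of "\<lambda>v. x $ fst v $ snd v"] by (simp add: bmon_def)
    qed
  qed (simp add: bmon_def)
  then show ?thesis unfolding poly_blk_def mpoly_fun_deg_def by simp
qed

lemma poly_blk_bmon: "(\<Sum>v\<in>UNIV. \<alpha> v) \<le> d \<Longrightarrow> poly_blk d (bmon \<alpha>)"
  unfolding poly_blk_iff by (intro exI[of _ "{\<alpha>}"] exI[of _ "\<lambda>_. 1"]) auto

lemma poly_blkE:
  assumes "poly_blk d f"
  obtains A c where "finite A" "\<And>\<alpha>. \<alpha> \<in> A \<Longrightarrow> (\<Sum>v\<in>UNIV. \<alpha> v) \<le> d"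
    "\<And>x. f x = (\<Sum>\<alpha>\<in>A. c \<alpha> * bmon \<alpha> x)"
  using assms unfolding poly_blk_iff by blast

text \<open>Makes formal derivatives available: along a line the analytic \<open>deriv\<close> in
  \<open>harmonic_fun\<close> becomes \<open>pderiv\<close> of a univariate polynomial.\<close>

lemma mpoly_line:
  fixes p :: "('v::finite \<Rightarrow> real) \<Rightarrow> real"
  assumes "mpoly_fun_deg d p"
  shows "\<exists>P :: real poly. \<forall>t. p (\<lambda>v. x v + t * w v) = poly P t"
proof -
  obtain A c where A: "finite A" "\<And>\<alpha>. \<alpha> \<in> A \<Longrightarrow> (\<Sum>v\<in>UNIV. \<alpha> v) \<le> d"
    "\<And>x. p x = (\<Sum>\<alpha>\<in>A. c \<alpha> * (\<Prod>v\<in>UNIV. x v ^ \<alpha> v))" using mpoly_fun_degE[OF assms] by blast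
  show ?thesis
    by (intro exI[of _ "\<Sum>\<alpha>\<in>A. smult (c \<alpha>) (\<Prod>v\<in>UNIV. [:x v, w v:] ^ \<alpha> v)"])
      (auto simp: A(3) poly_sum poly_prod intro!: sum.cong prod.cong)
qed

section \<open>A rotation invariant positive functional on the sphere\<close>

text \<open>A finitely supported measure, taken as a functional on all functions: linearity,
  monotonicity and exchange of order need no integrability. With a list of weighted points, sums and
  images are concatenation and mapping.\<close>

definition finpos :: "'a set \<Rightarrow> (('a \<Rightarrow> real) \<Rightarrow> real) \<Rightarrow> bool" where
  "finpos S L \<longleftrightarrow> (\<exists>ps. (\<forall>(c,y)\<in>set ps. 0 \<le> c \<and> y \<in> S) \<and> (\<forall>f. L f = (\<Sum>(c,y)\<leftarrow>ps. c * f y)))"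

lemma finposE:
  assumes "finpos S L"
  obtains ps where "\<And>c y. (c,y) \<in> set ps \<Longrightarrow> 0 \<le> c" "\<And>c y. (c,y) \<in> set ps \<Longrightarrow> y \<in> S"
    "\<And>f. L f = (\<Sum>(c,y)\<leftarrow>ps. c * f y)"
  using assms unfolding finpos_def by (auto simp: Ball_def)

lemma finpos_point: "y \<in> S \<Longrightarrow> finpos S (\<lambda>f. f y)"
  unfolding finpos_def by (intro exI[of _ "[(1,y)]"]) auto

lemma finpos_zero: "finpos S (\<lambda>f. 0)"
  unfolding finpos_def by (intro exI[of _ "[]"]) auto

lemma finpos_add: "finpos S L \<Longrightarrow> finpos S L' \<Longrightarrow> finpos S (\<lambda>f. L f + L' f)"
  unfolding finpos_def
proof (elim exE conjE, goal_cases)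
  case (1 ps qs)
  then show ?case by (intro exI[of _ "ps @ qs"]) auto
qed

lemma finpos_sum: "(\<And>i. i \<in> I \<Longrightarrow> finpos S (L i)) \<Longrightarrow> finpos S (\<lambda>f. \<Sum>i\<in>I. L i f)"
  by (induction I rule: infinite_finite_induct) (auto intro: finpos_add finpos_zero)

text \<open>Density \<open>w\<close> and push-forward along \<open>g\<close> in one. It serves to
  translate the walk and to project it radially to the sphere.\<close>

lemma finpos_weight:
  assumes "finpos S L" "\<And>y. y \<in> S \<Longrightarrow> 0 \<le> w y" "\<And>y. y \<in> S \<Longrightarrow> g y \<in> T"
  shows "finpos T (\<lambda>f. L (\<lambda>y. w y * f (g y)))"
proof -
  obtain ps where ps: "\<And>c y. (c,y) \<in> set ps \<Longrightarrow> 0 \<le> c" "\<And>c y. (c,y) \<in> set ps \<Longrightarrow> y \<in> S"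
    "\<And>f. L f = (\<Sum>(c,y)\<leftarrow>ps. c * f y)" using finposE[OF assms(1)] by blast
  show ?thesis unfolding finpos_def
    by (intro exI[of _ "map (\<lambda>(c,y). (c * w y, g y)) ps"])
      (use ps assms in \<open>auto simp: o_def case_prod_unfold mult_ac\<close>)
qed

lemma finpos_scale:
  assumes "finpos S L" "0 \<le> c" shows "finpos S (\<lambda>f. c * L f)"
proof -
  obtain ps where ps: "\<And>c y. (c,y) \<in> set ps \<Longrightarrow> 0 \<le> c" "\<And>c y. (c,y) \<in> set ps \<Longrightarrow> y \<in> S"
    "\<And>f. L f = (\<Sum>(c,y)\<leftarrow>ps. c * f y)" using finposE[OF assms(1)] by blast
  have "c * (\<Sum>(c,y)\<leftarrow>ps. c * f y) = (\<Sum>(b,y)\<leftarrow>map (\<lambda>(b,y). (c * b, y)) ps. b * f y)" for f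
    by (induction ps) (auto simp: algebra_simps)
  then show ?thesis unfolding finpos_def
    by (intro exI[of _ "map (\<lambda>(b,y). (c * b, y)) ps"]) (use ps assms in auto)
qed

context
  fixes S :: "'a set" and L assumes L: "finpos S L"
begin

lemma finpos_linear: "L (\<lambda>y. f y + g y) = L f + L g" "L (\<lambda>y. c * f y) = c * L f"
    "L (\<lambda>y. f y - g y) = L f - L g" "L (\<lambda>y. f y / c) = L f / c"
    "L (\<lambda>y. 0) = 0"
proof -
  from L obtain ps where ps: "\<And>f. L f = (\<Sum>(c,y)\<leftarrow>ps. c * f y)" unfolding finpos_def by auto
  show 1: "L (\<lambda>y. f y + g y) = L f + L g" for f g unfolding ps by (induction ps) (auto simp: algebra_simps)
  show 2: "L (\<lambda>y. c * f y) = c * L f" for c f unfolding ps by (induction ps) (auto simp: algebra_simps)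
  show "L (\<lambda>y. f y - g y) = L f - L g" using 1[of f "\<lambda>y. -1 * g y"] 2[of "-1" g] by simp
  show "L (\<lambda>y. f y / c) = L f / c" using 2[of "1/c" f] by simp
  show "L (\<lambda>y. 0) = 0" using 2[of 0 "\<lambda>_. 0"] by simp
qed

lemma finpos_commute_sum: "L (\<lambda>y. \<Sum>i\<in>I. f i y) = (\<Sum>i\<in>I. L (f i))"
  by (induction I rule: infinite_finite_induct) (auto simp: finpos_linear)

lemma finpos_commute_sum_list: "L (\<lambda>y. \<Sum>p\<leftarrow>ps. f p y) = (\<Sum>p\<leftarrow>ps. L (f p))"
  by (induction ps) (auto simp: finpos_linear)

lemma finpos_le:
  assumes "\<And>y. y \<in> S \<Longrightarrow> f y \<le> g y" shows "L f \<le> L g"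
proof -
  obtain ps where ps: "\<And>c y. (c,y) \<in> set ps \<Longrightarrow> 0 \<le> c" "\<And>c y. (c,y) \<in> set ps \<Longrightarrow> y \<in> S"
    "\<And>f. L f = (\<Sum>(c,y)\<leftarrow>ps. c * f y)" using finposE[OF L] by blast
  show ?thesis unfolding ps(3)
    by (intro sum_list_mono) (use ps assms in \<open>auto intro: mult_left_mono\<close>)
qed

lemma finpos_tendsto:
  assumes "\<And>y. y \<in> S \<Longrightarrow> (\<lambda>M. f M y) \<longlonglongrightarrow> g y"
  shows "(\<lambda>M::nat. L (f M)) \<longlonglongrightarrow> L g"
proof -
  obtain ps where ps: "\<And>c y. (c,y) \<in> set ps \<Longrightarrow> 0 \<le> c" "\<And>c y. (c,y) \<in> set ps \<Longrightarrow> y \<in> S"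
    "\<And>f. L f = (\<Sum>(c,y)\<leftarrow>ps. c * f y)" using finposE[OF L] by blast
  show ?thesis unfolding ps(3) using ps(2)
  proof (induction ps)
    case (Cons p ps)
    have "snd p \<in> S" using Cons.prems[of "fst p" "snd p"] by simp
    then show ?case using Cons.IH Cons.prems
      by (auto simp: case_prod_unfold intro!: tendsto_intros assms)
  qed simp
qed

lemma finpos_swap:
  assumes "finpos T L'" shows "L (\<lambda>y. L' (\<lambda>z. f y z)) = L' (\<lambda>z. L (\<lambda>y. f y z))"
proof -
  from assms obtain ps where ps: "\<And>f. L' f = (\<Sum>(c,y)\<leftarrow>ps. c * f y)" unfolding finpos_def by auto
  show ?thesis unfolding ps case_prod_unfold finpos_commute_sum_list finpos_linear ..
qed

end

section \<open>Moments of a random walk and their Gaussian limit\<close>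

text \<open>Expectation over one step, uniform on the 2 n vectors plus or minus sqrt n times a unit
  vector; the factor sqrt n makes the covariance the identity.\<close>

definition step_avg :: "(real^'n \<Rightarrow> real) \<Rightarrow> real" where
  "step_avg F = (\<Sum>i\<in>UNIV. F (sqrt (real CARD('n)) *\<^sub>R axis i 1) + F (- (sqrt (real CARD('n)) *\<^sub>R axis i 1)))
     / (2 * real CARD('n))"

text \<open>Expectation over the sum of M independent steps. Its moments, scaled by powers of sqrt
  M, tend to those of a standard Gaussian vector.\<close>

primrec walk :: "nat \<Rightarrow> (real^'n \<Rightarrow> real) \<Rightarrow> real" where
  "walk 0 = (\<lambda>f. f 0)"
| "walk (Suc M) = (\<lambda>f. step_avg (\<lambda>\<xi>. walk M (\<lambda>y. f (y + \<xi>))))"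

text \<open>Products of linear forms take the place of monomials: the class is stable under
  rotations, and a list allows induction that removes one factor.\<close>

definition lprod :: "(real^'n) list \<Rightarrow> real^'n \<Rightarrow> real" where
  "lprod as y = (\<Prod>a\<leftarrow>as. a \<bullet> y)"

lemma lprod_simps [simp]: "lprod [] y = 1" "lprod (a # as) y = (a \<bullet> y) * lprod as y"
  "lprod (as @ bs) y = lprod as y * lprod bs y"
  by (auto simp: lprod_def)

definition delete_nth :: "nat \<Rightarrow> 'a list \<Rightarrow> 'a list" where "delete_nth i as = take i as @ drop (Suc i) as"

lemma delete_nth_simps [simp]: "delete_nth 0 (a # as) = as" "delete_nth (Suc i) (a # as) = a # delete_nth i as"
  by (auto simp: delete_nth_def)

lemma length_delete_nth [simp]: "i < length as \<Longrightarrow> length (delete_nth i as) = length as - 1"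
  by (simp add: delete_nth_def)

lemma mset_delete_nth: "i < length as \<Longrightarrow> mset (as ! i # delete_nth i as) = mset as"
  by (metis add_mset_add_single delete_nth_def id_take_nth_drop mset.simps(2) mset_append union_mset_add_mset_right)

lemma finpos_step_avg: "finpos UNIV (step_avg :: (real^'n \<Rightarrow> real) \<Rightarrow> real)"
proof -
  have "finpos UNIV (\<lambda>F. (1 / (2 * real CARD('n))) * (\<Sum>i\<in>(UNIV::'n set).
      F (sqrt (real CARD('n)) *\<^sub>R axis i 1) + F (- (sqrt (real CARD('n)) *\<^sub>R axis i 1))))"
    by (intro finpos_scale finpos_sum finpos_add finpos_point) auto
  then show ?thesis by (simp add: step_avg_def[abs_def])
qed

lemma finpos_walk: "finpos UNIV (walk M :: (real^'n \<Rightarrow> real) \<Rightarrow> real)"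
proof (induction M)
  case 0 then show ?case by (simp add: finpos_point)
next
  case (Suc M)
  have "finpos UNIV (\<lambda>f::real^'n \<Rightarrow> real. walk M (\<lambda>y. f (y + \<xi>)))" for \<xi>
    using finpos_weight[OF Suc, of "\<lambda>_. 1" "\<lambda>y. y + \<xi>"] by simp
  then have "finpos UNIV (\<lambda>f::real^'n \<Rightarrow> real. (1 / (2 * real CARD('n))) * (\<Sum>i\<in>(UNIV::'n set).
      walk M (\<lambda>y. f (y + sqrt (real CARD('n)) *\<^sub>R axis i 1)) + walk M (\<lambda>y. f (y + - (sqrt (real CARD('n)) *\<^sub>R axis i 1)))))"
    by (intro finpos_scale finpos_sum finpos_add) (assumption+, simp)
  then show ?case by (simp add: step_avg_def[abs_def])
qed

lemma step_avg_inner: "step_avg (\<lambda>\<xi>. a \<bullet> \<xi>) = 0"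
  by (simp add: step_avg_def)

lemma step_avg_inner2: "step_avg (\<lambda>\<xi>. (a \<bullet> \<xi>) * (b \<bullet> \<xi>)) = a \<bullet> (b :: real^'n)"
proof -
  define s where "s = sqrt (real CARD('n))"
  have s: "s * s = real CARD('n)" by (simp add: s_def)
  have "step_avg (\<lambda>\<xi>. (a \<bullet> \<xi>) * (b \<bullet> \<xi>)) = (\<Sum>i\<in>UNIV. 2 * (s * s) * (a $ i * b $ i)) / (2 * real CARD('n))"
    by (simp add: step_avg_def inner_axis mult_ac flip: s_def)
  also have "\<dots> = a \<bullet> b"
    unfolding s sum_distrib_left[symmetric] by (simp add: inner_vec_def)
  finally show ?thesis .
qed

lemma step_avg_minus: "step_avg (\<lambda>\<xi>. F (- \<xi>)) = step_avg F"
  by (simp add: step_avg_def add.commute)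

lemma walk_minus: "walk M (\<lambda>y. f (- y)) = walk M f"
proof (induction M arbitrary: f)
  case (Suc M)
  have "walk (Suc M) (\<lambda>y. f (- y)) = step_avg (\<lambda>\<xi>. walk M (\<lambda>y. f (- y - \<xi>)))"
    by simp
  also have "\<dots> = step_avg (\<lambda>\<xi>. walk M (\<lambda>y. f (y - \<xi>)))"
    by (subst Suc[of "\<lambda>y. f (y - _)"]) simp
  also have "\<dots> = walk (Suc M) f"
    using step_avg_minus[of "\<lambda>\<xi>. walk M (\<lambda>y. f (y + \<xi>))"] by simp
  finally show ?case .
qed simp

text \<open>The steps of the walk are exchangeable, so \<open>a \<bullet> y\<close> may be replaced by the number of steps times
  \<open>a \<bullet> \<xi>\<close> for one of the steps \<open>\<xi>\<close>; in the limit this becomes Gaussian integration by parts.\<close>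
lemma walk_stein:
  "walk (Suc M) (\<lambda>y. (a \<bullet> y) * F y) = real (Suc M) * step_avg (\<lambda>\<xi>. (a \<bullet> \<xi>) * walk M (\<lambda>y. F (y + \<xi>)))"
proof (induction M arbitrary: F)
  case (Suc M)
  \<comment> \<open>One step \<xi> is split off: the induction hypothesis applies to the part of
    \<open>a \<bullet> y\<close> from the other steps, and the part \<open>a \<bullet> \<xi>\<close>
    already has the required form.\<close>
  have "walk (Suc (Suc M)) (\<lambda>y. (a \<bullet> y) * F y)
    = step_avg (\<lambda>\<xi>. walk (Suc M) (\<lambda>y. (a \<bullet> y) * F (y + \<xi>)) + (a \<bullet> \<xi>) * walk (Suc M) (\<lambda>y. F (y + \<xi>)))"
    by (subst walk.simps(2)) (simp only: inner_add_right distrib_right finpos_linear[OF finpos_walk])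
  also have "\<dots> = step_avg (\<lambda>\<xi>. walk (Suc M) (\<lambda>y. (a \<bullet> y) * F (y + \<xi>)))
      + step_avg (\<lambda>\<xi>. (a \<bullet> \<xi>) * walk (Suc M) (\<lambda>y. F (y + \<xi>)))"
    by (rule finpos_linear[OF finpos_step_avg])
  also have "step_avg (\<lambda>\<xi>. walk (Suc M) (\<lambda>y. (a \<bullet> y) * F (y + \<xi>)))
     = real (Suc M) * step_avg (\<lambda>\<xi>. step_avg (\<lambda>\<xi>'. (a \<bullet> \<xi>') * walk M (\<lambda>y. F (y + \<xi>' + \<xi>))))"
    by (simp only: Suc finpos_linear[OF finpos_step_avg])
  also have "step_avg (\<lambda>\<xi>. step_avg (\<lambda>\<xi>'. (a \<bullet> \<xi>') * walk M (\<lambda>y. F (y + \<xi>' + \<xi>))))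
     = step_avg (\<lambda>\<xi>'. (a \<bullet> \<xi>') * step_avg (\<lambda>\<xi>. walk M (\<lambda>y. F (y + \<xi>' + \<xi>))))"
    by (subst finpos_swap[OF finpos_step_avg finpos_step_avg])
      (simp only: finpos_linear[OF finpos_step_avg])
  also have "\<dots> = step_avg (\<lambda>\<xi>. (a \<bullet> \<xi>) * walk (Suc M) (\<lambda>y. F (y + \<xi>)))"
    by (simp add: add_ac)
  finally show ?case by (simp add: algebra_simps)
qed simp

text \<open>First-order Taylor expansion in \<xi>. Of the remainder only the degree matters: having
  lost two factors, it is negligible after scaling.\<close>

lemma lprod_shift:
  "\<exists>ps. (\<forall>(c,bs)\<in>set ps. length bs + 2 \<le> length as) \<and>
    (\<forall>y. lprod as (y + \<xi>) = lprod as y + (\<Sum>i<length as. (as ! i \<bullet> \<xi>) * lprod (delete_nth i as) y)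
       + (\<Sum>(c,bs)\<leftarrow>ps. c * lprod bs y))"
proof (induction as)
  case Nil
  show ?case by (intro exI[of _ "[]"]) simp
next
  case (Cons a as)
  then obtain ps where ps: "\<And>c bs. (c,bs)\<in>set ps \<Longrightarrow> length bs + 2 \<le> length as"
    "\<And>y. lprod as (y + \<xi>) = lprod as y + (\<Sum>i<length as. (as ! i \<bullet> \<xi>) * lprod (delete_nth i as) y)
       + (\<Sum>(c,bs)\<leftarrow>ps. c * lprod bs y)" by fast
  \<comment> \<open>Multiplying the expansion of \<open>as\<close> by
    \<open>a \<bullet> y + a \<bullet> \<xi>\<close> produces second-order terms in three ways: the
    old remainder times either summand, and the linear terms times
    \<open>a \<bullet> \<xi>\<close>.\<close>
  define qs where "qs = map (\<lambda>(c,bs). (c, a # bs)) ps @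
     map (\<lambda>i. ((a \<bullet> \<xi>) * (as ! i \<bullet> \<xi>), delete_nth i as)) [0..<length as] @
     map (\<lambda>(c,bs). ((a \<bullet> \<xi>) * c, bs)) ps"
  show ?case
  proof (intro exI[of _ qs] conjI allI)
    show "\<forall>(c,bs)\<in>set qs. length bs + 2 \<le> length (a # as)"
      using ps(1) by (fastforce simp: qs_def)
    fix y
    have *: "(\<Sum>x\<leftarrow>[0..<k]. g x) = (\<Sum>i<k. g i)" for k and g :: "nat \<Rightarrow> real"
      by (simp add: sum_list_distinct_conv_sum_set atLeast0LessThan)
    have cm: "k * (\<Sum>(c,bs)\<leftarrow>ps. c * lprod bs y) = (\<Sum>p\<leftarrow>ps. k * (fst p * lprod (snd p) y))" for k
      by (induction ps) (auto simp: algebra_simps)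
    have q: "(\<Sum>(c,bs)\<leftarrow>qs. c * lprod bs y) = (a \<bullet> y) * (\<Sum>(c,bs)\<leftarrow>ps. c * lprod bs y)
       + (a \<bullet> \<xi>) * (\<Sum>i<length as. (as ! i \<bullet> \<xi>) * lprod (delete_nth i as) y)
       + (a \<bullet> \<xi>) * (\<Sum>(c,bs)\<leftarrow>ps. c * lprod bs y)"
      unfolding cm by (simp add: qs_def o_def case_prod_unfold * sum_distrib_left mult_ac)
    have "(\<Sum>i<length (a # as). ((a # as) ! i \<bullet> \<xi>) * lprod (delete_nth i (a # as)) y)
       = (a \<bullet> \<xi>) * lprod as y + (a \<bullet> y) * (\<Sum>i<length as. (as ! i \<bullet> \<xi>) * lprod (delete_nth i as) y)"
      by (simp add: sum.lessThan_Suc_shift sum_distrib_left mult_ac del: sum.lessThan_Suc)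
    then show "lprod (a # as) (y + \<xi>) = lprod (a # as) y
       + (\<Sum>i<length (a # as). ((a # as) ! i \<bullet> \<xi>) * lprod (delete_nth i (a # as)) y)
       + (\<Sum>(c,bs)\<leftarrow>qs. c * lprod bs y)"
      unfolding q by (simp only: lprod_simps ps(2) inner_add_right) (simp only: algebra_simps)
  qed
qed

text \<open>Wick's formula for the moment \<open>\<Prod>a\<leftarrow>as. a \<bullet> g\<close> of a standard Gaussian vector \<open>g\<close>.\<close>
function wick :: "(real^'n) list \<Rightarrow> real" where
  "wick [] = 1"
| "wick (a # as) = (\<Sum>i<length as. (a \<bullet> as ! i) * wick (delete_nth i as))"
  by pat_completeness auto
termination by (relation "Wellfounded.measure length") auto

text \<open>\<open>walk_stein\<close> relates M + 1 steps to M, hence the change of normalisation;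
  any surplus power of sqrt (M + 1) beyond the degree forces the limit 0.\<close>

lemma walk_rescale:
  fixes bs :: "(real^'n) list"
  assumes "(\<lambda>M. walk M (lprod bs) / sqrt (real M) ^ length bs) \<longlonglongrightarrow> wick bs" "length bs \<le> e"
  shows "(\<lambda>M. walk M (lprod bs) / sqrt (real (Suc M)) ^ e) \<longlonglongrightarrow> (if length bs = e then wick bs else 0)"
proof -
  let ?l = "length bs"
  have "(\<lambda>M. sqrt (real M / real (Suc M))) \<longlonglongrightarrow> sqrt 1"
    by (intro tendsto_real_sqrt LIMSEQ_n_over_Suc_n)
  moreover have "(\<lambda>M. sqrt (inverse (real (Suc M)))) \<longlonglongrightarrow> sqrt 0"
    by (intro tendsto_real_sqrt LIMSEQ_inverse_real_of_nat)
  ultimately have "(\<lambda>M. walk M (lprod bs) / sqrt (real M) ^ ?l * sqrt (real M / real (Suc M)) ^ ?l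
      * sqrt (inverse (real (Suc M))) ^ (e - ?l)) \<longlonglongrightarrow> wick bs * sqrt 1 ^ ?l * sqrt 0 ^ (e - ?l)"
    by (intro tendsto_mult tendsto_power assms(1))
  also have "wick bs * sqrt 1 ^ ?l * sqrt 0 ^ (e - ?l) = (if length bs = e then wick bs else 0)"
    using assms(2) by (auto simp: power_0_left)
  finally show ?thesis
  proof (rule Lim_transform_eventually)
    show "\<forall>\<^sub>F M in sequentially. walk M (lprod bs) / sqrt (real M) ^ ?l * sqrt (real M / real (Suc M)) ^ ?l
      * sqrt (inverse (real (Suc M))) ^ (e - ?l) = walk M (lprod bs) / sqrt (real (Suc M)) ^ e"
      using eventually_gt_at_top[of 0]
    proof eventually_elim
      case (elim M)
      have "sqrt (real (Suc M)) ^ e = sqrt (real (Suc M)) ^ ?l * sqrt (real (Suc M)) ^ (e - ?l)"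
        using assms(2) by (simp flip: power_add)
      with elim show ?case
        by (simp add: real_sqrt_divide real_sqrt_inverse power_divide power_inverse field_simps del: of_nat_Suc)
    qed
  qed
qed

text \<open>The central limit theorem for moments. After \<open>walk_stein\<close> and
  \<open>lprod_shift\<close> the constant term drops out because a step has mean zero, the linear
  terms give the pairings because its covariance is the identity, and the remainder has too low a
  degree.\<close>

lemma walk_tendsto_wick:
  fixes as :: "(real^'n) list"
  shows "(\<lambda>M. walk M (lprod as) / sqrt (real M) ^ length as) \<longlonglongrightarrow> wick as"
proof (induction as rule: length_induct)
  case (1 as)
  show ?case
  proof (cases as)
    case Nil
    have [simp]: "lprod [] = (\<lambda>y::real^'n. 1)" by (rule ext) simp
    have "walk M (\<lambda>y::real^'n. 1) = 1" for M
      by (induction M) (auto simp: step_avg_def)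
    then show ?thesis by (simp add: Nil)
  next
    case (Cons a bs)
    define k where "k = length bs"
    have IH: "(\<lambda>M. walk M (lprod cs) / sqrt (real M) ^ length cs) \<longlonglongrightarrow> wick cs" if "length cs \<le> k" for cs :: "(real^'n) list"
      using 1[rule_format, of cs] that by (simp add: Cons k_def)
    obtain ps where ps: "\<And>\<xi> c cs. (c, cs) \<in> set (ps \<xi>) \<Longrightarrow> length cs + 2 \<le> k"
      and sh: "\<And>\<xi> y. lprod bs (y + \<xi>) = lprod bs y + (\<Sum>i<k. (bs ! i \<bullet> \<xi>) * lprod (delete_nth i bs) y)
       + (\<Sum>(c,cs)\<leftarrow>ps \<xi>. c * lprod cs y)"
    proof -
      have "\<exists>ps. \<forall>\<xi>. (\<forall>(c,cs)\<in>set (ps \<xi>). length cs + 2 \<le> length bs) \<and>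
        (\<forall>y. lprod bs (y + \<xi>) = lprod bs y + (\<Sum>i<length bs. (bs ! i \<bullet> \<xi>) * lprod (delete_nth i bs) y)
       + (\<Sum>(c,cs)\<leftarrow>ps \<xi>. c * lprod cs y))"
        by (intro choice allI lprod_shift)
      then show thesis using that unfolding k_def by fast
    qed
    define rem where "rem = (\<lambda>M \<xi>. (\<Sum>(c,cs)\<leftarrow>ps \<xi>. c * walk M (lprod cs)))"
    have W: "walk (Suc M) (lprod as) = real (Suc M) * ((\<Sum>i<k. (a \<bullet> bs ! i) * walk M (lprod (delete_nth i bs)))
        + step_avg (\<lambda>\<xi>. (a \<bullet> \<xi>) * rem M \<xi>))" for M
    proof -
      have "walk (Suc M) (lprod as) = walk (Suc M) (\<lambda>y. (a \<bullet> y) * lprod bs y)"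
        by (rule arg_cong[where f="walk (Suc M)"]) (auto simp: Cons)
      also have "\<dots> = real (Suc M) * step_avg (\<lambda>\<xi>. (a \<bullet> \<xi>) * walk M (\<lambda>y. lprod bs (y + \<xi>)))"
        by (rule walk_stein)
      also have "(\<lambda>\<xi>. (a \<bullet> \<xi>) * walk M (\<lambda>y. lprod bs (y + \<xi>))) =
         (\<lambda>\<xi>. walk M (lprod bs) * (a \<bullet> \<xi>) + (\<Sum>i<k. walk M (lprod (delete_nth i bs)) * ((a \<bullet> \<xi>) * (bs ! i \<bullet> \<xi>)))
           + (a \<bullet> \<xi>) * rem M \<xi>)"
        unfolding sh finpos_linear(1,2)[OF finpos_walk] finpos_commute_sum[OF finpos_walk] rem_def
          case_prod_unfold finpos_commute_sum_list[OF finpos_walk]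
        by (rule ext) (simp add: distrib_left sum_distrib_left mult_ac)
      also have "step_avg \<dots> = (\<Sum>i<k. (a \<bullet> bs ! i) * walk M (lprod (delete_nth i bs)))
        + step_avg (\<lambda>\<xi>. (a \<bullet> \<xi>) * rem M \<xi>)"
        unfolding finpos_linear(1,2)[OF finpos_step_avg] finpos_commute_sum[OF finpos_step_avg]
          step_avg_inner step_avg_inner2 by (simp add: mult_ac)
      finally show ?thesis .
    qed
    \<comment> \<open>The prefactor M + 1 from \<open>walk_stein\<close> uses up two of the k + 1
      powers of sqrt (M + 1); the k - 1 left over match the length of
      \<open>delete_nth i bs\<close>.\<close>
    have S: "sqrt (real (Suc M)) ^ length as = real (Suc M) * sqrt (real (Suc M)) ^ (k - 1)" if "k > 0" for M
    proof -
      have "length as = 2 + (k - 1)" using that by (simp add: Cons k_def)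
      then show ?thesis unfolding power_add by simp
    qed
    have "(\<lambda>M. walk (Suc M) (lprod as) / sqrt (real (Suc M)) ^ length as) \<longlonglongrightarrow> wick as"
    proof (cases "k = 0")
      case True
      then have "ps \<xi> = []" for \<xi> using ps[of "fst (hd (ps \<xi>))" "snd (hd (ps \<xi>))" \<xi>] by (cases "ps \<xi>") auto
      then have "rem = (\<lambda>_ _. 0)" by (auto simp: rem_def)
      then show ?thesis using True unfolding W by (simp add: Cons k_def finpos_linear(5)[OF finpos_step_avg])
    next
      case False
      then have k: "k > 0" by simp
      let ?q = "\<lambda>M. sqrt (real (Suc M)) ^ (k - 1)"
      have "(\<lambda>M. \<Sum>i<k. (a \<bullet> bs ! i) * (walk M (lprod (delete_nth i bs)) / ?q M)) \<longlonglongrightarrow>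
          (\<Sum>i<k. (a \<bullet> bs ! i) * wick (delete_nth i bs))"
      proof (intro tendsto_sum tendsto_mult tendsto_const)
        fix i assume i: "i \<in> {..<k}"
        then have l: "length (delete_nth i bs) = k - 1" by (simp add: k_def)
        then show "(\<lambda>M. walk M (lprod (delete_nth i bs)) / ?q M) \<longlonglongrightarrow> wick (delete_nth i bs)"
          using walk_rescale[OF IH, of "delete_nth i bs" "k - 1"] by simp
      qed
      moreover have "(\<lambda>M. step_avg (\<lambda>\<xi>. (a \<bullet> \<xi>) * (rem M \<xi> / ?q M))) \<longlonglongrightarrow> step_avg (\<lambda>\<xi>. (a \<bullet> \<xi>) * 0)"
      proof (rule finpos_tendsto[OF finpos_step_avg], intro tendsto_mult tendsto_const)
        fix \<xi> :: "real^'n"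
        have "(\<lambda>M. (\<Sum>(c,cs)\<leftarrow>qs. c * walk M (lprod cs)) / ?q M) \<longlonglongrightarrow> 0"
          if "\<And>c cs. (c, cs) \<in> set qs \<Longrightarrow> length cs + 2 \<le> k" for qs :: "(real \<times> (real^'n) list) list"
          using that
        proof (induction qs)
          case (Cons q qs)
          obtain c cs where q: "q = (c, cs)" by force
          have l: "length cs + 2 \<le> k" using Cons.prems[of c cs] q by simp
          then have "(\<lambda>M. walk M (lprod cs) / ?q M) \<longlonglongrightarrow> 0"
            using walk_rescale[OF IH, of cs "k - 1"] l by (cases "length cs = k - 1") auto
          then have "(\<lambda>M. c * (walk M (lprod cs) / ?q M) + (\<Sum>(c,cs)\<leftarrow>qs. c * walk M (lprod cs)) / ?q M) \<longlonglongrightarrow> c * 0 + 0"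
            using Cons.IH Cons.prems by (intro tendsto_intros) auto
          then show ?case by (simp add: q add_divide_distrib)
        qed simp
        from this[of "ps \<xi>"] ps show "(\<lambda>M. rem M \<xi> / ?q M) \<longlonglongrightarrow> 0"
          unfolding rem_def by blast
      qed
      ultimately have "(\<lambda>M. (\<Sum>i<k. (a \<bullet> bs ! i) * (walk M (lprod (delete_nth i bs)) / ?q M))
          + step_avg (\<lambda>\<xi>. (a \<bullet> \<xi>) * (rem M \<xi> / ?q M))) \<longlonglongrightarrow> wick as"
        by (auto dest: tendsto_add simp: Cons k_def finpos_linear(5)[OF finpos_step_avg])
      moreover have "walk (Suc M) (lprod as) / sqrt (real (Suc M)) ^ length as =
         (\<Sum>i<k. (a \<bullet> bs ! i) * (walk M (lprod (delete_nth i bs)) / ?q M))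
          + step_avg (\<lambda>\<xi>. (a \<bullet> \<xi>) * (rem M \<xi> / ?q M))" for M
        unfolding W S[OF k] times_divide_eq_right finpos_linear(4)[OF finpos_step_avg]
        by (simp add: add_divide_distrib sum_divide_distrib del: of_nat_Suc)
      ultimately show ?thesis by simp
    qed
    then show ?thesis by (rule LIMSEQ_imp_Suc)
  qed
qed

text \<open>The recursion of \<open>wick\<close> singles out the head of the list, so symmetry is
  read off from the limit: \<open>lprod\<close> does not depend on the order.\<close>

lemma wick_perm: "mset as = mset bs \<Longrightarrow> wick as = wick bs"
proof -
  assume m: "mset as = mset bs"
  then have "lprod as y = lprod bs y" for y
    unfolding lprod_def by (metis mset_map prod_mset_prod_list)
  then have "lprod as = lprod bs" by auto
  moreover have "length as = length bs" using m by (rule mset_eq_length)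
  ultimately show ?thesis
    using walk_tendsto_wick[of as] walk_tendsto_wick[of bs] by (simp add: LIMSEQ_unique)
qed

text \<open>Linearity in the first vector, with \<open>a\<close> expanded in the standard
  basis.\<close>

lemma wick_expand: "(\<Sum>k\<in>UNIV. (a \<bullet> axis k 1) * wick (axis k 1 # as)) = wick (a # as)"
proof -
  have "(\<Sum>k\<in>UNIV. (a \<bullet> axis k 1) * wick (axis k 1 # as)) =
    (\<Sum>i<length as. (\<Sum>k\<in>UNIV. (a \<bullet> axis k 1) * (axis k 1 \<bullet> as ! i)) * wick (delete_nth i as))"
    by (simp add: sum_distrib_left sum_distrib_right mult_ac) (rule sum.swap)
  also have "\<dots> = wick (a # as)"
    by (simp add: inner_axis inner_axis' inner_vec_def[of a])
  finally show ?thesis .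
qed

text \<open>The Gaussian identity E(|g|^2 F) = (n + deg F) E(F) for homogeneous F. Pairing the two
  basis vectors with each other contributes n; pairing the first with a factor of \<open>as\<close>
  contributes one copy of \<open>wick as\<close> per factor.\<close>

lemma wick_trace:
  fixes as :: "(real^'n) list"
  shows "(\<Sum>k\<in>UNIV. wick (axis k 1 # axis k 1 # as)) = (real CARD('n) + real (length as)) * wick as"
proof -
  have "(\<Sum>k\<in>UNIV. wick (axis k 1 # axis k 1 # as)) =
    (\<Sum>k\<in>(UNIV::'n set). wick as + (\<Sum>i<length as. (as ! i \<bullet> axis k 1) * wick (axis k 1 # delete_nth i as)))"
    by (subst wick.simps(2))
      (simp add: sum.lessThan_Suc_shift inner_axis_axis inner_commute del: sum.lessThan_Suc wick.simps(2))
  also have "\<dots> = real CARD('n) * wick as + (\<Sum>i<length as. wick (as ! i # delete_nth i as))"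
    by (simp only: sum.distrib sum_constant, subst sum.swap, simp only: wick_expand)
  also have "\<dots> = (real CARD('n) + real (length as)) * wick as"
  proof -
    have "(\<Sum>i<length as. wick (as ! i # delete_nth i as)) = (\<Sum>i<length as. wick as)"
      by (intro sum.cong refl wick_perm mset_delete_nth) auto
    then show ?thesis by (simp add: algebra_simps del: wick.simps)
  qed
  finally show ?thesis .
qed

section \<open>From Gaussian moments to moments of the sphere\<close>

text \<open>For even k this is E|g|^k for a standard Gaussian vector in dimension n. For odd k the
  Gaussian moments vanish, and the value just continues the recursion and stays positive.\<close>

fun sph_const :: "real \<Rightarrow> nat \<Rightarrow> real" where
  "sph_const n 0 = 1"
| "sph_const n (Suc 0) = 1"
| "sph_const n (Suc (Suc k)) = (n + real k) * sph_const n k"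

lemma sph_const_pos: "n > 0 \<Longrightarrow> sph_const n k > 0"
  by (induction n k rule: sph_const.induct) auto

text \<open>A Gaussian vector is its length times an independent uniform direction, so division by
  the radial moment leaves the moment of the uniform measure on the sphere.\<close>

definition sph_wick :: "(real^'n) list \<Rightarrow> real" where
  "sph_wick as = wick as / sph_const (real CARD('n)) (length as)"

lemma sph_wick_Nil [simp]: "sph_wick [] = 1"
  by (simp add: sph_wick_def)

text \<open>The recursion of \<open>wick\<close> with the radial constants compared. The factor
  stays on the left because it is 0 when n = 1 and \<open>as\<close> is empty.\<close>

lemma sph_wick_Cons:
  fixes as :: "(real^'n) list"
  shows "(real CARD('n) + real (length as) - 1) * sph_wick (a # as) = (\<Sum>i<length as. (a \<bullet> as ! i) * sph_wick (delete_nth i as))"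
proof (cases "length as")
  case 0
  then show ?thesis by (simp add: sph_wick_def)
next
  case (Suc k)
  have "real CARD('n) + real k > 0" by (simp add: add_pos_nonneg)
  then have "(real CARD('n) + real (length as) - 1) * sph_wick (a # as) = wick (a # as) / sph_const (real CARD('n)) k"
    by (simp add: sph_wick_def Suc del: wick.simps)
  also have "\<dots> = (\<Sum>i<length as. (a \<bullet> as ! i) * sph_wick (delete_nth i as))"
    by (simp add: sph_wick_def Suc sum_divide_distrib del: sum.lessThan_Suc)
  finally show ?thesis .
qed

lemma sph_wick_perm: "mset as = mset bs \<Longrightarrow> sph_wick as = sph_wick bs"
  unfolding sph_wick_def using wick_perm mset_eq_length by metis

text \<open>Each factor \<open>y \<bullet> y\<close> is a sum of squares of coordinates, so
  \<open>wick_trace\<close> applies once per factor and builds up \<open>sph_const\<close>.\<close>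

lemma walk_norm_tendsto:
  fixes as :: "(real^'n) list"
  shows "(\<lambda>M. walk M (\<lambda>y. (y \<bullet> y) ^ r * lprod as y) / sqrt (real M) ^ (length as + 2 * r))
     \<longlonglongrightarrow> sph_wick as * sph_const (real CARD('n)) (length as + 2 * r)"
proof (induction r arbitrary: as)
  case 0
  show ?case using walk_tendsto_wick[of as] sph_const_pos[of "real CARD('n)" "length as"]
    by (simp add: sph_wick_def)
next
  case (Suc r)
  have "(y \<bullet> y) ^ Suc r * lprod as y = (\<Sum>k\<in>UNIV. (y \<bullet> y) ^ r * lprod (axis k 1 # axis k 1 # as) y)" for y :: "real^'n"
  proof -
    have "y \<bullet> y = (\<Sum>k\<in>UNIV. (axis k 1 \<bullet> y) * (axis k 1 \<bullet> y))"
      by (subst inner_vec_def) (simp add: inner_axis')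
    then show ?thesis by (simp add: sum_distrib_left sum_distrib_right mult_ac)
  qed
  then have eq: "(\<lambda>y::real^'n. (y \<bullet> y) ^ Suc r * lprod as y) = (\<lambda>y. \<Sum>k\<in>UNIV. (y \<bullet> y) ^ r * lprod (axis k 1 # axis k 1 # as) y)"
    by (rule ext)
  have "(\<lambda>M. \<Sum>k\<in>UNIV. walk M (\<lambda>y. (y \<bullet> y) ^ r * lprod (axis k 1 # axis k 1 # as) y)
       / sqrt (real M) ^ (length (axis k 1 # axis k 1 # as) + 2 * r))
     \<longlonglongrightarrow> (\<Sum>k\<in>UNIV. sph_wick (axis k 1 # axis k 1 # as) * sph_const (real CARD('n)) (length (axis k 1 # axis k 1 # as) + 2 * r))"
    by (intro tendsto_sum Suc)
  also have "(\<Sum>k\<in>UNIV. sph_wick (axis k 1 # axis k 1 # as) * sph_const (real CARD('n)) (length (axis k 1 # axis k 1 # as) + 2 * r))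
     = (\<Sum>k\<in>UNIV. wick (axis k 1 # axis k 1 # as)) / sph_const (real CARD('n)) (length as + 2) * sph_const (real CARD('n)) (length as + 2 * Suc r)"
    by (simp add: sph_wick_def sum_distrib_right sum_divide_distrib del: wick.simps sph_const.simps)
  also have "\<dots> = sph_wick as * sph_const (real CARD('n)) (length as + 2 * Suc r)"
  proof -
    have "real CARD('n) + real (length as) > 0" by (simp add: add_pos_nonneg)
    moreover have "sph_const (real CARD('n)) (length as + 2) = (real CARD('n) + real (length as)) * sph_const (real CARD('n)) (length as)"
      by simp
    ultimately show ?thesis unfolding wick_trace by (simp add: sph_wick_def)
  qed
  finally show ?case
    unfolding eq finpos_commute_sum[OF finpos_walk] by (simp add: sum_divide_distrib)
qed

text \<open>The random walk is projected to the sphere with weight \<open>\<parallel>y\<parallel>^(2 N)\<close>, which turns the moments of even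
  degree up to \<open>2 N\<close> into polynomial moments of the walk; those of odd degree vanish by symmetry.\<close>
lemma sphere_functional:
  obtains L :: "nat \<Rightarrow> (real^'n \<Rightarrow> real) \<Rightarrow> real" where
    "\<And>M. finpos {y. norm y = 1} (L M)"
    "\<And>as. length as \<le> D \<Longrightarrow> (\<lambda>M. L M (lprod as)) \<longlonglongrightarrow> sph_wick as"
proof -
  \<comment> \<open>If 2 k is a degree up to D, then N - k is positive, so the cancellation of the
    weight against the normalised vector also holds at y = 0.\<close>
  define N where "N = Suc D"
  \<comment> \<open>The value at 0 only has to lie on the sphere, because the weight vanishes
    there.\<close>
  define nz where "nz = (\<lambda>y::real^'n. if y = 0 then axis undefined 1 else y /\<^sub>R norm y)"
  \<comment> \<open>The walk average of the weight is asymptotically M^N times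
    \<open>sph_const\<close>; this normalises the total mass to 1 in the limit.\<close>
  define C where "C = (\<lambda>M. 1 / (sqrt (real M) ^ (2 * N) * sph_const (real CARD('n)) (2 * N)))"
  define L where "L = (\<lambda>M f. C M * walk M (\<lambda>y. (y \<bullet> y) ^ N * f (nz y)))"
  have C: "C M \<ge> 0" for M
    using sph_const_pos[of "real CARD('n)" "2 * N"] by (simp add: C_def)
  have 1: "finpos {y. norm y = 1} (L M)" for M
    unfolding L_def by (intro finpos_scale finpos_weight[OF finpos_walk] C) (auto simp: nz_def)
  have sc: "lprod as (c *\<^sub>R y) = c ^ length as * lprod as y" for as and y :: "real^'n" and c
    by (induction as) auto
  have 2: "(\<lambda>M. L M (lprod as)) \<longlonglongrightarrow> sph_wick as" if "length as \<le> D" for as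
  proof (cases "even (length as)")
    case True
    then obtain k where k: "length as = 2 * k" by blast
    with that have kN: "k < N" by (simp add: N_def)
    have "(y \<bullet> y) ^ N * lprod as (nz y) = (y \<bullet> y) ^ (N - k) * lprod as y" for y
    proof (cases "y = 0")
      case False
      have "N = (N - k) + k" using kN by simp
      then have "(y \<bullet> y) ^ N = (y \<bullet> y) ^ (N - k) * (y \<bullet> y) ^ k" by (metis power_add)
      moreover have "(y \<bullet> y) ^ k = norm y ^ length as" by (simp add: k power_mult power2_norm_eq_inner)
      ultimately show ?thesis using False by (simp add: nz_def sc power_inverse)
    qed (use kN in \<open>simp add: power_0_left\<close>)
    then have "L M (lprod as) = walk M (\<lambda>y. (y \<bullet> y) ^ (N - k) * lprod as y) / sqrt (real M) ^ (length as + 2 * (N - k))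
        / sph_const (real CARD('n)) (length as + 2 * (N - k))" for M
      using kN by (simp add: L_def C_def k flip: distrib_left)
    then show ?thesis
      using tendsto_divide[OF walk_norm_tendsto[of "N - k" as] tendsto_const, of "sph_const (real CARD('n)) (length as + 2 * (N - k))"]
        sph_const_pos[of "real CARD('n)" "length as + 2 * (N - k)"] by simp
  next
    case False
    have m: "lprod as (- y) = - lprod as y" for y
      using sc[of as "-1" y] False by simp
    have "walk M (lprod as) = 0" for M
    proof -
      have "walk M (lprod as) = walk M (\<lambda>y. -1 * lprod as y)"
        using walk_minus[of M "lprod as"] by (simp add: m)
      then show ?thesis unfolding finpos_linear(2)[OF finpos_walk] by simp
    qed
    then have "(\<lambda>M. 0) \<longlonglongrightarrow> wick as" using walk_tendsto_wick[of as] by simp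
    then have w: "sph_wick as = 0" by (simp add: sph_wick_def LIMSEQ_const_iff)
    have "walk M (\<lambda>y. (y \<bullet> y) ^ N * lprod as (nz y)) = 0" for M
    proof -
      have "walk M (\<lambda>y. (y \<bullet> y) ^ N * lprod as (nz y)) = walk M (\<lambda>y. -1 * ((y \<bullet> y) ^ N * lprod as (nz y)))"
        by (subst walk_minus[symmetric], rule arg_cong[where f="walk M"], rule ext) (auto simp: nz_def m N_def)
      then show ?thesis unfolding finpos_linear(2)[OF finpos_walk] by simp
    qed
    then show ?thesis by (simp add: L_def w)
  qed
  show thesis using that 1 2 by blast
qed

section \<open>A polynomial concentrated near 1\<close>

text \<open>Moments of u = \<open>x \<bullet> y\<close> for a fixed unit vector x and uniform y, see
  \<open>sph_wick_replicate\<close>.\<close>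

fun sph_moment :: "real \<Rightarrow> nat \<Rightarrow> real" where
  "sph_moment n 0 = 1"
| "sph_moment n (Suc 0) = 0"
| "sph_moment n (Suc (Suc l)) = (real l + 1) / (n + real l) * sph_moment n l"

definition sph_mean :: "real \<Rightarrow> real poly \<Rightarrow> real" where
  "sph_mean n p = (\<Sum>i\<le>degree p. coeff p i * sph_moment n i)"

lemma sph_mean_altdef: "degree p \<le> N \<Longrightarrow> sph_mean n p = (\<Sum>i\<le>N. coeff p i * sph_moment n i)"
  unfolding sph_mean_def by (rule sum.mono_neutral_left) (auto simp: coeff_eq_0)

lemma sph_mean_add: "sph_mean n (p + q) = sph_mean n p + sph_mean n q"
proof -
  let ?N = "max (degree p) (degree q)"
  show ?thesis
    using sph_mean_altdef[of p ?N n] sph_mean_altdef[of q ?N n] sph_mean_altdef[of "p + q" ?N n]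
      degree_add_le_max[of p q] by (simp add: sum.distrib distrib_right)
qed

lemma sph_mean_smult: "sph_mean n (smult c p) = c * sph_mean n p"
  using sph_mean_altdef[of p "degree p" n] sph_mean_altdef[of "smult c p" "degree p" n]
  by (simp add: sum_distrib_left mult.assoc)

lemma sph_mean_0 [simp]: "sph_mean n 0 = 0"
  by (simp add: sph_mean_def)

lemma sph_mean_diff: "sph_mean n (p - q) = sph_mean n p - sph_mean n q"
  using sph_mean_add[of n p "smult (-1) q"] sph_mean_smult[of n "-1" q] by simp

lemma sph_mean_sum: "sph_mean n (\<Sum>i\<in>I. f i) = (\<Sum>i\<in>I. sph_mean n (f i))"
  by (induction I rule: infinite_finite_induct) (auto simp: sph_mean_add)

lemma sph_mean_monom: "sph_mean n (monom c k) = c * sph_moment n k"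
  using sph_mean_altdef[of "monom c k" k n] by (simp add: degree_monom_le if_distrib[of "\<lambda>x. x * _"] cong: if_cong)

text \<open>Integration by parts against the density of u, proportional to (1 - u^2)^((n-3)/2). On
  monomials it is the recursion of \<open>sph_moment\<close>.\<close>

lemma sph_mean_stein:
  assumes "n \<ge> 1"
  shows "sph_mean n ([:1, 0, -1:] * pderiv f) = (n - 1) * sph_mean n ([:0, 1:] * f)"
proof -
  have m: "sph_mean n ([:1, 0, -1:] * pderiv (monom c l)) = (n - 1) * sph_mean n ([:0, 1:] * monom c l)" for c l
  proof (cases l)
    case 0
    have "[:0, 1:] * monom c 0 = monom c (Suc 0)" by (simp add: monom_altdef)
    then show ?thesis using 0 by (simp add: pderiv_monom sph_mean_monom)
  next
    case (Suc k)
    have 1: "[:1, 0, -1:] * pderiv (monom c l) = monom (real l * c) k - monom (real l * c) (Suc (Suc k))"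
      unfolding Suc pderiv_monom
      by (simp add: fun_eq_iff poly_monom algebra_simps flip: poly_eq_poly_eq_iff)
    have 2: "[:0, 1:] * monom c l = monom c (Suc (Suc k))"
      by (simp add: Suc monom_altdef)
    have "n + real k > 0" using assms by simp
    then show ?thesis unfolding 1 2 sph_mean_diff sph_mean_monom
      by (simp add: Suc field_simps)
  qed
  have "f = (\<Sum>i\<le>degree f. monom (coeff f i) i)" by (simp add: poly_as_sum_of_monoms)
  then obtain I :: "nat set" and c where f: "f = (\<Sum>i\<in>I. monom (c i) i)" by metis
  have pd: "pderiv (sum g I) = (\<Sum>i\<in>I. pderiv (g i))" for g :: "nat \<Rightarrow> real poly"
    by (induction I rule: infinite_finite_induct) (auto simp: pderiv_add)
  show ?thesis unfolding f pd sum_distrib_left sph_mean_sum m ..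
qed

text \<open>Half of 1 - u, the quantity whose mean is to be made small, as a variable running
  through [0, 1].\<close>

definition zpoly :: "real poly" where "zpoly = [:1/2, -1/2:]"

lemma poly_zpoly [simp]: "poly zpoly x = (1 - x) / 2"
  by (simp add: zpoly_def)

lemma pderiv_zpoly: "pderiv zpoly = [:-1/2:]"
  by (simp add: zpoly_def pderiv_pCons)

lemma degree_zpoly: "degree zpoly = 1"
  by (simp add: zpoly_def)

text \<open>\<open>sph_mean_stein\<close> for the k-th power of z, with 1 - u^2 = 4 z (1 - z) and u
  = 1 - 2 z.\<close>

lemma sph_mean_zpoly_power_Suc:
  assumes "n \<ge> 1"
  shows "2 * (n - 1 + real k) * sph_mean n (zpoly ^ Suc k) = (n - 1 + 2 * real k) * sph_mean n (zpoly ^ k)"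
proof -
  have 1: "[:1, 0, -1:] = 4 * (zpoly * (1 - zpoly))" "[:0, 1:] = 1 - smult 2 zpoly" 
    by (simp_all add: fun_eq_iff field_simps flip: poly_eq_poly_eq_iff)
  have 2: "pderiv (zpoly ^ k) * zpoly = smult (- real k / 2) (zpoly ^ k)"
  proof (cases k)
    case (Suc l)
    show ?thesis unfolding Suc pderiv_power_Suc
      by (simp add: fun_eq_iff pderiv_zpoly field_simps flip: poly_eq_poly_eq_iff)
  qed simp
  have "[:1, 0, -1:] * pderiv (zpoly ^ k) = 4 * (1 - zpoly) * (pderiv (zpoly ^ k) * zpoly)"
    unfolding 1 by (simp only: mult_ac)
  also have "\<dots> = smult (-2 * real k) (zpoly ^ k - zpoly ^ Suc k)"
    unfolding 2 by (simp add: fun_eq_iff numeral_poly field_simps flip: poly_eq_poly_eq_iff)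
  finally have "sph_mean n (smult (-2 * real k) (zpoly ^ k - zpoly ^ Suc k)) = (n - 1) * sph_mean n ([:0, 1:] * zpoly ^ k)"
    using sph_mean_stein[OF assms, of "zpoly ^ k"] by simp
  also have "[:0, 1:] * zpoly ^ k = zpoly ^ k - smult 2 (zpoly ^ Suc k)"
    unfolding 1 by (simp add: algebra_simps)
  finally show ?thesis by (simp only: sph_mean_diff sph_mean_smult) (simp add: algebra_simps)
qed

section \<open>Alternating binomial sums as finite differences\<close>

text \<open>Pascal's rule. Up to sign the sum is a finite difference of f at 0, and this is the
  induction step for evaluating such differences.\<close>

lemma alternating_Suc:
  "(\<Sum>j\<le>Suc t. (-1)^j * real (Suc t choose j) * f j) = (\<Sum>j\<le>t. (-1)^j * real (t choose j) * (f j - f (Suc j)))"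
proof -
  have "(\<Sum>j\<le>Suc t. (-1)^j * real (Suc t choose j) * f j) =
     f 0 + (\<Sum>j\<le>t. (-1)^Suc j * real (t choose Suc j) * f (Suc j)) - (\<Sum>j\<le>t. (-1)^j * real (t choose j) * f (Suc j))"
    by (subst sum.atMost_Suc_shift) (simp add: sum_subtractf[symmetric], intro sum.cong refl, simp add: algebra_simps)
  also have "f 0 + (\<Sum>j\<le>t. (-1)^Suc j * real (t choose Suc j) * f (Suc j)) = (\<Sum>j\<le>Suc t. (-1)^j * real (t choose j) * f j)"
    using sum.atMost_Suc_shift[of "\<lambda>j. (-1)^j * real (t choose j) * f j" t] by (simp del: sum.atMost_Suc)
  also have "\<dots> = (\<Sum>j\<le>t. (-1)^j * real (t choose j) * f j)" by simp
  finally show ?thesis by (simp add: algebra_simps sum_subtractf)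
qed

text \<open>A difference lowers the degree, because a shift of the argument preserves the leading
  coefficient; t of them annihilate degree below t.\<close>

lemma alternating_poly:
  fixes P :: "real poly"
  assumes "degree P < t"
  shows "(\<Sum>j\<le>t. (-1)^j * real (t choose j) * poly P (real j)) = 0"
  using assms
proof (induction t arbitrary: P)
  case (Suc t)
  define Q where "Q = P - pcompose P [:1, 1:]"
  have Q: "poly P (real j) - poly P (real (Suc j)) = poly Q (real j)" for j
    by (simp add: Q_def poly_pcompose add.commute)
  have "degree Q \<le> degree P" unfolding Q_def by (intro degree_diff_le) (auto simp: degree_pcompose)
  moreover have "coeff Q (degree P) = 0"
    using lead_coeff_comp[of "[:1,1::real:]" P] by (simp add: Q_def degree_pcompose)
  ultimately have "Q = 0 \<or> degree Q < degree P" by (rule eq_zero_or_degree_less)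
  then have "(\<Sum>j\<le>t. (-1)^j * real (t choose j) * poly Q (real j)) = 0"
    using Suc by auto
  then show ?case unfolding alternating_Suc Q .
qed simp

text \<open>The Beta integral of s^(c-1) (1-s)^t with the power expanded. In the induction c is kept
  arbitrary, since a difference of 1/(j + c) brings in c + 1.\<close>

lemma alternating_inverse:
  assumes "c > 0"
  shows "(\<Sum>j\<le>t. (-1)^j * real (t choose j) * (1 / (real j + c))) = fact t / pochhammer c (Suc t)"
  using assms
proof (induction t arbitrary: c)
  case (Suc t)
  have "(\<Sum>j\<le>Suc t. (-1)^j * real (Suc t choose j) * (1 / (real j + c)))
    = (\<Sum>j\<le>t. (-1)^j * real (t choose j) * (1 / (real j + c))) - (\<Sum>j\<le>t. (-1)^j * real (t choose j) * (1 / (real j + (c + 1))))"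
    unfolding alternating_Suc sum_subtractf[symmetric] by (intro sum.cong) (simp_all add: right_diff_distrib add_ac)
  also have "\<dots> = fact t / pochhammer c (Suc t) - fact t / pochhammer (c + 1) (Suc t)"
    using Suc.IH[of c] Suc.IH[of "c + 1"] Suc.prems by simp
  also have "\<dots> = fact (Suc t) / pochhammer c (Suc (Suc t))"
  proof -
    define p where "p = pochhammer (c + 1) t"
    have p: "p > 0" using Suc.prems by (simp add: p_def pochhammer_pos)
    have 1: "pochhammer c (Suc t) = c * p" by (simp add: pochhammer_rec p_def)
    have 2: "pochhammer (c + 1) (Suc t) = p * (c + 1 + real t)" by (simp add: pochhammer_Suc p_def)
    have 3: "pochhammer c (Suc (Suc t)) = c * (p * (c + 1 + real t))" by (subst pochhammer_rec) (simp add: 2)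
    have "c + 1 + real t > 0" using Suc.prems by simp
    then show ?thesis unfolding 1 2 3 using p Suc.prems by (simp add: divide_simps) (simp add: algebra_simps)
  qed
  finally show ?case .
qed simp

text \<open>Division of R by j + c leaves the remainder R(-c); the quotient has degree below t and
  is annihilated, so the simple pole alone contributes.\<close>

lemma alternating_poly_inverse:
  fixes R :: "real poly"
  assumes "c > 0" "degree R \<le> t"
  shows "(\<Sum>j\<le>t. (-1)^j * real (t choose j) * (poly R (real j) / (real j + c))) = poly R (- c) * fact t / pochhammer c (Suc t)"
proof -
  have "[:- (- c), 1:] dvd R - [:poly R (- c):]" by (subst poly_eq_0_iff_dvd[symmetric]) simp
  then obtain S where S: "R - [:poly R (- c):] = [:c, 1:] * S" by (auto simp: dvd_def)
  have "S = 0 \<or> degree S < t"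
  proof (cases "S = 0")
    case False
    then have "degree ([:c, 1:] * S) = Suc (degree S)" by (subst degree_mult_eq) auto
    moreover have "degree (R - [:poly R (- c):]) \<le> t" using assms(2) by (intro degree_diff_le) auto
    ultimately show ?thesis unfolding S by simp
  qed simp
  then have 0: "(\<Sum>j\<le>t. (-1)^j * real (t choose j) * poly S (real j)) = 0"
    using alternating_poly[of S t] by auto
  have "poly R (real j) / (real j + c) = poly S (real j) + poly R (- c) * (1 / (real j + c))" for j
  proof -
    have "poly R (real j) = (real j + c) * poly S (real j) + poly R (- c)"
      using arg_cong[OF S, of "\<lambda>p. poly p (real j)"] by (simp add: algebra_simps)
    moreover have "real j + c > 0" using assms(1) by simp
    ultimately show ?thesis by (simp add: field_simps)
  qed
  then have "(\<Sum>j\<le>t. (-1)^j * real (t choose j) * (poly R (real j) / (real j + c)))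
     = 0 + poly R (- c) * (\<Sum>j\<le>t. (-1)^j * real (t choose j) * (1 / (real j + c)))"
    by (simp add: 0[symmetric] distrib_left sum.distrib sum_distrib_left mult_ac)
  then show ?thesis using alternating_inverse[OF assms(1)] by simp
qed

text \<open>Presents a Pochhammer symbol with j in its base as a polynomial in j of known degree, to
  which the difference lemmas apply.\<close>

definition poch_poly :: "real \<Rightarrow> nat \<Rightarrow> real poly" where
  "poch_poly c k = (\<Prod>r<k. [:c + real r, 1:])"

lemma poly_poch_poly: "poly (poch_poly c k) x = pochhammer (c + x) k"
  by (simp add: poch_poly_def poly_prod pochhammer_prod atLeast0LessThan add_ac)

lemma degree_poch_poly: "degree (poch_poly c k) \<le> k"
proof -
  have "degree (poch_poly c k) \<le> sum (degree \<circ> (\<lambda>r. [:c + real r, 1:])) {..<k}"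
    unfolding poch_poly_def by (rule degree_prod_sum_le) simp
  then show ?thesis by simp
qed


section \<open>A Jacobi polynomial and its means, in dimension at least 2\<close>

context
  fixes n a :: real and t :: nat
  assumes n: "n \<ge> 2" and a: "a = (n - 1) / 2"
begin

lemma sph_mean_zpoly_power: "sph_mean n (zpoly ^ k) = pochhammer a k / pochhammer (2 * a) k"
proof (induction k)
  case 0
  show ?case using sph_mean_monom[of n 1 0] by (simp add: monom_0 one_pCons)
next
  case (Suc k)
  have p: "2 * a + real k > 0" "pochhammer (2 * a) k > 0" using n by (auto simp: a pochhammer_pos add_pos_nonneg)
  have "2 * (2 * a + real k) * sph_mean n (zpoly ^ Suc k) = 2 * (a + real k) * sph_mean n (zpoly ^ k)"
    using sph_mean_zpoly_power_Suc[of n k] n by (simp add: a field_simps)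
  then have "(2 * a + real k) * sph_mean n (zpoly ^ Suc k) = (a + real k) * sph_mean n (zpoly ^ k)"
    by (simp only: mult.assoc mult_cancel_left) simp
  then have "sph_mean n (zpoly ^ Suc k) = (a + real k) / (2 * a + real k) * sph_mean n (zpoly ^ k)"
    using p by (simp add: field_simps del: power_Suc)
  then show ?case unfolding Suc by (simp add: pochhammer_Suc mult.commute)
qed

text \<open>On the sphere \<open>z = (1 - u)/2\<close> has the symmetric beta distribution with parameter \<open>a\<close>. The polynomial
  \<open>jac\<close> is the Jacobi polynomial orthogonal for that distribution weighted by \<open>z^2\<close>, so the means of
  \<open>jac^2\<close> and \<open>jac^2 * z\<close> involve only its two lowest coefficients and the means of \<open>jac\<close> and \<open>jac * z\<close>.
  The alternating binomial sums for these are evaluated as \<open>t\<close>-th differences.\<close>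
definition jac_coeff :: "nat \<Rightarrow> real" where
  "jac_coeff j = (-1)^j * real (t choose j) * (pochhammer (2 * a + real t + 1) j / pochhammer (a + 2) j)"

definition jac :: "real poly" where "jac = (\<Sum>j\<le>t. smult (jac_coeff j) (zpoly ^ j))"

definition jac_mean :: "nat \<Rightarrow> real" where "jac_mean i = (\<Sum>j\<le>t. jac_coeff j * sph_mean n (zpoly ^ (j + i)))"

lemma degree_jac: "degree jac \<le> t"
  unfolding jac_def
proof (intro degree_sum_le)
  fix j assume "j \<in> {..t}"
  then show "degree (smult (jac_coeff j) (zpoly ^ j)) \<le> t"
    by (auto intro!: order_trans[OF degree_smult_le] order_trans[OF degree_power_le] simp: degree_zpoly)
qed simp

lemma sph_mean_jac_mult: "sph_mean n (jac * zpoly ^ i) = jac_mean i"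
  by (simp add: jac_def jac_mean_def sum_distrib_right sph_mean_sum sph_mean_smult power_add)

lemma sph_mean_jac_square: "sph_mean n (jac\<^sup>2 * zpoly ^ i) = (\<Sum>j\<le>t. jac_coeff j * jac_mean (j + i))"
proof -
  have "jac\<^sup>2 * zpoly ^ i = (\<Sum>j\<le>t. smult (jac_coeff j) (zpoly ^ j)) * (jac * zpoly ^ i)"
    by (simp add: power2_eq_square jac_def[symmetric] mult_ac)
  also have "\<dots> = (\<Sum>j\<le>t. smult (jac_coeff j) (jac * zpoly ^ (j + i)))"
    by (simp add: sum_distrib_right sum_distrib_left power_add mult_ac)
  finally have "jac\<^sup>2 * zpoly ^ i = (\<Sum>j\<le>t. smult (jac_coeff j) (jac * zpoly ^ (j + i)))" .
  then show ?thesis by (simp add: sph_mean_sum sph_mean_smult sph_mean_jac_mult)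
qed

lemma poch_pos: "pochhammer (2 * a) k > 0" "pochhammer a k > 0" "pochhammer (a + 1) k > 0" "pochhammer (a + 2) k > 0"
  using n by (auto simp: a field_simps intro!: pochhammer_pos)

lemma a_pos: "a > 0" using n by (simp add: a)

text \<open>\<open>pochhammer (2 * a) (t + 1 + j)\<close> is split in two ways. This removes j from
  the denominator and leaves a polynomial in j of degree t + 1 - i.\<close>

lemma poch_ratio:
  assumes "i \<le> Suc t"
  shows "pochhammer (2 * a + real t + 1) j / pochhammer (2 * a) (j + i) = pochhammer (2 * a + real i + real j) (Suc t - i) / pochhammer (2 * a) (Suc t)"
proof -
  have "pochhammer (2 * a) (Suc t + j) = pochhammer (2 * a) (Suc t) * pochhammer (2 * a + real t + 1) j"
    by (subst pochhammer_product[of "Suc t"]) (auto simp: add_ac)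
  moreover have "pochhammer (2 * a) (Suc t + j) = pochhammer (2 * a) (j + i) * pochhammer (2 * a + real i + real j) (Suc t - i)"
    using assms by (subst pochhammer_product[of "j + i"]) (auto simp: add_ac)
  ultimately show ?thesis using poch_pos(1)[of "Suc t"] poch_pos(1)[of "j + i"] by (simp add: field_simps)
qed

lemma jac_mean_term:
  assumes "i \<le> Suc t"
  shows "jac_coeff j * sph_mean n (zpoly ^ (j + i)) = (-1)^j * real (t choose j) *
     (pochhammer a (j + i) / pochhammer (a + 2) j * (pochhammer (2 * a + real i + real j) (Suc t - i) / pochhammer (2 * a) (Suc t)))"
  unfolding jac_coeff_def sph_mean_zpoly_power poch_ratio[OF assms, symmetric] by simp

text \<open>Up to a constant the summand is the signed binomial coefficient times a polynomial in j
  of degree i + (t - 1 - i) = t - 1, so the t-th difference vanishes.\<close>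

lemma jac_orthogonal:
  assumes "i < t" shows "jac_mean (i + 2) = 0"
proof -
  define Q where "Q = poch_poly (a + 2) i * poch_poly (2 * a + 2 + real i) (t - 1 - i)"
  have "degree Q \<le> i + (t - 1 - i)"
    unfolding Q_def by (rule order_trans[OF degree_mult_le]) (intro add_mono degree_poch_poly)
  then have Q: "degree Q < t" using assms by simp
  have "jac_coeff j * sph_mean n (zpoly ^ (j + (i + 2))) =
     (a * (a + 1) / pochhammer (2 * a) (Suc t)) * ((-1)^j * real (t choose j) * poly Q (real j))" for j
  proof -
    have "pochhammer a (j + (i + 2)) = pochhammer a (2 + j) * pochhammer (a + 2 + real j) i"
      by (subst pochhammer_product[of "2 + j"]) (auto simp: add_ac)
    also have "pochhammer a (2 + j) = a * (a + 1) * pochhammer (a + 2) j"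
      by (subst pochhammer_product[of 2]) (auto simp: numeral_2_eq_2 pochhammer_Suc)
    finally have "pochhammer a (j + (i + 2)) / pochhammer (a + 2) j = a * (a + 1) * pochhammer (a + 2 + real j) i"
      using poch_pos(4)[of j] by simp
    moreover have "Suc t - (i + 2) = t - 1 - i" by simp
    ultimately show ?thesis using assms
      by (subst jac_mean_term) (simp_all add: Q_def poly_poch_poly add_ac)
  qed
  then show ?thesis unfolding jac_mean_def
    by (simp only: alternating_poly[OF Q] sum_distrib_left[symmetric])
qed

text \<open>Here the summand is a polynomial of degree t over j + a + 1; the pole at -(a + 1) gives
  the value.\<close>

lemma jac_mean_1: "jac_mean 1 = (a * (a + 1) / pochhammer (2 * a) (Suc t)) * fact t * (a / ((a + real t) * (a + real t + 1)))"
proof -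
  define Q where "Q = poch_poly (2 * a + 1) t"
  have Q: "degree Q \<le> t" unfolding Q_def by (rule degree_poch_poly)
  have "jac_coeff j * sph_mean n (zpoly ^ (j + 1)) =
     (a * (a + 1) / pochhammer (2 * a) (Suc t)) * ((-1)^j * real (t choose j) * (poly Q (real j) / (real j + (a + 1))))" for j
  proof -
    have "pochhammer a (j + 1) * (real j + (a + 1)) = pochhammer a (2 + j)"
      by (simp add: pochhammer_Suc add_ac)
    also have "\<dots> = a * (a + 1) * pochhammer (a + 2) j"
      by (subst pochhammer_product[of 2]) (auto simp: numeral_2_eq_2 pochhammer_Suc)
    finally have "pochhammer a (j + 1) * (real j + (a + 1)) = a * (a + 1) * pochhammer (a + 2) j" .
    moreover have "real j + (a + 1) \<noteq> 0" "pochhammer (a + 2) j \<noteq> 0" using a_pos poch_pos(4)[of j] by auto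
    ultimately have "pochhammer a (j + 1) / pochhammer (a + 2) j = a * (a + 1) / (real j + (a + 1))"
      by - (subst frac_eq_eq; assumption)
    then show ?thesis
      by (subst jac_mean_term, simp, simp add: Q_def poly_poch_poly add_ac, simp add: mult_ac)
  qed
  then have "jac_mean 1 = (a * (a + 1) / pochhammer (2 * a) (Suc t)) * (poly Q (- (a + 1)) * fact t / pochhammer (a + 1) (Suc t))"
    unfolding jac_mean_def using alternating_poly_inverse[OF _ Q, of "a + 1"] a_pos
    by (simp only: sum_distrib_left[symmetric])
  also have "poly Q (- (a + 1)) = pochhammer a t" by (simp add: Q_def poly_poch_poly)
  also have "pochhammer a t * fact t / pochhammer (a + 1) (Suc t) = fact t * (a / ((a + real t) * (a + real t + 1)))"
  proof -
    have "pochhammer a t * ((a + real t) * (a + real t + 1)) = a * pochhammer (a + 1) (Suc t)"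
      by (subst pochhammer_rec[symmetric]) (simp add: pochhammer_Suc algebra_simps)
    moreover have "(a + real t) * (a + real t + 1) \<noteq> 0" "pochhammer (a + 1) (Suc t) \<noteq> 0"
      using a_pos poch_pos(3)[of "Suc t"] by auto
    ultimately have "pochhammer a t / pochhammer (a + 1) (Suc t) = a / ((a + real t) * (a + real t + 1))"
      by - (subst frac_eq_eq; assumption)
    then show ?thesis by (metis mult.commute times_divide_eq_right)
  qed
  finally show ?thesis by (simp only: mult.assoc)
qed

text \<open>Without any power of z there are two simple poles, at -a and -(a + 1), separated by
  partial fractions.\<close>

lemma jac_mean_0: "jac_mean 0 = (a * (a + 1) / pochhammer (2 * a) (Suc t)) * fact t * (1 - (a - 1) * a / ((a + real t) * (a + real t + 1)))"
proof -
  define Q where "Q = poch_poly (2 * a) t"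
  have Q: "degree Q \<le> t" unfolding Q_def by (rule degree_poch_poly)
  have "jac_coeff j * sph_mean n (zpoly ^ (j + 0)) =
     (a * (a + 1) / pochhammer (2 * a) (Suc t)) * ((a + real t) * ((-1)^j * real (t choose j) * (poly Q (real j) / (real j + a)))
        - (a + real t - 1) * ((-1)^j * real (t choose j) * (poly Q (real j) / (real j + (a + 1)))))" for j
  proof -
    have "pochhammer a j * ((real j + a) * (real j + (a + 1))) = pochhammer a (2 + j)"
      by (simp add: pochhammer_Suc add_ac mult_ac)
    also have "\<dots> = a * (a + 1) * pochhammer (a + 2) j"
      by (subst pochhammer_product[of 2]) (auto simp: numeral_2_eq_2 pochhammer_Suc)
    finally have "pochhammer a j * ((real j + a) * (real j + (a + 1))) = a * (a + 1) * pochhammer (a + 2) j" .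
    moreover have p: "a + 1 + real j > 0" "a + real j > 0" using a_pos by auto
    moreover have "(real j + a) * (real j + (a + 1)) \<noteq> 0" "pochhammer (a + 2) j \<noteq> 0"
      using a_pos poch_pos(4)[of j] by auto
    ultimately have "pochhammer a j / pochhammer (a + 2) j = a * (a + 1) / ((real j + a) * (real j + (a + 1)))"
      by - (subst frac_eq_eq; assumption)
    then have 1: "pochhammer a j / pochhammer (a + 2) j = a * (a + 1) * (1 / ((real j + a) * (real j + (a + 1))))"
      by simp
    \<comment> \<open>Partial fractions: the numerator 2 a + j + t equals a + t at j = -a and a + t
      - 1 at j = -(a + 1).\<close>
    have 2: "1 / ((real j + a) * (real j + (a + 1))) * (2 * a + real j + real t) = (a + real t) / (real j + a) - (a + real t - 1) / (real j + (a + 1))"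
      using p by (simp add: divide_simps) (simp add: algebra_simps)
    have 3: "pochhammer (2 * a + real j) (Suc t) = (2 * a + real j + real t) * poly Q (real j)"
      by (simp add: Q_def poly_poch_poly pochhammer_Suc)
    have "jac_coeff j * sph_mean n (zpoly ^ (j + 0)) = (-1)^j * real (t choose j) * (a * (a + 1) / pochhammer (2 * a) (Suc t)) *
       (1 / ((real j + a) * (real j + (a + 1))) * (2 * a + real j + real t)) * poly Q (real j)"
      by (subst jac_mean_term, simp, simp add: 1 3, simp add: mult_ac)
    also have "\<dots> = (-1)^j * real (t choose j) * (a * (a + 1) / pochhammer (2 * a) (Suc t)) *
       ((a + real t) / (real j + a) - (a + real t - 1) / (real j + (a + 1))) * poly Q (real j)"
      unfolding 2 ..
    also have "\<dots> = (a * (a + 1) / pochhammer (2 * a) (Suc t)) * ((a + real t) * ((-1)^j * real (t choose j) * (poly Q (real j) / (real j + a)))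
        - (a + real t - 1) * ((-1)^j * real (t choose j) * (poly Q (real j) / (real j + (a + 1)))))"
    proof -
      have "s * k * (A / x - B / y) * P = k * (A * (s * (P / x)) - B * (s * (P / y)))" for s k A B x y P :: real
        by (simp add: algebra_simps)
      then show ?thesis .
    qed
    finally show ?thesis .
  qed
  then have "jac_mean 0 = (a * (a + 1) / pochhammer (2 * a) (Suc t)) *
     ((a + real t) * (poly Q (- a) * fact t / pochhammer a (Suc t)) - (a + real t - 1) * (poly Q (- (a + 1)) * fact t / pochhammer (a + 1) (Suc t)))"
    unfolding jac_mean_def using alternating_poly_inverse[OF _ Q, of "a + 1"] alternating_poly_inverse[OF _ Q, of a] a_pos
    by (simp only: sum_distrib_left[symmetric] sum_subtractf)
  also have "poly Q (- a) = pochhammer a t" by (simp add: Q_def poly_poch_poly)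
  also have "poly Q (- (a + 1)) = pochhammer (a - 1) t" by (simp add: Q_def poly_poch_poly)
  also have "(a + real t) * (pochhammer a t * fact t / pochhammer a (Suc t)) = fact t"
  proof -
    have "pochhammer a t \<noteq> 0" "a + real t \<noteq> 0" using poch_pos(2)[of t] a_pos by auto
    then show ?thesis by (simp add: pochhammer_Suc)
  qed
  also have "(a + real t - 1) * (pochhammer (a - 1) t * fact t / pochhammer (a + 1) (Suc t)) = fact t * ((a - 1) * a / ((a + real t) * (a + real t + 1)))"
  proof -
    have 1: "a * pochhammer (a + 1) (Suc t) = pochhammer a t * ((a + real t) * (a + real t + 1))"
      by (subst pochhammer_rec[symmetric]) (simp add: pochhammer_Suc algebra_simps)
    have 2: "pochhammer (a - 1) t * (a + real t - 1) = (a - 1) * pochhammer a t"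
      using pochhammer_Suc[of "a - 1" t] pochhammer_rec[of "a - 1" t] by (simp add: algebra_simps)
    have 3: "(a + real t) * (a + real t + 1) > 0" using a_pos by simp
    have "(a + real t - 1) * (pochhammer (a - 1) t * fact t / pochhammer (a + 1) (Suc t)) = fact t * ((a - 1) * pochhammer a t / pochhammer (a + 1) (Suc t))"
      unfolding 2[symmetric] by simp
    also have "pochhammer a t / pochhammer (a + 1) (Suc t) = a / ((a + real t) * (a + real t + 1))"
      using 1 3 poch_pos(3)[of "Suc t"] by (simp add: field_simps)
    then have "(a - 1) * pochhammer a t / pochhammer (a + 1) (Suc t) = (a - 1) * a / ((a + real t) * (a + real t + 1))"
      by (simp only: times_divide_eq_right[symmetric])
    finally show ?thesis .
  qed
  finally show ?thesis by (simp only: right_diff_distrib mult_1_right mult.assoc)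
qed

text \<open>Orthogonality leaves two terms of the first mean and one of the second. With the common
  positive factor W/q removed, the inequality follows from a (a + 2) \<le> n^2.\<close>

lemma jac_moments:
  assumes "t \<ge> 1"
  shows "sph_mean n (jac\<^sup>2) > 0" "2 * real t ^ 2 * sph_mean n (jac\<^sup>2 * zpoly) \<le> n ^ 2 * sph_mean n (jac\<^sup>2)"
proof -
  obtain s where s: "t = Suc s" using assms by (cases t) auto
  have "(\<Sum>j\<le>t. jac_coeff j * jac_mean (j + 0)) = jac_coeff 0 * jac_mean 0 + jac_coeff 1 * jac_mean 1 + (\<Sum>j<s. jac_coeff (Suc (Suc j)) * jac_mean (j + 2))"
    unfolding s by (simp add: sum.atMost_Suc_shift lessThan_Suc_atMost[symmetric] sum.lessThan_Suc_shift del: sum.lessThan_Suc sum.atMost_Suc)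
  also have "(\<Sum>j<s. jac_coeff (Suc (Suc j)) * jac_mean (j + 2)) = 0"
    by (intro sum.neutral ballI) (subst jac_orthogonal, auto simp: s)
  finally have A: "sph_mean n (jac\<^sup>2) = jac_mean 0 - real t * (2 * a + real t + 1) / (a + 2) * jac_mean 1"
    using sph_mean_jac_square[of 0] by (simp add: jac_coeff_def)
  have "(\<Sum>j\<le>t. jac_coeff j * jac_mean (j + 1)) = jac_coeff 0 * jac_mean 1 + (\<Sum>j<t. jac_coeff (Suc j) * jac_mean (j + 2))"
    by (subst lessThan_Suc_atMost[symmetric], subst sum.lessThan_Suc_shift) simp
  also have "(\<Sum>j<t. jac_coeff (Suc j) * jac_mean (j + 2)) = 0"
    by (intro sum.neutral ballI) (subst jac_orthogonal, auto)
  finally have B: "sph_mean n (jac\<^sup>2 * zpoly) = jac_mean 1"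
    using sph_mean_jac_square[of 1] by (simp add: jac_coeff_def)
  define W where "W = (a * (a + 1) / pochhammer (2 * a) (Suc t)) * fact t"
  define q where "q = (a + real t) * (a + real t + 1)"
  have W: "W > 0" unfolding W_def using a_pos by (intro mult_pos_pos divide_pos_pos) (auto simp: poch_pos)
  have q: "q > 0" unfolding q_def using a_pos by simp
  have B': "jac_mean 1 = W / q * a" unfolding jac_mean_1 W_def q_def by simp
  have A': "sph_mean n (jac\<^sup>2) = W / q * (2 * (real t ^ 2 + (2 * a + 1) * real t) / (a + 2) + 2 * a)"
  proof -
    have "sph_mean n (jac\<^sup>2) = W / q * (q - (a - 1) * a - real t * (2 * a + real t + 1) / (a + 2) * a)"
    proof -
      have W': "W * (1 - x / q) = W / q * (q - x)" for x using q by (simp add: field_simps)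
      have "jac_mean 0 = W / q * (q - (a - 1) * a)"
        unfolding W'[symmetric] unfolding jac_mean_0 W_def q_def ..
      then show ?thesis unfolding A B' by (simp add: right_diff_distrib mult_ac)
    qed
    also have "q - (a - 1) * a - real t * (2 * a + real t + 1) / (a + 2) * a = 2 * (real t ^ 2 + (2 * a + 1) * real t) / (a + 2) + 2 * a"
      using a_pos by (simp add: q_def divide_simps) (simp add: algebra_simps power2_eq_square)
    finally show ?thesis .
  qed
  show "sph_mean n (jac\<^sup>2) > 0"
    unfolding A' using W q a_pos by (intro mult_pos_pos divide_pos_pos add_nonneg_pos divide_nonneg_pos) auto
  have "2 * real t ^ 2 * a \<le> n ^ 2 * (2 * (real t ^ 2 + (2 * a + 1) * real t) / (a + 2) + 2 * a)"
  proof -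
    \<comment> \<open>For a = (n - 1)/2 the product a (a + 2) is (n^2 + 2 n - 3)/4, which n \<ge> 2
      bounds by n^2.\<close>
    have "2 * n \<le> n * n" using n by (intro mult_right_mono) auto
    moreover have "a * (a + 2) = (n * n + 2 * n - 3) / 4" by (simp add: a field_simps)
    moreover have "0 \<le> n * n" by simp
    moreover have "2 * n \<le> x \<Longrightarrow> y = (x + 2 * n - 3) / 4 \<Longrightarrow> 0 \<le> x \<Longrightarrow> y \<le> x" for x y :: real
      by simp
    ultimately have "a * (a + 2) \<le> n * n" by blast
    then have "a * (a + 2) \<le> n ^ 2" by (simp only: power2_eq_square)
    then have "2 * real t ^ 2 * (a * (a + 2)) \<le> 2 * real t ^ 2 * n ^ 2" by (intro mult_left_mono) auto
    then have "2 * real t ^ 2 * a \<le> n ^ 2 * (2 * real t ^ 2 / (a + 2))" using a_pos by (simp add: field_simps)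
    also have "\<dots> \<le> n ^ 2 * (2 * (real t ^ 2 + (2 * a + 1) * real t) / (a + 2) + 2 * a)"
      using a_pos by (intro mult_left_mono add_increasing2 divide_right_mono) auto
    finally show ?thesis .
  qed
  then have "W / q * (2 * real t ^ 2 * a) \<le> W / q * (n ^ 2 * (2 * (real t ^ 2 + (2 * a + 1) * real t) / (a + 2) + 2 * a))"
    using W q by (intro mult_left_mono) auto
  then show "2 * real t ^ 2 * sph_mean n (jac\<^sup>2 * zpoly) \<le> n ^ 2 * sph_mean n (jac\<^sup>2)"
    unfolding A' B B' by (simp only: mult_ac)
qed

end

text \<open>The square of P is the kernel as a function of \<open>x \<bullet> y\<close>: it has
  total mass 1 and little mass away from 1.\<close>

lemma exists_concentrated_square:
  assumes "N \<ge> 1" "t \<ge> 1"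
  obtains P where "degree P \<le> t" "sph_mean (real N) (P\<^sup>2) = 1"
    "sph_mean (real N) (P\<^sup>2 * [:1, -1:]) \<le> real N ^ 2 / real t ^ 2"
proof -
  let ?n = "real N"
  obtain Q where Q: "degree Q \<le> t" "sph_mean ?n (Q\<^sup>2) > 0"
     "2 * real t ^ 2 * sph_mean ?n (Q\<^sup>2 * zpoly) \<le> ?n ^ 2 * sph_mean ?n (Q\<^sup>2)"
  proof (cases "N = 1")
    case False
    then have n: "?n \<ge> 2" using assms(1) by simp
    show thesis using that[OF degree_jac jac_moments] n assms(2) by blast
  next
    case True
    \<comment> \<open>For n = 1 the sphere is the two points u = 1 and u = -1. Since 1 - z = (1 +
      u)/2 vanishes at the second, all mass sits at u = 1.\<close>
    let ?Q = "1 - zpoly"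
    have 0: "sph_mean 1 1 = 1" using sph_mean_monom[of 1 1 0] by (simp add: monom_0 one_pCons)
    have 1: "sph_mean 1 zpoly = 1 / 2" using sph_mean_altdef[of zpoly 1 1] by (simp add: zpoly_def)
    have 2: "sph_mean 1 (zpoly ^ 2) = 1 / 2"
      using sph_mean_zpoly_power_Suc[of 1 1] 1 by (simp add: numeral_2_eq_2)
    have 3: "sph_mean 1 (zpoly ^ 3) = 1 / 2"
      using sph_mean_zpoly_power_Suc[of 1 2] 2 by (simp add: numeral_3_eq_3 numeral_2_eq_2)
    have e1: "?Q\<^sup>2 = 1 - smult 2 zpoly + zpoly ^ 2" and e2: "?Q\<^sup>2 * zpoly = zpoly - smult 2 (zpoly ^ 2) + zpoly ^ 3"
      using smult_add_left[of 1 1 zpoly] smult_add_left[of 1 1 "zpoly * zpoly"]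
      by (simp_all add: power2_eq_square power3_eq_cube algebra_simps)
    show thesis
    proof (rule that[of ?Q])
      show "degree ?Q \<le> t" using assms(2) by (intro degree_diff_le) (auto simp: degree_zpoly)
      show "sph_mean ?n (?Q\<^sup>2) > 0"
        unfolding e1 by (simp only: True sph_mean_add sph_mean_diff sph_mean_smult) (simp add: 0 1 2)
      have "sph_mean ?n (?Q\<^sup>2 * zpoly) = 0"
        unfolding e2 by (simp only: True sph_mean_add sph_mean_diff sph_mean_smult) (simp add: 1 2 3)
      then show "2 * real t ^ 2 * sph_mean ?n (?Q\<^sup>2 * zpoly) \<le> ?n ^ 2 * sph_mean ?n (?Q\<^sup>2)"
        using \<open>sph_mean ?n (?Q\<^sup>2) > 0\<close> by simp
    qed
  qed
  define c where "c = 1 / sqrt (sph_mean ?n (Q\<^sup>2))"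
  have c: "c\<^sup>2 = 1 / sph_mean ?n (Q\<^sup>2)" using Q(2) by (simp add: c_def power_divide)
  have sq: "(smult c Q)\<^sup>2 = smult (c\<^sup>2) (Q\<^sup>2)" by (simp add: power2_eq_square)
  show thesis
  proof (rule that[of "smult c Q"])
    show "degree (smult c Q) \<le> t" using Q(1) degree_smult_le le_trans by blast
    show "sph_mean ?n ((smult c Q)\<^sup>2) = 1" unfolding sq sph_mean_smult c using Q(2) by simp
    have "(smult c Q)\<^sup>2 * [:1, -1:] = smult (2 * c\<^sup>2) (Q\<^sup>2 * zpoly)"
      unfolding sq by (simp add: fun_eq_iff algebra_simps flip: poly_eq_poly_eq_iff)
    then have "sph_mean ?n ((smult c Q)\<^sup>2 * [:1, -1:]) = 2 * sph_mean ?n (Q\<^sup>2 * zpoly) / sph_mean ?n (Q\<^sup>2)"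
      by (simp add: sph_mean_smult c)
    also have "\<dots> \<le> ?n ^ 2 / real t ^ 2" using Q(2,3) assms(2) by (simp add: field_simps)
    finally show "sph_mean ?n ((smult c Q)\<^sup>2 * [:1, -1:]) \<le> ?n ^ 2 / real t ^ 2" .
  qed
qed

section \<open>The truncated quadratic module\<close>

text \<open>Independence of powers in each variable passes to products: with all variables but one
  fixed, the identity is univariate. The conclusion sums over all indices with exponent \<beta> on
  S, since indices that differ elsewhere may agree there.\<close>

lemma grid_monomials_independent:
  fixes U :: "'v \<Rightarrow> real set" and e :: "'i \<Rightarrow> 'v \<Rightarrow> nat"
  assumes uni: "\<And>v c F. v \<in> S \<Longrightarrow> finite F \<Longrightarrow> F \<subseteq> E v \<Longrightarrow> (\<And>x. x \<in> U v \<Longrightarrow> (\<Sum>a\<in>F. c a * x ^ a) = 0) \<Longrightarrow> (\<forall>a\<in>F. c a = (0::real))"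
    and "finite S" "finite I" "\<And>i v. i \<in> I \<Longrightarrow> v \<in> S \<Longrightarrow> e i v \<in> E v"
    and "\<And>x. (\<And>v. v \<in> S \<Longrightarrow> x v \<in> U v) \<Longrightarrow> (\<Sum>i\<in>I. c i * (\<Prod>v\<in>S. x v ^ e i v)) = 0"
  shows "(\<Sum>i\<in>{i\<in>I. \<forall>v\<in>S. e i v = \<beta> v}. c i) = 0"
  using assms(2,1,3-)
proof (induction S arbitrary: I rule: finite_induct)
  case empty
  then show ?case using empty(4)[of "\<lambda>_. 0"] by simp
next
  case (insert v S)
  show ?case
  proof (cases "\<beta> v \<in> (\<lambda>i. e i v) ` I")
    case False
    then have "\<forall>i\<in>I. e i v \<noteq> \<beta> v" by (metis imageI)
    then have "{i\<in>I. \<forall>w\<in>insert v S. e i w = \<beta> w} = {}" by auto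
    then show ?thesis by (simp only: sum.empty)
  next
    case True
    let ?J = "{i\<in>I. e i v = \<beta> v}"
    have "(\<Sum>i\<in>{i\<in>?J. \<forall>w\<in>S. e i w = \<beta> w}. c i) = 0"
    proof (rule insert.IH)
      show "finite ?J" using insert.prems(2) by simp
      show "\<forall>a\<in>F. c' a = 0" if "w \<in> S" "finite F" "F \<subseteq> E w" "\<And>x. x \<in> U w \<Longrightarrow> (\<Sum>a\<in>F. c' a * x ^ a) = 0"
        for w c' F using insert.prems(1)[of w F c'] that by simp
      fix x assume x: "\<And>w. w \<in> S \<Longrightarrow> x w \<in> U w"
      have "\<forall>a\<in>(\<lambda>i. e i v) ` I. (\<Sum>i\<in>{i\<in>I. e i v = a}. c i * (\<Prod>w\<in>S. x w ^ e i w)) = 0"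
      proof (rule insert.prems(1)[of v])
        fix u assume u: "u \<in> U v"
        have "(\<Sum>a\<in>(\<lambda>i. e i v) ` I. (\<Sum>i\<in>{i\<in>I. e i v = a}. c i * (\<Prod>w\<in>S. x w ^ e i w)) * u ^ a)
          = (\<Sum>a\<in>(\<lambda>i. e i v) ` I. (\<Sum>i\<in>{i\<in>I. e i v = a}. c i * (\<Prod>w\<in>S. x w ^ e i w) * u ^ e i v))"
          by (auto simp: sum_distrib_right intro!: sum.cong)
        also have "\<dots> = (\<Sum>i\<in>I. c i * (\<Prod>w\<in>S. x w ^ e i w) * u ^ e i v)"
          by (rule sum.image_gen[OF insert.prems(2), symmetric])
        also have "\<dots> = (\<Sum>i\<in>I. c i * (\<Prod>w\<in>insert v S. (x(v := u)) w ^ e i w))"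
        proof (intro sum.cong refl)
          fix i
          have "(\<Prod>w\<in>S. (x(v := u)) w ^ e i w) = (\<Prod>w\<in>S. x w ^ e i w)"
            using insert.hyps by (intro prod.cong) auto
          then show "c i * (\<Prod>w\<in>S. x w ^ e i w) * u ^ e i v = c i * (\<Prod>w\<in>insert v S. (x(v := u)) w ^ e i w)"
            using insert.hyps by simp
        qed
        also have "\<dots> = 0" by (rule insert.prems(4)) (use x u in auto)
        finally show "(\<Sum>a\<in>(\<lambda>i. e i v) ` I. (\<Sum>i\<in>{i\<in>I. e i v = a}. c i * (\<Prod>w\<in>S. x w ^ e i w)) * u ^ a) = 0" .
      qed (use insert.prems in auto)
      then show "(\<Sum>i\<in>?J. c i * (\<Prod>w\<in>S. x w ^ e i w)) = 0" using True by blast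
    qed (use insert.prems in \<open>auto\<close>)
    also have "{i\<in>?J. \<forall>w\<in>S. e i w = \<beta> w} = {i\<in>I. \<forall>w\<in>insert v S. e i w = \<beta> w}" by auto
    finally show ?thesis .
  qed
qed

lemma powers_indep_infinite:
  assumes "infinite (U :: real set)" "finite F" "\<And>x. x \<in> U \<Longrightarrow> (\<Sum>a\<in>F. c a * x ^ a) = 0"
  shows "\<forall>a\<in>F. c a = 0"
proof -
  let ?P = "\<Sum>a\<in>F. monom (c a) a"
  have "U \<subseteq> {x. poly ?P x = 0}" using assms(3) by (auto simp: poly_sum poly_monom)
  then have "?P = 0" using assms(1) poly_roots_finite[of ?P] finite_subset by blast
  then have "coeff ?P a = 0" for a by simp
  moreover have "coeff ?P a = c a" if "a \<in> F" for a using that assms(2) by (simp add: coeff_sum)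
  ultimately show ?thesis by simp
qed

lemma powers_indep_sign:
  assumes "F \<subseteq> {0, 1::nat}" "\<And>x. x \<in> {-1, 1::real} \<Longrightarrow> (\<Sum>a\<in>F. c a * x ^ a) = 0"
  shows "\<forall>a\<in>F. c a = 0"
proof -
  have "F = {} \<or> F = {0} \<or> F = {1} \<or> F = {0, 1}" using assms(1) by blast
  then show ?thesis using assms(2)[of 1] assms(2)[of "-1"] by auto
qed

definition fin_functional :: "'x set \<Rightarrow> (('x \<Rightarrow> real) \<Rightarrow> real) \<Rightarrow> bool" where
  "fin_functional X L \<longleftrightarrow> (\<exists>X0 w. finite X0 \<and> X0 \<subseteq> X \<and> (\<forall>g. L g = (\<Sum>x\<in>X0. w x * g x)))"

lemma fin_functional_point: "x \<in> X \<Longrightarrow> fin_functional X (\<lambda>g. g x)"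
  unfolding fin_functional_def by (intro exI[of _ "{x}"] exI[of _ "\<lambda>_. 1"]) auto

lemma fin_functional_cmult: "fin_functional X L \<Longrightarrow> fin_functional X (\<lambda>g. c * L g)"
  unfolding fin_functional_def
proof (elim exE conjE, goal_cases)
  case (1 X0 w)
  then show ?case by (intro exI[of _ X0] exI[of _ "\<lambda>x. c * w x"]) (auto simp: sum_distrib_left mult.assoc)
qed

lemma fin_functional_add:
  assumes "fin_functional X L" "fin_functional X L'" shows "fin_functional X (\<lambda>g. L g + L' g)"
proof -
  from assms obtain A u B v where A: "finite A" "A \<subseteq> X" "\<And>g. L g = (\<Sum>x\<in>A. u x * g x)"
    and B: "finite B" "B \<subseteq> X" "\<And>g. L' g = (\<Sum>x\<in>B. v x * g x)"
    unfolding fin_functional_def by auto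
  have "L g + L' g = (\<Sum>x\<in>A\<union>B. ((if x \<in> A then u x else 0) + (if x \<in> B then v x else 0)) * g x)" for g
  proof -
    have "(\<Sum>x\<in>A\<union>B. (if x \<in> A then u x else 0) * g x) = L g"
      unfolding A(3) by (rule sum.mono_neutral_cong_right) (use A B in auto)
    moreover have "(\<Sum>x\<in>A\<union>B. (if x \<in> B then v x else 0) * g x) = L' g"
      unfolding B(3) by (rule sum.mono_neutral_cong_right) (use A B in auto)
    ultimately show ?thesis by (simp add: distrib_right sum.distrib)
  qed
  then show ?thesis unfolding fin_functional_def using A B
    by (intro exI[of _ "A \<union> B"] exI[of _ "\<lambda>x. (if x \<in> A then u x else 0) + (if x \<in> B then v x else 0)"]) auto
qed

lemma fin_functional_sum:
  "(\<And>i. i \<in> I \<Longrightarrow> fin_functional X (L i)) \<Longrightarrow> fin_functional X (\<lambda>g. \<Sum>i\<in>I. L i g)"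
proof (induction I rule: infinite_finite_induct)
  case (insert i I)
  then show ?case by (simp add: fin_functional_add)
qed (auto simp: fin_functional_def intro!: exI[of _ "{}"])

lemma fin_functional_linear:
  assumes "fin_functional X L"
  shows "L (\<lambda>x. \<Sum>a\<in>A. c a * f a x) = (\<Sum>a\<in>A. c a * L (f a))"
proof -
  from assms obtain X0 w where "\<And>g. L g = (\<Sum>x\<in>X0. w x * g x)"
    unfolding fin_functional_def by auto
  then show ?thesis by (simp add: sum_distrib_left mult_ac) (rule sum.swap)
qed

text \<open>Elimination. Subtracting from \<open>f b\<close> its part along the earlier functions
  leaves u, which by independence is nonzero at some point z of X; a corrected evaluation at z is
  dual to \<open>f b\<close>, and the old functionals are corrected by multiples of it.\<close>

lemma dual_functionals:
  fixes f :: "'a \<Rightarrow> 'x \<Rightarrow> real"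
  assumes "finite A" "\<And>c. (\<And>x. x \<in> X \<Longrightarrow> (\<Sum>a\<in>A. c a * f a x) = 0) \<Longrightarrow> \<forall>a\<in>A. c a = 0"
  shows "\<exists>L. \<forall>a\<in>A. fin_functional X (L a) \<and> (\<forall>b\<in>A. L a (f b) = (if a = b then 1 else 0))"
  using assms
proof (induction A rule: finite_induct)
  case (insert b A)
  have ex: "\<exists>L. \<forall>a\<in>A. fin_functional X (L a) \<and> (\<forall>b\<in>A. L a (f b) = (if a = b then 1 else 0))"
  proof (rule insert.IH)
    fix c assume c: "\<And>x. x \<in> X \<Longrightarrow> (\<Sum>a\<in>A. c a * f a x) = 0"
    have "(\<Sum>a\<in>insert b A. (if a = b then 0 else c a) * f a x) = (\<Sum>a\<in>A. c a * f a x)" for x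
      using insert.hyps by (simp, intro sum.cong) auto
    then have "\<forall>a\<in>insert b A. (if a = b then 0 else c a) = 0"
      by (intro insert.prems) (simp add: c)
    then show "\<forall>a\<in>A. c a = 0" using insert.hyps by (metis insertCI)
  qed
  from ex obtain L where LL: "\<forall>a\<in>A. fin_functional X (L a) \<and> (\<forall>b\<in>A. L a (f b) = (if a = b then 1 else 0))" ..
  then have L: "\<And>a. a \<in> A \<Longrightarrow> fin_functional X (L a)"
    "\<And>a a'. a \<in> A \<Longrightarrow> a' \<in> A \<Longrightarrow> L a (f a') = (if a = a' then 1 else 0)" by simp_all
  define u where "u = (\<lambda>x. f b x - (\<Sum>a\<in>A. L a (f b) * f a x))"
  have "\<exists>x\<in>X. u x \<noteq> 0"
  proof (rule ccontr)
    assume "\<not> (\<exists>x\<in>X. u x \<noteq> 0)"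
    then have u: "\<And>x. x \<in> X \<Longrightarrow> u x = 0" by blast
    have "(\<Sum>a\<in>insert b A. (if a = b then 1 else - L a (f b)) * f a x) = u x" for x
    proof -
      have "(\<Sum>a\<in>A. (if a = b then 1 else - L a (f b)) * f a x) = (\<Sum>a\<in>A. - (L a (f b) * f a x))"
        using insert.hyps by (intro sum.cong) auto
      then show ?thesis using insert.hyps by (simp add: u_def sum_negf)
    qed
    then have "\<forall>a\<in>insert b A. (if a = b then 1 else - L a (f b)) = 0"
      by (intro insert.prems) (simp add: u)
    then show False by auto
  qed
  then obtain z where z: "z \<in> X" "u z \<noteq> 0" by blast
  define Lb where "Lb = (\<lambda>g. (1 / u z) * (g z + (\<Sum>a\<in>A. - f a z * L a g)))"
  have Lb: "fin_functional X Lb"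
    unfolding Lb_def by (intro fin_functional_cmult fin_functional_add fin_functional_sum fin_functional_point z L)
  have Lb_A: "Lb (f a) = 0" if "a \<in> A" for a
    unfolding Lb_def using that insert.hyps(1) by (simp add: L if_distrib cong: if_cong)
  have Lb_b: "Lb (f b) = 1"
    using z(2) by (simp add: Lb_def sum_negf) (simp add: u_def mult.commute)
  define L' where "L' = (\<lambda>a. if a = b then Lb else (\<lambda>g. L a g + (- L a (f b)) * Lb g))"
  show ?case
  proof (intro exI[of _ L'] ballI conjI)
    fix a a' assume a: "a \<in> insert b A" and a': "a' \<in> insert b A"
    show "fin_functional X (L' a)"
    proof (cases "a = b")
      case True
      then show ?thesis using Lb by (simp add: L'_def)
    next
      case False
      then have "a \<in> A" using a by simp
      then have "fin_functional X (\<lambda>g. L a g + (- L a (f b)) * Lb g)"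
        by (intro fin_functional_add fin_functional_cmult L(1) Lb)
      then show ?thesis using False by (simp only: L'_def if_False)
    qed
    show "L' a (f a') = (if a = a' then 1 else 0)"
      using a a' insert.hyps by (auto simp: L'_def Lb_A Lb_b L)
  qed
qed auto

text \<open>A dual functional is a finite combination of point values, so it bounds its coefficient
  by the values at finitely many points. Applied to normal forms on \<open>Xset\<close> and to
  powers of r in (0, 1).\<close>

lemma coeff_bound:
  fixes f :: "'a \<Rightarrow> 'x \<Rightarrow> real"
  assumes "finite A" "\<And>c. (\<And>x. x \<in> X \<Longrightarrow> (\<Sum>a\<in>A. c a * f a x) = 0) \<Longrightarrow> \<forall>a\<in>A. c a = 0"
  obtains X0 C where "finite X0" "X0 \<subseteq> X" "C \<ge> 0"
    "\<And>c a. a \<in> A \<Longrightarrow> \<bar>c a\<bar> \<le> C * (\<Sum>x\<in>X0. \<bar>\<Sum>b\<in>A. c b * f b x\<bar>)"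
proof -
  from dual_functionals[OF assms] obtain L
    where LL: "\<forall>a\<in>A. fin_functional X (L a) \<and> (\<forall>b\<in>A. L a (f b) = (if a = b then 1 else 0))" ..
  then have L: "\<And>a. a \<in> A \<Longrightarrow> fin_functional X (L a)"
    "\<And>a a'. a \<in> A \<Longrightarrow> a' \<in> A \<Longrightarrow> L a (f a') = (if a = a' then 1 else 0)" by simp_all
  have "\<forall>a\<in>A. \<exists>X0 w. finite X0 \<and> X0 \<subseteq> X \<and> (\<forall>g. L a g = (\<Sum>x\<in>X0. w x * g x))"
    using L(1) unfolding fin_functional_def by blast
  then obtain Y w where Y: "\<And>a. a \<in> A \<Longrightarrow> finite (Y a)" "\<And>a. a \<in> A \<Longrightarrow> Y a \<subseteq> X"
    "\<And>a g. a \<in> A \<Longrightarrow> L a g = (\<Sum>x\<in>Y a. w a x * g x)" by metis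
  define C where "C = (\<Sum>a\<in>A. \<Sum>x\<in>Y a. \<bar>w a x\<bar>)"
  show thesis
  proof (rule that[of "\<Union>a\<in>A. Y a" C])
    show "finite (\<Union>a\<in>A. Y a)" "(\<Union>a\<in>A. Y a) \<subseteq> X" "C \<ge> 0"
      using Y(1,2) assms(1) by (auto simp: C_def sum_nonneg)
    fix c :: "'a \<Rightarrow> real" and a assume a: "a \<in> A"
    let ?g = "\<lambda>x. \<Sum>b\<in>A. c b * f b x" and ?S = "\<Sum>x\<in>(\<Union>a\<in>A. Y a). \<bar>\<Sum>b\<in>A. c b * f b x\<bar>"
    have "L a ?g = c a"
      using fin_functional_linear[OF L(1)[OF a], where A=A and c=c and f=f] a assms(1)
      by (simp add: L(2) if_distrib cong: if_cong)
    then have "\<bar>c a\<bar> = \<bar>\<Sum>x\<in>Y a. w a x * ?g x\<bar>" using Y(3)[OF a] by simp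
    also have "\<dots> \<le> (\<Sum>x\<in>Y a. \<bar>w a x\<bar> * ?S)"
    proof (rule order_trans[OF sum_abs], intro sum_mono)
      fix x assume x: "x \<in> Y a"
      have "\<bar>?g x\<bar> \<le> ?S"
        by (rule member_le_sum) (use x a Y(1) assms(1) in auto)
      then show "\<bar>w a x * ?g x\<bar> \<le> \<bar>w a x\<bar> * ?S" by (simp add: abs_mult mult_left_mono)
    qed
    also have "\<dots> = (\<Sum>x\<in>Y a. \<bar>w a x\<bar>) * ?S" by (simp add: sum_distrib_right)
    also have "\<dots> \<le> C * ?S" unfolding C_def
      by (intro mult_right_mono member_le_sum[of a A "\<lambda>a. \<Sum>x\<in>Y a. \<bar>w a x\<bar>"]) (use a assms(1) in \<open>auto intro!: sum_nonneg\<close>)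
    finally show "\<bar>c a\<bar> \<le> C * ?S" .
  qed
qed


section \<open>Closure properties of the truncated module and bounds for monomials\<close>

lemma sos_deg_0: "sos_deg k (\<lambda>x. 0)"
  unfolding sos_deg_def using poly_blk_const by (intro conjI exI[of _ "[]"]) auto

lemma sos_deg_square: "poly_blk s g \<Longrightarrow> sos_deg (2 * s) (\<lambda>x. (g x)\<^sup>2)"
  unfolding sos_deg_def using poly_blk_power[of s g 2] by (intro conjI exI[of _ "[g]"]) auto

lemma sos_deg_add: "sos_deg k f \<Longrightarrow> sos_deg k g \<Longrightarrow> sos_deg k (\<lambda>x. f x + g x)"
  unfolding sos_deg_def
proof (elim conjE exE, goal_cases)
  case (1 gs hs)
  have "poly_blk k (\<lambda>x. f x + g x)" using 1 by (intro poly_blk_add)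
  then show ?case using 1 by (intro conjI exI[of _ "gs @ hs"]) auto
qed

lemma sos_deg_cmult: "sos_deg k f \<Longrightarrow> 0 \<le> c \<Longrightarrow> sos_deg k (\<lambda>x. c * f x)"
  unfolding sos_deg_def
proof (elim conjE exE, goal_cases)
  case (1 gs)
  have "c * (\<Sum>g\<leftarrow>gs. (g x)\<^sup>2) = (\<Sum>g\<leftarrow>map (\<lambda>g x. sqrt c * g x) gs. (g x)\<^sup>2)" for x
    using 1(1) by (induction gs) (auto simp: distrib_left power_mult_distrib)
  moreover have "poly_blk k (\<lambda>x. c * f x)" using 1 by (intro poly_blk_cmult)
  moreover have "\<forall>g\<in>set gs. \<exists>e. poly_blk e (\<lambda>x. sqrt c * g x)" using 1 poly_blk_cmult by blast
  ultimately show ?case using 1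
    by (intro conjI exI[of _ "map (\<lambda>g x. sqrt c * g x) gs"]) auto
qed

lemma in_T_sos: "sos_deg (2 * s) f \<Longrightarrow> in_T s f"
  unfolding in_T_def by (intro exI[of _ f] exI[of _ "\<lambda>_ _. 0"]) (auto intro: poly_blk_const)

lemma in_T_ideal: "(\<And>j. poly_blk (2 * s - 2) (h j)) \<Longrightarrow> in_T s (\<lambda>x. \<Sum>j\<in>UNIV. h j x * (1 - (norm (x $ j))\<^sup>2))"
  unfolding in_T_def by (intro exI[of _ "\<lambda>_. 0"] exI[of _ h]) (auto intro: sos_deg_0)

lemma sum_single_block:
  fixes x :: "real^'n^'m"
  shows "(\<Sum>i\<in>UNIV. (if i = j then h else (\<lambda>_. 0)) x * (1 - (norm (x $ i))\<^sup>2)) = h x * (1 - (norm (x $ j))\<^sup>2)"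
proof -
  have "(\<Sum>i\<in>UNIV. (if i = j then h else (\<lambda>_. 0)) x * (1 - (norm (x $ i))\<^sup>2))
    = (\<Sum>i\<in>UNIV. if i = j then h x * (1 - (norm (x $ j))\<^sup>2) else 0)"
    by (intro sum.cong) auto
  then show ?thesis by simp
qed

lemma in_T_ideal1:
  assumes "poly_blk (2 * s - 2) h" shows "in_T s (\<lambda>x. h x * (1 - (norm (x $ j))\<^sup>2))"
proof -
  have "in_T s (\<lambda>x. \<Sum>i\<in>UNIV. (if i = j then h else (\<lambda>_. 0)) x * (1 - (norm (x $ i))\<^sup>2))"
    by (rule in_T_ideal) (auto intro: assms poly_blk_const)
  moreover have "(\<Sum>i\<in>UNIV. (if i = j then h else (\<lambda>_. 0)) x * (1 - (norm (x $ i))\<^sup>2)) = h x * (1 - (norm (x $ j))\<^sup>2)" for x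
    by (rule sum_single_block)
  ultimately show ?thesis by (simp only:)
qed

lemma in_T_add: "in_T s f \<Longrightarrow> in_T s g \<Longrightarrow> in_T s (\<lambda>x. f x + g x)"
  unfolding in_T_def
proof (elim exE conjE, goal_cases)
  case (1 \<sigma> \<sigma>' h h')
  show ?case
    by (intro exI[of _ "\<lambda>x. \<sigma> x + \<sigma>' x"] exI[of _ "\<lambda>j x. h j x + h' j x"])
      (use 1 in \<open>auto simp: distrib_right sum.distrib intro: sos_deg_add poly_blk_add\<close>)
qed

lemma in_T_cmult: "in_T s f \<Longrightarrow> 0 \<le> c \<Longrightarrow> in_T s (\<lambda>x. c * f x)"
  unfolding in_T_def
proof (elim exE conjE, goal_cases)
  case (1 \<sigma> h)
  show ?case
    by (intro exI[of _ "\<lambda>x. c * \<sigma> x"] exI[of _ "\<lambda>j x. c * h j x"])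
      (use 1 in \<open>auto simp: distrib_left sum_distrib_left mult.assoc intro: sos_deg_cmult poly_blk_cmult\<close>)
qed

lemma in_T_const: "0 \<le> c \<Longrightarrow> in_T s (\<lambda>x. c)"
  using in_T_sos[OF sos_deg_square[OF poly_blk_const[of s "sqrt c"]]] by simp

lemma in_T_sum: "(\<And>i. i \<in> I \<Longrightarrow> in_T s (f i)) \<Longrightarrow> in_T s (\<lambda>x. \<Sum>i\<in>I. f i x)"
  by (induction I rule: infinite_finite_induct) (simp_all add: in_T_add in_T_const)

lemma bmon_add: "bmon (\<lambda>v. \<alpha> v + \<beta> v) x = bmon \<alpha> x * bmon \<beta> x"
  by (simp add: bmon_def power_add prod.distrib)

lemma bmon_upd: "bmon (\<alpha>(v := \<alpha> v + k)) x = bmon \<alpha> x * (x $ fst v $ snd v) ^ k"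
proof -
  have "\<alpha>(v := \<alpha> v + k) = (\<lambda>w. \<alpha> w + (if w = v then k else 0))" by auto
  then have "bmon (\<alpha>(v := \<alpha> v + k)) x = bmon \<alpha> x * bmon (\<lambda>w. if w = v then k else 0) x"
    by (simp only: bmon_add)
  also have "bmon (\<lambda>w. if w = v then k else 0) x = (\<Prod>w\<in>UNIV. if w = v then (x $ fst w $ snd w) ^ k else 1)"
    unfolding bmon_def by (intro prod.cong) auto
  also have "\<dots> = (x $ fst v $ snd v) ^ k" by simp
  finally show ?thesis .
qed

lemma sum_upd: "(\<Sum>w\<in>UNIV. (\<alpha>(v := \<alpha> v + k)) w) = (\<Sum>w\<in>UNIV. \<alpha> w) + (k::nat)" for v :: "'v::finite"
proof -
  have "\<alpha>(v := \<alpha> v + k) = (\<lambda>w. \<alpha> w + (if w = v then k else 0))" by auto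
  then show ?thesis by (simp only: sum.distrib) simp
qed

lemma norm_sq_split: "(norm (x :: real^'n))\<^sup>2 = (x $ i)\<^sup>2 + (\<Sum>k\<in>UNIV - {i}. (x $ k)\<^sup>2)"
  unfolding power2_norm_eq_inner inner_vec_def by (subst sum.remove[of UNIV i]) (simp_all add: power2_eq_square)

lemma exponent_decompose:
  fixes \<alpha> :: "'v::finite \<Rightarrow> nat" assumes "\<alpha> v > 0"
  obtains \<beta> where "\<alpha> = \<beta>(v := \<beta> v + 1)"
  using assms that[of "\<alpha>(v := \<alpha> v - 1)"] by auto

text \<open>One variable of block j is added at a time: 1 - p^2 x_i^2 is (1 - p^2) plus p^2 (1 -
  |x_j|^2) plus the squares of p x_l for l other than i. As p has degree below s, the multiplier p^2
  stays within degree 2 s - 2.\<close>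

lemma in_T_one_minus_bmon_square:
  "(\<Sum>v\<in>UNIV. \<beta> v) \<le> s \<Longrightarrow> in_T s (\<lambda>x::real^'n^'m. 1 - (bmon \<beta> x)\<^sup>2)"
proof (induction "\<Sum>v\<in>UNIV. \<beta> v" arbitrary: \<beta>)
  case 0
  then have "\<beta> = (\<lambda>_. 0)" by auto
  then show ?case by (simp add: bmon_def in_T_const)
next
  case (Suc k)
  then obtain v where "\<beta> v > 0" by (metis neq0_conv sum.neutral Zero_not_Suc)
  then obtain \<gamma> where \<gamma>: "\<beta> = \<gamma>(v := \<gamma> v + 1)" by (rule exponent_decompose)
  obtain j i where v: "v = (j, i)" by force
  have deg: "(\<Sum>v\<in>UNIV. \<gamma> v) = k" using Suc(2) sum_upd[of \<gamma> v 1] by (simp add: \<gamma>)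
  have "1 - (bmon \<beta> x)\<^sup>2 = (1 - (bmon \<gamma> x)\<^sup>2) + ((\<Sum>l\<in>UNIV - {i}. (bmon \<gamma> x * x $ j $ l)\<^sup>2)
      + (bmon \<gamma> x)\<^sup>2 * (1 - (norm (x $ j))\<^sup>2))" for x
    unfolding \<gamma> bmon_upd v norm_sq_split[of _ i]
    by (simp add: algebra_simps power_mult_distrib sum_distrib_left)
  moreover have "in_T s (\<lambda>x. (1 - (bmon \<gamma> x)\<^sup>2) + ((\<Sum>l\<in>UNIV - {i}. (bmon \<gamma> x * x $ j $ l)\<^sup>2)
      + (bmon \<gamma> x)\<^sup>2 * (1 - (norm (x $ j))\<^sup>2)))"
  proof (intro in_T_add in_T_sum in_T_ideal1)
    show "in_T s (\<lambda>x. 1 - (bmon \<gamma> x)\<^sup>2)" using Suc deg by simp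
    show "in_T s (\<lambda>x. (bmon \<gamma> x * x $ j $ l)\<^sup>2)" for l
      using Suc(2,3) deg
      by (intro in_T_sos sos_deg_square poly_blk_mono[OF poly_blk_mult[OF poly_blk_bmon poly_blk_coord]]) auto
    show "poly_blk (2 * s - 2) (\<lambda>x. (bmon \<gamma> x)\<^sup>2)"
      using Suc(2,3) deg
      by (intro poly_blk_mono[OF poly_blk_power[OF poly_blk_bmon]]) auto
  qed
  ultimately show ?case by (simp only:)
qed

lemma exponent_split:
  fixes \<alpha> :: "'v::finite \<Rightarrow> nat"
  assumes "k \<le> (\<Sum>v\<in>UNIV. \<alpha> v)"
  obtains \<beta> \<gamma> where "\<alpha> = (\<lambda>v. \<beta> v + \<gamma> v)" "(\<Sum>v\<in>UNIV. \<beta> v) = k"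
proof -
  have "\<exists>\<beta>. (\<forall>v. \<beta> v \<le> \<alpha> v) \<and> (\<Sum>v\<in>UNIV. \<beta> v) = k" using assms
  proof (induction k)
    case 0 then show ?case by (intro exI[of _ "\<lambda>_. 0"]) auto
  next
    case (Suc k)
    then obtain \<beta> where \<beta>: "\<forall>v. \<beta> v \<le> \<alpha> v" "(\<Sum>v\<in>UNIV. \<beta> v) = k" by auto
    have "\<exists>v. \<beta> v < \<alpha> v"
    proof (rule ccontr)
      assume "\<not> ?thesis"
      then have "\<beta> = \<alpha>" using \<beta>(1) by (auto simp: not_less intro: antisym)
      then show False using \<beta>(2) Suc.prems by simp
    qed
    then obtain v where "\<beta> v < \<alpha> v" by blast
    then show ?case using \<beta> sum_upd[of \<beta> v 1] by (intro exI[of _ "\<beta>(v := \<beta> v + 1)"]) auto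
  qed
  then obtain \<beta> where \<beta>: "\<And>v. \<beta> v \<le> \<alpha> v" "(\<Sum>v\<in>UNIV. \<beta> v) = k" by blast
  show thesis by (rule that[of \<beta> "\<lambda>v. \<alpha> v - \<beta> v"]) (use \<beta> in auto)
qed

text \<open>The monomial is split into two factors of degree at most s; their product is bounded by
  half the sum of their squares, each at most 1 in the module.\<close>

lemma in_T_one_plus_bmon:
  assumes "(\<Sum>v\<in>UNIV. \<alpha> v) \<le> 2 * s" "\<epsilon>\<^sup>2 = 1"
  shows "in_T s (\<lambda>x::real^'n^'m. 1 + \<epsilon> * bmon \<alpha> x)"
proof -
  obtain \<beta> \<gamma> where \<alpha>: "\<alpha> = (\<lambda>v. \<beta> v + \<gamma> v)" and \<beta>: "(\<Sum>v\<in>UNIV. \<beta> v) = min s (\<Sum>v\<in>UNIV. \<alpha> v)"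
    by (rule exponent_split[of "min s (\<Sum>v\<in>UNIV. \<alpha> v)" \<alpha>]) auto
  have "(\<Sum>v\<in>UNIV. \<alpha> v) = (\<Sum>v\<in>UNIV. \<beta> v) + (\<Sum>v\<in>UNIV. \<gamma> v)" by (simp add: \<alpha> sum.distrib)
  then have deg: "(\<Sum>v\<in>UNIV. \<beta> v) \<le> s" "(\<Sum>v\<in>UNIV. \<gamma> v) \<le> s" using \<beta> assms(1) by auto
  have "1 + \<epsilon> * bmon \<alpha> x = 1/2 * (bmon \<beta> x + \<epsilon> * bmon \<gamma> x)\<^sup>2 + (1/2 * (1 - (bmon \<beta> x)\<^sup>2) + 1/2 * (1 - (bmon \<gamma> x)\<^sup>2))" for x
    unfolding \<alpha> bmon_add power2_sum power_mult_distrib assms(2) by (simp add: field_simps)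
  moreover have "in_T s (\<lambda>x. 1/2 * (bmon \<beta> x + \<epsilon> * bmon \<gamma> x)\<^sup>2 + (1/2 * (1 - (bmon \<beta> x)\<^sup>2) + 1/2 * (1 - (bmon \<gamma> x)\<^sup>2)))"
    using deg by (intro in_T_add in_T_cmult in_T_one_minus_bmon_square in_T_sos sos_deg_square poly_blk_add poly_blk_cmult poly_blk_bmon) auto
  ultimately show ?thesis by (simp only:)
qed

lemma in_T_bmon_bound:
  assumes "(\<Sum>v\<in>UNIV. \<alpha> v) \<le> 2 * s" "\<bar>c\<bar> \<le> K"
  shows "in_T s (\<lambda>x::real^'n^'m. c * bmon \<alpha> x + K)"
proof -
  have "c * bmon \<alpha> x + K = \<bar>c\<bar> * (1 + (if c \<ge> 0 then 1 else -1) * bmon \<alpha> x) + (K - \<bar>c\<bar>)" for x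
    by (simp add: algebra_simps abs_if)
  moreover have "in_T s (\<lambda>x. \<bar>c\<bar> * (1 + (if c \<ge> 0 then 1 else -1) * bmon \<alpha> x) + (K - \<bar>c\<bar>))"
    using assms by (intro in_T_add in_T_cmult in_T_one_plus_bmon in_T_const) auto
  ultimately show ?thesis by (simp only:)
qed

text \<open>Exponents of normal forms modulo the ideal: the relation \<open>\<parallel>x $ j\<parallel>^2 = 1\<close> eliminates squares of the
  coordinate \<open>i0\<close> in every block. The corresponding monomials are linearly independent on \<open>Xset\<close>.\<close>
definition red_exps :: "'n \<Rightarrow> nat \<Rightarrow> ('m::finite \<times> 'n::finite \<Rightarrow> nat) set" where
  "red_exps i0 k = {\<alpha>. (\<Sum>v\<in>UNIV. \<alpha> v) \<le> k \<and> (\<forall>j. \<alpha> (j, i0) \<le> 1)}"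

lemma finite_red_exps: "finite (red_exps i0 k :: ('m::finite \<times> 'n::finite \<Rightarrow> nat) set)"
proof (rule finite_subset)
  show "(red_exps i0 k :: ('m \<times> 'n \<Rightarrow> nat) set) \<subseteq> PiE UNIV (\<lambda>_. {..k})"
  proof
    fix \<alpha> :: "'m \<times> 'n \<Rightarrow> nat" assume "\<alpha> \<in> red_exps i0 k"
    then have "(\<Sum>v\<in>UNIV. \<alpha> v) \<le> k" by (simp add: red_exps_def)
    moreover have "\<alpha> v \<le> (\<Sum>v\<in>UNIV. \<alpha> v)" for v by (rule member_le_sum) auto
    ultimately show "\<alpha> \<in> PiE UNIV (\<lambda>_. {..k})" by (auto intro: order_trans)
  qed
qed (auto intro: finite_PiE)

definition reducible :: "'n \<Rightarrow> nat \<Rightarrow> (real^'n^'m \<Rightarrow> real) \<Rightarrow> bool" where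
  "reducible i0 s f \<longleftrightarrow> (\<exists>c h. (\<forall>j. poly_blk (2 * s - 2) (h j)) \<and>
     (\<forall>x. f x = (\<Sum>\<alpha>\<in>red_exps i0 (2 * s). c \<alpha> * bmon \<alpha> x) + (\<Sum>j\<in>UNIV. h j x * (1 - (norm (x $ j))\<^sup>2))))"

lemma reducible_add: "reducible i0 s f \<Longrightarrow> reducible i0 s g \<Longrightarrow> reducible i0 s (\<lambda>x. f x + g x)"
  unfolding reducible_def
proof (elim exE conjE, goal_cases)
  case (1 c c' h h')
  show ?case
    by (intro exI[of _ "\<lambda>\<alpha>. c \<alpha> + c' \<alpha>"] exI[of _ "\<lambda>j x. h j x + h' j x"])
      (use 1 in \<open>auto simp: distrib_right sum.distrib intro: poly_blk_add\<close>)
qed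

lemma reducible_cmult: "reducible i0 s f \<Longrightarrow> reducible i0 s (\<lambda>x. b * f x)"
  unfolding reducible_def
proof (elim exE conjE, goal_cases)
  case (1 c h)
  show ?case
    by (intro exI[of _ "\<lambda>\<alpha>. b * c \<alpha>"] exI[of _ "\<lambda>j x. b * h j x"])
      (use 1 in \<open>auto simp: distrib_left sum_distrib_left mult.assoc intro: poly_blk_cmult\<close>)
qed

lemma reducible_ideal:
  assumes "poly_blk (2 * s - 2) h" shows "reducible i0 s (\<lambda>x. h x * (1 - (norm (x $ j))\<^sup>2))"
proof -
  have "(\<Sum>i\<in>UNIV. (if i = j then h else (\<lambda>_. 0)) x * (1 - (norm (x $ i))\<^sup>2)) = h x * (1 - (norm (x $ j))\<^sup>2)" for x
    by (rule sum_single_block)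
  then show ?thesis unfolding reducible_def
    by (intro exI[of _ "\<lambda>_. 0"] exI[of _ "\<lambda>i. if i = j then h else (\<lambda>_. 0)"]) (auto intro: assms poly_blk_const)
qed

lemma reducible_sum: "(\<And>i. i \<in> I \<Longrightarrow> reducible i0 s (f i)) \<Longrightarrow> reducible i0 s (\<lambda>x. \<Sum>i\<in>I. f i x)"
proof (induction I rule: infinite_finite_induct)
  case (insert i I)
  then show ?case by (simp add: reducible_add)
qed (auto simp: reducible_def intro!: exI[of _ "\<lambda>_. 0"] exI[of _ "\<lambda>_ _. 0"] poly_blk_const)

text \<open>Replacing a square of coordinate \<open>i0\<close> of a block by 1 minus the other
  squares keeps the degree within 2 s and lowers the total exponent of the coordinates
  \<open>i0\<close>, which is the induction measure.\<close>

lemma reducible_bmon: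
  "(\<Sum>v\<in>UNIV. \<alpha> v) \<le> 2 * s \<Longrightarrow> reducible i0 s (bmon \<alpha> :: real^'n^'m \<Rightarrow> real)"
proof (induction "\<Sum>j\<in>(UNIV::'m set). \<alpha> (j, i0)" arbitrary: \<alpha> rule: less_induct)
  case less
  show ?case
  proof (cases "\<forall>j. \<alpha> (j, i0) \<le> 1")
    case True
    then have "\<alpha> \<in> red_exps i0 (2 * s)" using less.prems by (simp add: red_exps_def)
    moreover have "(\<Sum>\<beta>\<in>red_exps i0 (2 * s). (if \<beta> = \<alpha> then 1 else 0) * bmon \<beta> x)
       = (\<Sum>\<beta>\<in>red_exps i0 (2 * s). if \<beta> = \<alpha> then bmon \<alpha> x else 0)" for x :: "real^'n^'m"
      by (intro sum.cong) auto
    ultimately show ?thesis unfolding reducible_def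
      by (intro exI[of _ "\<lambda>\<beta>. if \<beta> = \<alpha> then 1 else 0"] exI[of _ "\<lambda>_ _. 0"])
        (auto simp: finite_red_exps intro: poly_blk_const)
  next
    case False
    then obtain j where j: "\<alpha> (j, i0) \<ge> 2" by (metis not_less_eq_eq numeral_2_eq_2 One_nat_def)
    define \<gamma> where "\<gamma> = \<alpha>((j, i0) := \<alpha> (j, i0) - 2)"
    have \<alpha>: "\<alpha> = \<gamma>((j, i0) := \<gamma> (j, i0) + 2)" by (rule ext) (use j in \<open>auto simp: \<gamma>_def\<close>)
    have deg: "(\<Sum>v\<in>UNIV. \<gamma> v) + 2 \<le> 2 * s" using less.prems sum_upd[of \<gamma> "(j,i0)" 2] unfolding \<alpha>[symmetric] by simp
    have m: "(\<Sum>j'\<in>UNIV. \<gamma> (j', i0)) < (\<Sum>j'\<in>UNIV. \<alpha> (j', i0))"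
      by (rule sum_strict_mono_ex1) (use j in \<open>auto simp: \<gamma>_def intro!: exI[of _ j]\<close>)
    have "bmon \<alpha> x = bmon \<gamma> x + (-1) * ((\<Sum>i\<in>UNIV - {i0}. bmon (\<gamma>((j, i) := \<gamma> (j, i) + 2)) x)
       + bmon \<gamma> x * (1 - (norm (x $ j))\<^sup>2))" for x :: "real^'n^'m"
      unfolding \<alpha> bmon_upd norm_sq_split[of _ i0] fst_conv snd_conv
      by (simp add: algebra_simps sum_distrib_left)
    moreover have "reducible i0 s (\<lambda>x. bmon \<gamma> x + (-1) * ((\<Sum>i\<in>UNIV - {i0}. bmon (\<gamma>((j, i) := \<gamma> (j, i) + 2)) x)
       + bmon \<gamma> x * (1 - (norm (x $ j))\<^sup>2)) :: real)"
    proof (intro reducible_add reducible_cmult reducible_sum reducible_ideal)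
      show "reducible i0 s (\<lambda>x::real^'n^'m. bmon \<gamma> x)" using less.hyps[OF m] deg by simp
      show "reducible i0 s (\<lambda>x::real^'n^'m. bmon (\<gamma>((j, i) := \<gamma> (j, i) + 2)) x)" if "i \<in> UNIV - {i0}" for i
      proof (rule less.hyps)
        have "(\<Sum>j'\<in>UNIV. (\<gamma>((j, i) := \<gamma> (j, i) + 2)) (j', i0)) = (\<Sum>j'\<in>UNIV. \<gamma> (j', i0))"
          using that by (intro sum.cong) auto
        then show "(\<Sum>j'\<in>UNIV. (\<gamma>((j, i) := \<gamma> (j, i) + 2)) (j', i0)) < (\<Sum>j'\<in>UNIV. \<alpha> (j', i0))" using m by simp
        show "(\<Sum>v\<in>UNIV. (\<gamma>((j, i) := \<gamma> (j, i) + 2)) v) \<le> 2 * s" using sum_upd[of \<gamma> "(j,i)" 2] deg by simp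
      qed
      show "poly_blk (2 * s - 2) (bmon \<gamma> :: real^'n^'m \<Rightarrow> real)" using deg by (intro poly_blk_bmon) simp
    qed
    ultimately show ?thesis by (metis (no_types, lifting) ext)
  qed
qed

text \<open>On \<open>Xset\<close> the coordinates other than \<open>i0\<close> may vary freely near
  0, while those at \<open>i0\<close> are determined up to sign. The signs separate the exponents 0
  and 1 at \<open>i0\<close>; within one such pattern the other coordinates separate the
  rest.\<close>

lemma red_exps_indep:
  fixes c :: "('m::finite \<times> 'n::finite \<Rightarrow> nat) \<Rightarrow> real"
  assumes "\<And>x. x \<in> Xset \<Longrightarrow> (\<Sum>\<alpha>\<in>red_exps i0 k. c \<alpha> * bmon \<alpha> (x :: real^'n^'m)) = 0"
  shows "\<forall>\<alpha>\<in>red_exps i0 k. c \<alpha> = 0"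
proof
  fix \<kappa> :: "'m \<times> 'n \<Rightarrow> nat" assume \<kappa>: "\<kappa> \<in> red_exps i0 k"
  let ?N = "red_exps i0 k :: ('m \<times> 'n \<Rightarrow> nat) set"
  \<comment> \<open>The bound 1/n keeps the sum of the n - 1 free squares in a block below 1, so a
    real coordinate \<open>i0\<close> completes it to a unit vector.\<close>
  let ?I = "{0<..<1 / real CARD('n)}"
  define M where "M = {\<alpha>\<in>?N. \<forall>j\<in>UNIV. \<alpha> (j, i0) = \<kappa> (j, i0)}"
  have split: "(\<Prod>v\<in>UNIV. g v) = (\<Prod>j\<in>UNIV. g (j, i0)) * (\<Prod>j\<in>UNIV. \<Prod>i\<in>UNIV - {i0}. g (j, i))"
    for g :: "'m \<times> 'n \<Rightarrow> real"
  proof -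
    have "(\<Prod>v\<in>UNIV. g v) = (\<Prod>j\<in>UNIV. \<Prod>i\<in>UNIV. g (j, i))"
      by (simp add: prod.cartesian_product)
    also have "\<dots> = (\<Prod>j\<in>UNIV. g (j, i0) * (\<Prod>i\<in>UNIV - {i0}. g (j, i)))"
      by (subst prod.remove[of UNIV i0]) simp_all
    finally show ?thesis by (simp add: prod.distrib)
  qed
  have "(\<Sum>\<alpha>\<in>M. c \<alpha> * (\<Prod>v\<in>UNIV. y v ^ \<alpha> v)) = 0" if y: "\<And>v. v \<in> UNIV \<Longrightarrow> y v \<in> ?I" for y :: "'m \<times> 'n \<Rightarrow> real"
  proof -
    define \<rho> where "\<rho> = (\<lambda>j. sqrt (1 - (\<Sum>i\<in>UNIV - {i0}. (y (j, i))\<^sup>2)))"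
    have lt: "(\<Sum>i\<in>UNIV - {i0}. (y (j, i))\<^sup>2) < 1" for j
    proof -
      have "(y (j, i))\<^sup>2 \<le> 1 / real CARD('n)" for i
      proof -
        have y1: "0 < y (j, i)" "y (j, i) < 1 / real CARD('n)" using y[of "(j,i)"] by auto
        have "1 / real CARD('n) \<le> 1" by (simp add: Suc_leI)
        then have "y (j, i) \<le> 1" using y1 by linarith
        then have "y (j, i) * y (j, i) \<le> 1 * (1 / real CARD('n))" using y1 by (intro mult_mono) auto
        then show ?thesis by (simp add: power2_eq_square)
      qed
      then have "(\<Sum>i\<in>UNIV - {i0}. (y (j, i))\<^sup>2) \<le> real (card (UNIV - {i0})) * (1 / real CARD('n))"
        by (intro sum_bounded_above) auto
      also have "\<dots> < 1" by (simp add: card_Diff_singleton of_nat_diff Suc_leI divide_less_eq)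
      finally show ?thesis .
    qed
    then have \<rho>: "\<rho> j > 0" "(\<rho> j)\<^sup>2 = 1 - (\<Sum>i\<in>UNIV - {i0}. (y (j, i))\<^sup>2)" for j
      using less_imp_le[OF lt[of j]] by (simp_all add: \<rho>_def)
    define R where "R = (\<lambda>\<alpha>. \<Prod>j\<in>UNIV. \<Prod>i\<in>UNIV - {i0}. y (j, i) ^ \<alpha> (j, i))"
    have "(\<Sum>\<alpha>\<in>M. c \<alpha> * (\<Prod>j\<in>UNIV. \<rho> j ^ \<alpha> (j, i0)) * R \<alpha>) = 0"
      unfolding M_def
    proof (rule grid_monomials_independent[where U="\<lambda>_. {-1, 1}" and E="\<lambda>_. {0, 1}" and e="\<lambda>\<alpha> j. \<alpha> (j, i0)"])
      fix \<sigma> :: "'m \<Rightarrow> real" assume \<sigma>: "\<And>j. j \<in> UNIV \<Longrightarrow> \<sigma> j \<in> {-1, 1}"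
      define x :: "real^'n^'m" where "x = (\<chi> j. \<chi> i. if i = i0 then \<sigma> j * \<rho> j else y (j, i))"
      have s2: "(\<sigma> j)\<^sup>2 = 1" for j using \<sigma>[of j] by auto
      have "x \<in> Xset" unfolding Xset_def
      proof (intro CollectI allI)
        fix j
        have "(\<Sum>i\<in>UNIV - {i0}. (x $ j $ i)\<^sup>2) = (\<Sum>i\<in>UNIV - {i0}. (y (j, i))\<^sup>2)"
          by (intro sum.cong) (auto simp: x_def)
        then have "(norm (x $ j))\<^sup>2 = 1"
          unfolding norm_sq_split[of _ i0] by (simp add: x_def power_mult_distrib s2 \<rho>)
        then show "norm (x $ j) = 1" using power2_eq_iff_nonneg[of "norm (x $ j)" 1] by simp
      qed
      from assms[OF this] have "(\<Sum>\<alpha>\<in>?N. c \<alpha> * bmon \<alpha> x) = 0" .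
      moreover have "bmon \<alpha> x = (\<Prod>j\<in>UNIV. \<rho> j ^ \<alpha> (j, i0)) * R \<alpha> * (\<Prod>j\<in>UNIV. \<sigma> j ^ \<alpha> (j, i0))" for \<alpha>
      proof -
        have "(\<Prod>j\<in>UNIV. \<Prod>i\<in>UNIV - {i0}. (x $ j $ i) ^ \<alpha> (j, i)) = R \<alpha>"
          unfolding R_def by (intro prod.cong) (auto simp: x_def)
        then show ?thesis unfolding bmon_def split
          by (simp add: x_def power_mult_distrib prod.distrib)
      qed
      ultimately show "(\<Sum>\<alpha>\<in>?N. c \<alpha> * (\<Prod>j\<in>UNIV. \<rho> j ^ \<alpha> (j, i0)) * R \<alpha> * (\<Prod>j\<in>UNIV. \<sigma> j ^ \<alpha> (j, i0))) = 0"
        by (simp add: mult_ac)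
    next
      show "finite ?N" by (rule finite_red_exps)
      show "\<alpha> (j, i0) \<in> {0, 1}" if "\<alpha> \<in> ?N" for \<alpha> j
        using that by (auto simp: red_exps_def le_Suc_eq)
      fix cc :: "nat \<Rightarrow> real" and F assume "finite F" "F \<subseteq> {0, 1}" "\<And>x. x \<in> {-1, 1} \<Longrightarrow> (\<Sum>a\<in>F. cc a * x ^ a) = 0"
      then show "\<forall>a\<in>F. cc a = 0" by (intro powers_indep_sign) auto
    qed simp
    moreover have "(\<Sum>\<alpha>\<in>M. c \<alpha> * (\<Prod>j\<in>UNIV. \<rho> j ^ \<alpha> (j, i0)) * R \<alpha>) = (\<Prod>j\<in>UNIV. \<rho> j ^ \<kappa> (j, i0)) * (\<Sum>\<alpha>\<in>M. c \<alpha> * R \<alpha>)"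
      unfolding sum_distrib_left by (intro sum.cong refl) (simp add: M_def)
    moreover have "(\<Prod>j\<in>UNIV. \<rho> j ^ \<kappa> (j, i0)) > 0" by (intro prod_pos) (simp add: \<rho>)
    ultimately have "(\<Sum>\<alpha>\<in>M. c \<alpha> * R \<alpha>) = 0" by (metis mult_eq_0_iff order_less_irrefl)
    \<comment> \<open>The entries \<open>y (j, i0)\<close> are auxiliary variables: exponents in M
      agree there, so their powers form a common factor.\<close>
    moreover have "(\<Sum>\<alpha>\<in>M. c \<alpha> * (\<Prod>v\<in>UNIV. y v ^ \<alpha> v)) = (\<Prod>j\<in>UNIV. y (j, i0) ^ \<kappa> (j, i0)) * (\<Sum>\<alpha>\<in>M. c \<alpha> * R \<alpha>)"
      unfolding split sum_distrib_left by (intro sum.cong refl) (simp add: M_def R_def)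
    ultimately show ?thesis by simp
  qed
  then have "(\<Sum>\<alpha>\<in>{\<alpha>\<in>M. \<forall>v\<in>UNIV. \<alpha> v = \<kappa> v}. c \<alpha>) = 0"
  proof (rule grid_monomials_independent[where U="\<lambda>_. ?I" and E="\<lambda>_. UNIV" and e="\<lambda>\<alpha>. \<alpha>", rotated 4])
    show "finite M" by (simp add: M_def finite_red_exps)
    fix cc :: "nat \<Rightarrow> real" and F assume "finite F" "\<And>x. x \<in> ?I \<Longrightarrow> (\<Sum>a\<in>F. cc a * x ^ a) = 0"
    then show "\<forall>a\<in>F. cc a = 0" by (intro powers_indep_infinite[of ?I]) auto
  qed auto
  moreover have "{\<alpha>\<in>M. \<forall>v\<in>UNIV. \<alpha> v = \<kappa> v} = {\<kappa>}" using \<kappa> by (auto simp: M_def)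
  ultimately show "c \<kappa> = 0" by simp
qed

text \<open>The sample points and C depend on s but not on r. Modulo the ideal r is a combination of
  independent monomials whose coefficients the samples control, and \<open>in_T_bmon_bound\<close>
  pays a constant for each.\<close>

lemma in_T_from_samples:
  obtains X0 :: "(real^'n^'m) set" and C where "finite X0" "X0 \<subseteq> Xset" "C \<ge> 0"
    "\<And>r. poly_blk (2 * s) r \<Longrightarrow> in_T s (\<lambda>x. r x + C * (\<Sum>z\<in>X0. \<bar>r z\<bar>))"
proof -
  fix i0 :: 'n
  let ?N = "red_exps i0 (2 * s) :: ('m \<times> 'n \<Rightarrow> nat) set"
  obtain X0 :: "(real^'n^'m) set" and C where X0: "finite X0" "X0 \<subseteq> Xset" "C \<ge> 0"
    "\<And>c \<alpha>. \<alpha> \<in> ?N \<Longrightarrow> \<bar>c \<alpha>\<bar> \<le> C * (\<Sum>x\<in>X0. \<bar>\<Sum>\<beta>\<in>?N. c \<beta> * bmon \<beta> x\<bar>)"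
  proof (rule coeff_bound[where A="?N" and X=Xset and f=bmon])
    show "finite ?N" by (rule finite_red_exps)
    show "\<forall>\<alpha>\<in>?N. c \<alpha> = 0" if "\<And>x::real^'n^'m. x \<in> Xset \<Longrightarrow> (\<Sum>\<alpha>\<in>?N. c \<alpha> * bmon \<alpha> x) = 0" for c
      using that by (rule red_exps_indep)
  qed (rule that)
  show thesis
  \<comment> \<open>One constant K, the coefficient bound, is spent on each of the
    \<open>card ?N\<close> monomials.\<close>
  proof (rule that[of X0 "real (card ?N) * C"])
    fix r :: "real^'n^'m \<Rightarrow> real" assume "poly_blk (2 * s) r"
    then obtain A c0 where Ac: "finite A \<and> (\<forall>\<alpha>\<in>A. (\<Sum>v\<in>UNIV. \<alpha> v) \<le> 2 * s) \<and> (\<forall>x. r x = (\<Sum>\<alpha>\<in>A. c0 \<alpha> * bmon \<alpha> x))"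
      unfolding poly_blk_iff by blast
    then have "r = (\<lambda>x. \<Sum>\<alpha>\<in>A. c0 \<alpha> * bmon \<alpha> x)" by (intro ext) simp
    then have "reducible i0 s r"
      using Ac by (simp only:) (intro reducible_sum reducible_cmult reducible_bmon, simp)
    then obtain c h where ch: "(\<forall>j. poly_blk (2 * s - 2) (h j)) \<and>
      (\<forall>x. r x = (\<Sum>\<alpha>\<in>?N. c \<alpha> * bmon \<alpha> x) + (\<Sum>j\<in>UNIV. h j x * (1 - (norm (x $ j))\<^sup>2)))"
      unfolding reducible_def by blast
    then have h: "\<And>j. poly_blk (2 * s - 2) (h j)"
      and rc: "\<And>x. r x = (\<Sum>\<alpha>\<in>?N. c \<alpha> * bmon \<alpha> x) + (\<Sum>j\<in>UNIV. h j x * (1 - (norm (x $ j))\<^sup>2))"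
      by simp_all
    define K where "K = C * (\<Sum>z\<in>X0. \<bar>r z\<bar>)"
    have "r x = (\<Sum>\<alpha>\<in>?N. c \<alpha> * bmon \<alpha> x)" if "x \<in> Xset" for x
      using that unfolding rc by (simp add: Xset_def)
    then have "(\<Sum>z\<in>X0. \<bar>r z\<bar>) = (\<Sum>z\<in>X0. \<bar>\<Sum>\<alpha>\<in>?N. c \<alpha> * bmon \<alpha> z\<bar>)"
      using X0(2) by (intro sum.cong) auto
    then have K: "\<bar>c \<alpha>\<bar> \<le> K" if "\<alpha> \<in> ?N" for \<alpha> using X0(4)[OF that, of c] by (simp add: K_def)
    have "r x + real (card ?N) * C * (\<Sum>z\<in>X0. \<bar>r z\<bar>) = (\<Sum>\<alpha>\<in>?N. c \<alpha> * bmon \<alpha> x + K) + (\<Sum>j\<in>UNIV. h j x * (1 - (norm (x $ j))\<^sup>2))" for x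
      by (simp add: sum.distrib rc[of x] K_def)
    moreover have "in_T s (\<lambda>x. (\<Sum>\<alpha>\<in>?N. c \<alpha> * bmon \<alpha> x + K) + (\<Sum>j\<in>UNIV. h j x * (1 - (norm (x $ j))\<^sup>2)))"
      by (intro in_T_add in_T_sum in_T_ideal h in_T_bmon_bound K) (auto simp: red_exps_def)
    ultimately show "in_T s (\<lambda>x. r x + real (card ?N) * C * (\<Sum>z\<in>X0. \<bar>r z\<bar>))" by (simp only:)
  qed (use X0 in auto)
qed

section \<open>Kernel operators on the sphere\<close>

text \<open>Cauchy's estimate, with the mean over the circle replaced by the mean over roots of
  unity.\<close>

lemma coeff_le_on_circle:
  fixes P :: "complex poly"
  assumes "\<And>w. norm w = 1 \<Longrightarrow> norm (poly P w) \<le> B"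
  shows "norm (coeff P j) \<le> B"
proof -
  \<comment> \<open>The order of the roots exceeds j and the degree, so no other coefficient is
    aliased onto the j-th.\<close>
  define N where "N = Suc (max j (degree P))"
  define w where "w = (\<lambda>k::nat. exp (2 * of_real pi * \<i> * of_nat k / of_nat N) :: complex)"
  have N: "N \<ge> 1" by (simp add: N_def)
  have wm: "w (k * l) = w k ^ l" for k l
    unfolding w_def by (subst exp_of_nat_mult[symmetric]) (simp add: algebra_simps)
  have wN: "w N = 1" using complex_root_unity_eq_1[OF N, of N] by (simp add: w_def)
  have nw: "norm (w k) = 1" for k by (simp add: w_def)
  have w0: "w k \<noteq> 0" for k by (simp add: w_def)
  have orth: "(\<Sum>s<N. w s ^ k * inverse (w s ^ j)) = (if k = j then of_nat N else 0)" if "k < N" for k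
  proof (cases "k = j")
    case True
    then show ?thesis using w0 by simp
  next
    case False
    define z where "z = w k / w j"
    have "w k \<noteq> w j"
      unfolding w_def using complex_root_unity_eq[OF N, of k j] that False by (auto simp: N_def)
    then have z: "z \<noteq> 1" using w0 by (simp add: z_def)
    have zN: "z ^ N = 1"
      unfolding z_def power_divide wm[symmetric] by (simp add: mult.commute[of _ N] wm wN)
    have "w s ^ k = w k ^ s" for s k by (metis wm mult.commute)
    then have "w s ^ k * inverse (w s ^ j) = z ^ s" for s
      by (simp add: z_def divide_inverse power_mult_distrib power_inverse)
    then show ?thesis using False geometric_sum[OF z, of N] zN by simp
  qed
  have "(\<Sum>s<N. poly P (w s) * inverse (w s ^ j)) = (\<Sum>k<N. coeff P k * (\<Sum>s<N. w s ^ k * inverse (w s ^ j)))"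
  proof -
    have "poly P x = (\<Sum>k<N. coeff P k * x ^ k)" for x
      unfolding poly_altdef by (rule sum.mono_neutral_left) (auto simp: N_def coeff_eq_0)
    then show ?thesis
      by (simp add: sum_distrib_left sum_distrib_right mult.assoc) (rule sum.swap)
  qed
  also have "\<dots> = (\<Sum>k<N. coeff P k * (if k = j then of_nat N else 0))"
    by (intro sum.cong refl) (simp add: orth)
  also have "\<dots> = coeff P j * of_nat N"
    by (simp add: N_def if_distrib[of "\<lambda>x. _ * x"] cong: if_cong)
  finally have "norm (coeff P j) * real N = norm (\<Sum>s<N. poly P (w s) * inverse (w s ^ j))"
    by (simp add: norm_mult)
  also have "\<dots> \<le> (\<Sum>s<N. B)"
  proof (rule order_trans[OF norm_sum], rule sum_mono)
    fix s
    show "norm (poly P (w s) * inverse (w s ^ j)) \<le> B"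
      using assms[OF nw[of s]] by (simp add: norm_mult norm_inverse norm_power nw)
  qed
  finally show ?thesis using N by (simp add: mult.commute)
qed

lemma abs_sin_mult_le: "\<bar>sin (real k * x)\<bar> \<le> real k * \<bar>sin x\<bar>"
proof (induction k)
  case (Suc k)
  have "\<bar>sin (real (Suc k) * x)\<bar> = \<bar>sin (real k * x) * cos x + cos (real k * x) * sin x\<bar>"
  proof -
    have "real (Suc k) * x = real k * x + x" by (simp add: algebra_simps)
    then show ?thesis by (simp only: sin_add)
  qed
  also have "\<dots> \<le> \<bar>sin (real k * x)\<bar> * \<bar>cos x\<bar> + \<bar>cos (real k * x)\<bar> * \<bar>sin x\<bar>"
    by (metis abs_mult abs_triangle_ineq)
  also have "\<dots> \<le> \<bar>sin (real k * x)\<bar> * 1 + 1 * \<bar>sin x\<bar>"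
    by (intro add_mono mult_left_mono mult_right_mono) auto
  also have "\<dots> \<le> real (Suc k) * \<bar>sin x\<bar>" using Suc by (simp add: distrib_right)
  finally show ?case .
qed simp

lemma one_minus_cos_mult_le: "1 - cos (real k * x) \<le> (real k)\<^sup>2 * (1 - cos x)"
proof -
  have half: "1 - cos y = 2 * (sin (y / 2))\<^sup>2" for y :: real
    using cos_double_sin[of "y / 2"] by simp
  have "(sin (real k * (x / 2)))\<^sup>2 \<le> (real k * \<bar>sin (x / 2)\<bar>)\<^sup>2"
    using abs_sin_mult_le[of k "x / 2"] by (simp add: abs_le_square_iff[symmetric] abs_mult)
  then show ?thesis unfolding half by (simp add: power_mult_distrib)
qed

text \<open>The factor exp(i d \<theta>) clears negative frequencies: f becomes an algebraic
  polynomial of degree 2 d on the circle, whose j-th coefficient belongs to frequency j - d.\<close>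

definition trig_deg :: "nat \<Rightarrow> (real \<Rightarrow> real) \<Rightarrow> bool" where
  "trig_deg d f \<longleftrightarrow> (\<exists>P::complex poly. degree P \<le> 2 * d \<and>
     (\<forall>\<theta>. exp (\<i> * of_real \<theta>) ^ d * of_real (f \<theta>) = poly P (exp (\<i> * of_real \<theta>))))"

lemma trig_deg_mult:
  assumes "trig_deg d f" "trig_deg e g" shows "trig_deg (d + e) (\<lambda>\<theta>. f \<theta> * g \<theta>)"
proof -
  let ?e = "\<lambda>\<theta>. exp (\<i> * complex_of_real \<theta>)"
  obtain P :: "complex poly" where P: "degree P \<le> 2 * d" "\<And>\<theta>. ?e \<theta> ^ d * of_real (f \<theta>) = poly P (?e \<theta>)"
    using assms(1) unfolding trig_deg_def by auto
  obtain Q :: "complex poly" where Q: "degree Q \<le> 2 * e" "\<And>\<theta>. ?e \<theta> ^ e * of_real (g \<theta>) = poly Q (?e \<theta>)"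
    using assms(2) unfolding trig_deg_def by auto
  have "?e \<theta> ^ (d + e) * of_real (f \<theta> * g \<theta>) = poly (P * Q) (?e \<theta>)" for \<theta>
    unfolding poly_mult P(2)[symmetric] Q(2)[symmetric] by (simp add: power_add)
  moreover have "degree (P * Q) \<le> 2 * (d + e)"
    using degree_mult_le[of P Q] P(1) Q(1) by simp
  ultimately show ?thesis unfolding trig_deg_def by blast
qed

lemma trig_deg_add:
  assumes "trig_deg d f" "trig_deg d g" shows "trig_deg d (\<lambda>\<theta>. f \<theta> + g \<theta>)"
proof -
  let ?e = "\<lambda>\<theta>. exp (\<i> * complex_of_real \<theta>)"
  obtain P :: "complex poly" where P: "degree P \<le> 2 * d" "\<And>\<theta>. ?e \<theta> ^ d * of_real (f \<theta>) = poly P (?e \<theta>)"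
    using assms(1) unfolding trig_deg_def by auto
  obtain Q :: "complex poly" where Q: "degree Q \<le> 2 * d" "\<And>\<theta>. ?e \<theta> ^ d * of_real (g \<theta>) = poly Q (?e \<theta>)"
    using assms(2) unfolding trig_deg_def by auto
  have "?e \<theta> ^ d * of_real (f \<theta> + g \<theta>) = poly (P + Q) (?e \<theta>)" for \<theta>
    unfolding poly_add P(2)[symmetric] Q(2)[symmetric] by (simp add: distrib_left)
  moreover have "degree (P + Q) \<le> 2 * d" using P(1) Q(1) by (intro degree_add_le)
  ultimately show ?thesis unfolding trig_deg_def by blast
qed

lemma trig_deg_const: "trig_deg d (\<lambda>\<theta>. c)"
  unfolding trig_deg_def
  by (intro exI[of _ "monom (of_real c) d"] conjI)
    (auto simp: poly_monom intro: order_trans[OF degree_monom_le])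

lemma trig_deg_mono: "trig_deg d f \<Longrightarrow> d \<le> e \<Longrightarrow> trig_deg e f"
  using trig_deg_mult[of d f "e - d" "\<lambda>_. 1"] trig_deg_const by simp

lemma trig_deg_linear: "trig_deg 1 (\<lambda>\<theta>. A * cos \<theta> + B * sin \<theta>)"
  unfolding trig_deg_def
proof (intro exI[of _ "[:of_real A / 2 + \<i> * of_real B / 2, 0, of_real A / 2 - \<i> * of_real B / 2:]"] conjI allI)
  fix \<theta>
  let ?w = "exp (\<i> * complex_of_real \<theta>)"
  have w: "?w = of_real (cos \<theta>) + \<i> * of_real (sin \<theta>)"
    by (simp add: exp_Euler cos_of_real sin_of_real)
  have "inverse ?w = exp (\<i> * complex_of_real (- \<theta>))" by (simp add: exp_minus)
  also have "\<dots> = of_real (cos \<theta>) - \<i> * of_real (sin \<theta>)"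
    by (simp only: exp_Euler) (simp add: cos_of_real sin_of_real)
  finally have "?w * (of_real (cos \<theta>) - \<i> * of_real (sin \<theta>)) = 1" by (metis exp_not_eq_zero right_inverse)
  then have c: "?w * of_real (cos \<theta>) = (?w\<^sup>2 + 1) / 2" and s: "?w * of_real (sin \<theta>) = - \<i> * (?w\<^sup>2 - 1) / 2"
    unfolding power2_eq_square by (simp_all add: w algebra_simps complex_eq_iff)
  have "?w ^ 1 * of_real (A * cos \<theta> + B * sin \<theta>) = of_real A * (?w * of_real (cos \<theta>)) + of_real B * (?w * of_real (sin \<theta>))"
    by (simp add: algebra_simps)
  also have "\<dots> = of_real A * ((?w\<^sup>2 + 1) / 2) + of_real B * (- \<i> * (?w\<^sup>2 - 1) / 2)" unfolding c s ..
  also have "\<dots> = poly [:of_real A / 2 + \<i> * of_real B / 2, 0, of_real A / 2 - \<i> * of_real B / 2:] ?w"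
    by (simp add: power2_eq_square field_simps)
  finally show "?w ^ 1 * of_real (A * cos \<theta> + B * sin \<theta>) = poly [:of_real A / 2 + \<i> * of_real B / 2, 0, of_real A / 2 - \<i> * of_real B / 2:] ?w" .
qed simp

lemma sum_shifted_squares: "(\<Sum>j\<le>2 * d. (real j - real d)\<^sup>2) * 3 = real d * (real d + 1) * (2 * real d + 1)"
proof -
  have s: "(\<Sum>j\<le>d. (real j)\<^sup>2) * 6 = real d * (real d + 1) * (2 * real d + 1)"
    by (induction d) (auto simp: algebra_simps power2_eq_square)
  have "{..2 * d} = {..<d} \<union> {d..2 * d}" by auto
  then have "(\<Sum>j\<le>2 * d. (real j - real d)\<^sup>2) = (\<Sum>j<d. (real j - real d)\<^sup>2) + (\<Sum>j=d..2*d. (real j - real d)\<^sup>2)"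
    by (simp only:) (subst sum.union_disjoint, auto)
  also have "(\<Sum>j=d..2*d. (real j - real d)\<^sup>2) = (\<Sum>j\<le>d. (real j)\<^sup>2)"
    by (rule sum.reindex_bij_witness[of _ "\<lambda>j. j + d" "\<lambda>j. j - d"]) auto
  also have "(\<Sum>j<d. (real j - real d)\<^sup>2) = (\<Sum>j\<in>{1..d}. (real j)\<^sup>2)"
    by (rule sum.reindex_bij_witness[of _ "\<lambda>j. d - j" "\<lambda>j. d - j"]) (auto simp: of_nat_diff power2_commute)
  also have "(\<Sum>j\<in>{1..d}. (real j)\<^sup>2) = (\<Sum>j\<le>d. (real j)\<^sup>2)"
    by (rule sum.mono_neutral_left) auto
  finally show ?thesis using s by simp
qed

text \<open>Averaging over \<theta> and -\<theta> turns frequency k into cos (k \<theta>), which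
  differs from 1 by at most k^2 (1 - cos \<theta>). Coefficients are at most B, and the squares of k
  from -d to d sum to d (d + 1)(2 d + 1)/3 \<le> 2 d^3.\<close>

lemma trig_symmetrized_bound:
  assumes "trig_deg d f" "\<And>\<theta>. \<bar>f \<theta>\<bar> \<le> B" "d \<ge> 1"
  shows "\<bar>(f \<theta> + f (- \<theta>)) / 2 - f 0\<bar> \<le> 2 * real d ^ 3 * B * (1 - cos \<theta>)"
proof -
  let ?e = "\<lambda>\<theta>. exp (\<i> * complex_of_real \<theta>)"
  obtain P :: "complex poly" where P: "degree P \<le> 2 * d" "\<And>\<theta>. ?e \<theta> ^ d * of_real (f \<theta>) = poly P (?e \<theta>)"
    using assms(1) unfolding trig_deg_def by auto
  have cB: "norm (coeff P j) \<le> B" for j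
  proof (rule coeff_le_on_circle)
    fix w :: complex assume "norm w = 1"
    then have "w \<noteq> 0" by auto
    with \<open>norm w = 1\<close> have w: "w = ?e (Arg w)" using Arg_eq[of w] by simp
    have "norm (poly P (?e (Arg w))) \<le> B"
      unfolding P(2)[symmetric] using assms(2) by (simp add: norm_mult norm_power)
    then show "norm (poly P w) \<le> B" using w by simp
  qed
  have B: "B \<ge> 0" using cB[of 0] norm_ge_zero order_trans by blast
  have f: "of_real (f \<theta>) = (\<Sum>j\<le>2*d. coeff P j * ?e ((real j - real d) * \<theta>))" for \<theta>
  proof -
    have "of_real (f \<theta>) = poly P (?e \<theta>) / ?e \<theta> ^ d" unfolding P(2)[symmetric] by simp
    also have "poly P (?e \<theta>) = (\<Sum>j\<le>2*d. coeff P j * ?e \<theta> ^ j)"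
      unfolding poly_altdef by (rule sum.mono_neutral_left) (use P(1) in \<open>auto simp: coeff_eq_0\<close>)
    also have "\<dots> / ?e \<theta> ^ d = (\<Sum>j\<le>2*d. coeff P j * (?e \<theta> ^ j / ?e \<theta> ^ d))"
      by (simp add: sum_divide_distrib)
    also have "\<dots> = (\<Sum>j\<le>2*d. coeff P j * ?e ((real j - real d) * \<theta>))"
    proof (intro sum.cong refl)
      fix j
      have "?e \<theta> ^ j / ?e \<theta> ^ d = exp (of_nat j * (\<i> * of_real \<theta>) - of_nat d * (\<i> * of_real \<theta>))"
        by (simp add: exp_diff exp_of_nat_mult)
      then show "coeff P j * (?e \<theta> ^ j / ?e \<theta> ^ d) = coeff P j * ?e ((real j - real d) * \<theta>)"
        by (simp add: algebra_simps)
    qed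
    finally show ?thesis .
  qed
  have ee: "(?e x + ?e (- x)) / 2 = of_real (cos x)" for x
    by (simp only: exp_Euler) (simp add: cos_of_real sin_of_real)
  have "of_real ((f \<theta> + f (- \<theta>)) / 2 - f 0) = (\<Sum>j\<le>2*d. coeff P j * ((?e ((real j - real d) * \<theta>) + ?e (- ((real j - real d) * \<theta>))) / 2 - 1))"
  proof -
    have "of_real ((f \<theta> + f (- \<theta>)) / 2 - f 0) = (of_real (f \<theta>) + of_real (f (- \<theta>))) / 2 - complex_of_real (f 0)"
      by simp
    then show ?thesis unfolding f
      by (simp add: sum.distrib[symmetric] sum_divide_distrib sum_subtractf[symmetric] algebra_simps add_divide_distrib)
  qed
  also have "\<dots> = (\<Sum>j\<le>2*d. coeff P j * of_real (cos ((real j - real d) * \<theta>) - 1))"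
    unfolding ee by simp
  finally have "\<bar>(f \<theta> + f (- \<theta>)) / 2 - f 0\<bar> = norm (\<Sum>j\<le>2*d. coeff P j * of_real (cos ((real j - real d) * \<theta>) - 1))"
    by (metis norm_of_real)
  also have "\<dots> \<le> (\<Sum>j\<le>2*d. B * ((real j - real d)\<^sup>2 * (1 - cos \<theta>)))"
  proof (rule order_trans[OF norm_sum], rule sum_mono)
    fix j
    obtain k :: nat where "real j - real d = real k \<or> real j - real d = - real k"
      by (metis minus_diff_eq nat_le_linear of_nat_diff)
    then have k: "cos ((real j - real d) * \<theta>) = cos (real k * \<theta>)" "(real j - real d)\<^sup>2 = (real k)\<^sup>2"
      by auto
    then have "norm (complex_of_real (cos ((real j - real d) * \<theta>) - 1)) \<le> (real j - real d)\<^sup>2 * (1 - cos \<theta>)"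
      using one_minus_cos_mult_le[of k \<theta>] cos_le_one[of "real k * \<theta>"] by (simp only: norm_of_real k)
    then show "norm (coeff P j * of_real (cos ((real j - real d) * \<theta>) - 1)) \<le> B * ((real j - real d)\<^sup>2 * (1 - cos \<theta>))"
      unfolding norm_mult using cB[of j] B by (intro mult_mono) auto
  qed
  also have "\<dots> = (\<Sum>j\<le>2*d. (real j - real d)\<^sup>2) * (B * (1 - cos \<theta>))"
    unfolding sum_distrib_right by (intro sum.cong refl) (simp only: mult_ac)
  also have "\<dots> \<le> (2 * real d ^ 3) * (B * (1 - cos \<theta>))"
  proof (rule mult_right_mono)
    have d: "real d \<ge> 1" using assms(3) by simp
    have "0 \<le> real d * ((4 * real d + 1) * (real d - 1))" using d by (intro mult_nonneg_nonneg) auto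
    then have "real d * (real d + 1) * (2 * real d + 1) \<le> 6 * real d ^ 3"
      by (simp add: algebra_simps power3_eq_cube)
    then show "(\<Sum>j\<le>2*d. (real j - real d)\<^sup>2) \<le> 2 * real d ^ 3" using sum_shifted_squares[of d] by linarith
    show "0 \<le> B * (1 - cos \<theta>)" using B by simp
  qed
  finally show ?thesis by (simp only: mult.assoc)
qed

text \<open>Sums of products of at most d linear forms, the form in which limits of averages are
  available.\<close>

definition lin_span :: "nat \<Rightarrow> (real^'n \<Rightarrow> real) \<Rightarrow> bool" where
  "lin_span d p \<longleftrightarrow> (\<exists>ps. (\<forall>(c,as)\<in>set ps. length as \<le> d) \<and> (\<forall>y. p y = (\<Sum>(c,as)\<leftarrow>ps. c * lprod as y)))"

text \<open>The isometry that fixes the unit vector x and is -1 on its orthogonal complement; on a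
  great circle through x it reverses the angle.\<close>

definition refl_vec :: "real^'n \<Rightarrow> real^'n \<Rightarrow> real^'n" where
  "refl_vec x y = (2 * (x \<bullet> y)) *\<^sub>R x - y"

lemma lprod_circle: "trig_deg (length as) (\<lambda>\<theta>. lprod as (cos \<theta> *\<^sub>R x + sin \<theta> *\<^sub>R v))"
proof (induction as)
  case (Cons a as)
  then show ?case using trig_deg_mult[OF trig_deg_linear[of "a \<bullet> x" "a \<bullet> v"] Cons]
    by (simp add: inner_add_right mult.commute)
qed (simp add: trig_deg_const)

lemma lin_span_circle:
  assumes "lin_span d p" shows "trig_deg d (\<lambda>\<theta>. p (cos \<theta> *\<^sub>R x + sin \<theta> *\<^sub>R v))"
proof -
  from assms obtain ps where ps: "\<forall>(c,as)\<in>set ps. length as \<le> d" and p: "\<And>y. p y = (\<Sum>(c,as)\<leftarrow>ps. c * lprod as y)"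
    unfolding lin_span_def by auto
  show ?thesis unfolding p using ps
  proof (induction ps)
    case (Cons q ps)
    then have "trig_deg d (\<lambda>\<theta>. fst q * lprod (snd q) (cos \<theta> *\<^sub>R x + sin \<theta> *\<^sub>R v))"
      by (intro trig_deg_mono[OF trig_deg_mult[OF trig_deg_const[of 0] lprod_circle]]) auto
    then show ?case using Cons by (simp add: case_prod_unfold trig_deg_add)
  qed (simp add: trig_deg_const)
qed

text \<open>The great circle through x and y is parametrised from x, so that y and its mirror image
  sit at the angles \<theta> and -\<theta> with cos \<theta> = \<open>x \<bullet> y\<close>.\<close>

lemma circle_bound:
  fixes p :: "real^'n \<Rightarrow> real"
  assumes "lin_span d p" "d \<ge> 1" "\<And>y. norm y = 1 \<Longrightarrow> \<bar>p y\<bar> \<le> B" "norm x = 1" "norm y = 1"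
  shows "\<bar>(p y + p (refl_vec x y)) / 2 - p x\<bar> \<le> 2 * real d ^ 3 * B * (1 - x \<bullet> y)"
proof -
  define u where "u = x \<bullet> y"
  define v' where "v' = y - u *\<^sub>R x"
  have xx: "x \<bullet> x = 1" and yy: "y \<bullet> y = 1" using assms(4,5) by (simp_all add: norm_eq_1)
  have B: "B \<ge> 0" using assms(3)[OF assms(4)] by linarith
  have v'sq: "v' \<bullet> v' = 1 - u\<^sup>2"
    by (simp add: v'_def inner_diff_left inner_diff_right xx yy u_def inner_commute power2_eq_square)
  have xv': "x \<bullet> v' = 0" by (simp add: v'_def inner_diff_right xx u_def)
  show ?thesis
  proof (cases "v' = 0")
    \<comment> \<open>No direction v is defined if y = x or y = -x. The first case is an equality;
      in the second the trivial bound 2 B suffices, because 1 - \<open>x \<bullet> y\<close> is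
      2.\<close>
    case True
    then have y: "y = u *\<^sub>R x" by (simp add: v'_def)
    have "u = 1 \<or> u = -1" using v'sq True by (simp add: power2_eq_1_iff)
    then show ?thesis
    proof
      assume "u = 1"
      then have "y = x" using y by simp
      then show ?thesis by (simp add: refl_vec_def xx scaleR_2)
    next
      assume u: "u = -1"
      then have y: "y = - x" using y by simp
      have d1: "1 \<le> real d ^ 3" using assms(2) by simp
      have "refl_vec x y = - x" using y by (simp add: refl_vec_def xx scaleR_2)
      then have "\<bar>(p y + p (refl_vec x y)) / 2 - p x\<bar> = \<bar>p (-x) - p x\<bar>" by (simp add: y)
      also have "\<dots> \<le> 2 * 1 * B" using assms(3)[of x] assms(3)[of "-x"] assms(4) by simp
      also have "\<dots> \<le> 2 * real d ^ 3 * B" using B d1 by (intro mult_right_mono mult_left_mono) auto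
      also have "\<dots> \<le> 2 * real d ^ 3 * B * (1 - x \<bullet> y)" using B by (simp add: u flip: u_def)
      finally show ?thesis .
    qed
  next
    case False
    define r where "r = norm v'"
    have r: "r > 0" "r\<^sup>2 = 1 - u\<^sup>2" using False v'sq by (simp_all add: r_def power2_norm_eq_inner)
    define v where "v = v' /\<^sub>R r"
    have xv: "x \<bullet> v = 0" and vv: "v \<bullet> v = 1"
      using xv' r v'sq by (simp_all add: v_def power2_eq_square field_simps)
    have "u\<^sup>2 \<le> 1" using r by (metis diff_ge_0_iff_ge zero_le_power2)
    then have u1: "\<bar>u\<bar> \<le> 1" by (simp add: abs_square_le_1)
    define \<theta> where "\<theta> = arccos u"
    have c: "cos \<theta> = u" using u1 by (simp add: \<theta>_def cos_arccos_abs)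
    have s: "sin \<theta> = r"
      using u1 r by (simp add: \<theta>_def sin_arccos_abs) (metis real_sqrt_abs abs_of_pos)
    let ?g = "\<lambda>\<theta>. cos \<theta> *\<^sub>R x + sin \<theta> *\<^sub>R v"
    have g1: "norm (?g \<theta>) = 1" for \<theta>
      unfolding norm_eq_1 by (simp add: inner_add_left inner_add_right xx vv xv inner_commute[of v x] flip: power2_eq_square)
    have y: "?g \<theta> = y" using r by (simp add: c s v_def v'_def)
    have "r *\<^sub>R v = y - u *\<^sub>R x" using r by (simp add: v_def v'_def)
    moreover have "(2 * u) *\<^sub>R x = u *\<^sub>R x + u *\<^sub>R x" by (metis mult_2 scaleR_add_left)
    ultimately have y': "?g (- \<theta>) = refl_vec x y" by (simp add: c s refl_vec_def u_def)
    have "\<bar>(p (?g \<theta>) + p (?g (- \<theta>))) / 2 - p (?g 0)\<bar> \<le> 2 * real d ^ 3 * B * (1 - cos \<theta>)"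
      by (rule trig_symmetrized_bound[OF lin_span_circle[OF assms(1)] _ assms(2)]) (intro assms(3) g1)
    then show ?thesis unfolding y y' by (simp add: c u_def)
  qed
qed


section \<open>Limits of kernel averages\<close>

lemma delete_nth_append:
  "(\<Sum>i<length (as @ bs). f ((as @ bs) ! i) (delete_nth i (as @ bs))) =
     (\<Sum>i<length as. f (as ! i) (delete_nth i as @ bs)) + (\<Sum>i<length bs. f (bs ! i) (as @ delete_nth i bs) :: real)"
proof (induction as arbitrary: f)
  case (Cons a as)
  show ?case using Cons[of "\<lambda>b cs. f b (a # cs)"]
    by (simp add: sum.lessThan_Suc_shift del: sum.lessThan_Suc)
qed simp

lemma delete_nth_replicate: "i < l \<Longrightarrow> delete_nth i (replicate l x) = replicate (l - 1) x"
  by (induction l arbitrary: i) (auto simp: less_Suc_eq_0_disj Cons_replicate_eq)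

lemma sph_wick_replicate:
  fixes x :: "real^'n" assumes "norm x = 1"
  shows "sph_wick (replicate l x) = sph_moment (real CARD('n)) l"
proof (induction "real CARD('n)" l rule: sph_moment.induct)
  case 2
  show ?case by (simp add: sph_wick_def)
next
  case (3 l)
  have xx: "x \<bullet> x = 1" using assms by (simp add: norm_eq_1)
  have "(real CARD('n) + real l) * sph_wick (replicate (Suc (Suc l)) x) = (\<Sum>i<Suc l. (x \<bullet> replicate (Suc l) x ! i) * sph_wick (delete_nth i (replicate (Suc l) x)))"
    using sph_wick_Cons[of "replicate (Suc l) x" x] by simp
  also have "\<dots> = (\<Sum>i<Suc l. sph_wick (replicate l x))"
    by (intro sum.cong refl) (auto simp: xx delete_nth_replicate simp del: replicate_Suc)
  finally have "(real CARD('n) + real l) * sph_wick (replicate (Suc (Suc l)) x) = (real l + 1) * sph_moment (real CARD('n)) l"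
    using 3 by simp
  moreover have "real CARD('n) + real l > 0" by (simp add: add_pos_nonneg)
  ultimately show ?case by (simp add: field_simps)
qed simp

lemma poly_vec_const: "poly_vec d (\<lambda>x. c)"
  unfolding poly_vec_def by (rule mpoly_const)
lemma poly_vec_mono: "poly_vec d f \<Longrightarrow> d \<le> e \<Longrightarrow> poly_vec e f"
  unfolding poly_vec_def by (rule mpoly_mono)
lemma poly_vec_add: "poly_vec d f \<Longrightarrow> poly_vec d g \<Longrightarrow> poly_vec d (\<lambda>x. f x + g x)"
  unfolding poly_vec_def by (rule mpoly_add)
lemma poly_vec_cmult: "poly_vec d f \<Longrightarrow> poly_vec d (\<lambda>x. c * f x)"
  unfolding poly_vec_def by (rule mpoly_cmult)
lemma poly_vec_sum: "(\<And>i. i \<in> I \<Longrightarrow> poly_vec d (f i)) \<Longrightarrow> poly_vec d (\<lambda>x. \<Sum>i\<in>I. f i x)"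
  unfolding poly_vec_def by (rule mpoly_sum)
lemma poly_vec_mult: "poly_vec d f \<Longrightarrow> poly_vec e g \<Longrightarrow> poly_vec (d + e) (\<lambda>x. f x * g x)"
  unfolding poly_vec_def by (rule mpoly_mult)
lemma poly_vec_inner: "poly_vec 1 (\<lambda>x. a \<bullet> x)"
  unfolding poly_vec_def inner_vec_def inner_real_def vec_lambda_beta
  by (intro mpoly_sum mpoly_cmult mpoly_var) simp

text \<open>The reason why \<open>K\<close> does not raise degrees. The recursion is applied to a
  vector of \<open>as\<close>: paired with a copy of x it gives one linear factor in x, paired
  within \<open>as\<close> it gives a constant. The number l of copies does not enter the
  degree.\<close>

lemma sph_wick_poly:
  fixes as :: "(real^'n) list"
  shows "\<exists>g. poly_vec (length as) g \<and> (\<forall>x. norm x = 1 \<longrightarrow> sph_wick (replicate l x @ as) = g x)"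
proof (induction as arbitrary: l rule: length_induct)
  case (1 as)
  show ?case
  proof (cases as)
    case Nil
    then show ?thesis
      by (intro exI[of _ "\<lambda>_. sph_moment (real CARD('n)) l"]) (simp add: sph_wick_replicate poly_vec_const)
  next
    case (Cons a bs)
    define k where "k = length bs"
    have IH: "\<exists>g. poly_vec (length cs) g \<and> (\<forall>x. norm x = 1 \<longrightarrow> sph_wick (replicate l x @ cs) = g x)"
      if "length cs \<le> k" for l and cs :: "(real^'n) list"
      using 1[rule_format, of cs] that by (simp add: Cons k_def)
    obtain g where g: "poly_vec k g" "\<And>x. norm x = 1 \<Longrightarrow> sph_wick (replicate (l - 1) x @ bs) = g x"
      using IH[of bs "l - 1"] by (auto simp: k_def)
    have "\<forall>i. \<exists>g. i < k \<longrightarrow> (poly_vec (k - 1) g \<and> (\<forall>x. norm x = 1 \<longrightarrow> sph_wick (replicate l x @ delete_nth i bs) = g x))"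
    proof
      fix i
      show "\<exists>g. i < k \<longrightarrow> (poly_vec (k - 1) g \<and> (\<forall>x. norm x = 1 \<longrightarrow> sph_wick (replicate l x @ delete_nth i bs) = g x))"
        using IH[of "delete_nth i bs" l] by (cases "i < k") (auto simp: k_def)
    qed
    then obtain gg where gg: "\<And>i. i < k \<Longrightarrow> poly_vec (k - 1) (gg i)"
      "\<And>i x. i < k \<Longrightarrow> norm x = 1 \<Longrightarrow> sph_wick (replicate l x @ delete_nth i bs) = gg i x" by metis
    define D where "D = real CARD('n) + real (l + k) - 1"
    define h where "h = (\<lambda>x. (1 / D) * (real l * ((a \<bullet> x) * g x) + (\<Sum>i<k. (a \<bullet> bs ! i) * gg i x)))"
    have "poly_vec (Suc k) h"
    proof -
      have "poly_vec (Suc k) (\<lambda>x. (a \<bullet> x) * g x)" using poly_vec_mult[OF poly_vec_inner g(1), of a] by simp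
      moreover have "poly_vec (Suc k) (gg i)" if "i < k" for i
        by (rule poly_vec_mono[OF gg(1)[OF that]]) simp
      ultimately show ?thesis unfolding h_def by (intro poly_vec_cmult poly_vec_add poly_vec_sum) auto
    qed
    moreover have "sph_wick (replicate l x @ as) = h x" if x: "norm x = 1" for x
    proof -
      have "sph_wick (replicate l x @ as) = sph_wick (a # (replicate l x @ bs))"
        by (rule sph_wick_perm) (simp add: Cons)
      moreover have "D * sph_wick (a # (replicate l x @ bs)) = real l * ((a \<bullet> x) * g x) + (\<Sum>i<k. (a \<bullet> bs ! i) * gg i x)"
      proof -
        have "D * sph_wick (a # (replicate l x @ bs)) = (\<Sum>i<length (replicate l x @ bs). (a \<bullet> (replicate l x @ bs) ! i) * sph_wick (delete_nth i (replicate l x @ bs)))"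
          using sph_wick_Cons[of "replicate l x @ bs" a] by (simp add: D_def k_def)
        also have "\<dots> = (\<Sum>i<length (replicate l x). (a \<bullet> replicate l x ! i) * sph_wick (delete_nth i (replicate l x) @ bs)) + (\<Sum>i<length bs. (a \<bullet> bs ! i) * sph_wick (replicate l x @ delete_nth i bs))"
          by (rule delete_nth_append[of "\<lambda>b cs. (a \<bullet> b) * sph_wick cs"])
        also have "(\<Sum>i<length (replicate l x). (a \<bullet> replicate l x ! i) * sph_wick (delete_nth i (replicate l x) @ bs)) = (\<Sum>i<l. (a \<bullet> x) * g x)"
          using g(2)[OF x] by (intro sum.cong) (auto simp: delete_nth_replicate)
        also have "(\<Sum>i<length bs. (a \<bullet> bs ! i) * sph_wick (replicate l x @ delete_nth i bs)) = (\<Sum>i<k. (a \<bullet> bs ! i) * gg i x)"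
          by (intro sum.cong) (auto simp: gg(2)[OF _ x] k_def)
        finally show ?thesis by simp
      qed
      \<comment> \<open>D vanishes only for n = 1 and no further vectors; then the value is a first
        moment, which is 0 as well.\<close>
      moreover have "sph_wick (a # (replicate l x @ bs)) = 0" if "D = 0"
      proof -
        have "real CARD('n) \<ge> 1" by (simp add: Suc_leI)
        then have "real l + real k \<le> 0" using that unfolding D_def of_nat_add by linarith
        then have "l + k = 0" by (simp flip: of_nat_add)
        then have "l = 0" "bs = []" by (auto simp: k_def)
        then show ?thesis by (simp add: sph_wick_def)
      qed
      ultimately show ?thesis unfolding h_def by (cases "D = 0") (auto simp: field_simps)
    qed
    ultimately show ?thesis by (intro exI[of _ h]) (simp add: Cons k_def)
  qed
qed

lemma refl_vec_inner:
  assumes "norm x = 1"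
  shows "refl_vec x a \<bullet> refl_vec x b = a \<bullet> b" "refl_vec x x = x" "a \<bullet> refl_vec x b = refl_vec x a \<bullet> b"
proof -
  have xx: "x \<bullet> x = 1" using assms by (simp add: norm_eq_1)
  show "refl_vec x a \<bullet> refl_vec x b = a \<bullet> b"
    by (simp add: refl_vec_def inner_diff_left inner_diff_right xx inner_commute)
  show "refl_vec x x = x" by (simp add: refl_vec_def xx scaleR_2)
  show "a \<bullet> refl_vec x b = refl_vec x a \<bullet> b"
    by (simp add: refl_vec_def inner_diff_left inner_diff_right inner_commute)
qed

text \<open>Rotation invariance of the limit: the recursion involves inner products only.\<close>

lemma wick_map_isometry:
  assumes "\<And>a b. R a \<bullet> R b = a \<bullet> b" shows "wick (map R as) = wick as"
proof (induction as rule: wick.induct)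
  case (2 a as)
  have "delete_nth i (map R as) = map R (delete_nth i as)" for i by (simp add: delete_nth_def take_map drop_map)
  then show ?case using 2 by (auto simp: assms intro!: sum.cong)
qed simp

lemma kernel_tendsto:
  fixes L :: "nat \<Rightarrow> (real^'n \<Rightarrow> real) \<Rightarrow> real"
  assumes fp: "\<And>M. finpos {y. norm y = 1} (L M)"
    and lim: "\<And>as. length as \<le> D \<Longrightarrow> (\<lambda>M. L M (lprod as)) \<longlonglongrightarrow> sph_wick as"
    and "degree Q + length as \<le> D"
  shows "(\<lambda>M. L M (\<lambda>y. poly Q (x \<bullet> y) * lprod as y)) \<longlonglongrightarrow> (\<Sum>i\<le>degree Q. coeff Q i * sph_wick (replicate i x @ as))"
proof -
  have rep: "lprod (replicate i x) y = (x \<bullet> y) ^ i" for i y by (induction i) auto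
  have "poly Q (x \<bullet> y) * lprod as y = (\<Sum>i\<le>degree Q. coeff Q i * lprod (replicate i x @ as) y)" for y
    by (simp add: poly_altdef sum_distrib_right rep mult.assoc)
  then have "L M (\<lambda>y. poly Q (x \<bullet> y) * lprod as y) = (\<Sum>i\<le>degree Q. coeff Q i * L M (lprod (replicate i x @ as)))" for M
    by (simp add: finpos_commute_sum[OF fp] finpos_linear(2)[OF fp] del: lprod_simps)
  moreover have "(\<lambda>M. \<Sum>i\<le>degree Q. coeff Q i * L M (lprod (replicate i x @ as)))
    \<longlonglongrightarrow> (\<Sum>i\<le>degree Q. coeff Q i * sph_wick (replicate i x @ as))"
    using assms(3) by (intro tendsto_sum tendsto_mult tendsto_const lim) simp
  ultimately show ?thesis by simp
qed

lemma kernel_tendsto_mean: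
  fixes L :: "nat \<Rightarrow> (real^'n \<Rightarrow> real) \<Rightarrow> real"
  assumes fp: "\<And>M. finpos {y. norm y = 1} (L M)"
    and lim: "\<And>as. length as \<le> D \<Longrightarrow> (\<lambda>M. L M (lprod as)) \<longlonglongrightarrow> sph_wick as"
    and "degree Q \<le> D" "norm x = 1"
  shows "(\<lambda>M. L M (\<lambda>y. poly Q (x \<bullet> y))) \<longlonglongrightarrow> sph_mean (real CARD('n)) Q"
  using kernel_tendsto[OF fp lim, where Q=Q and as="[]" and x=x] assms(3,4)
  by (simp add: sph_wick_replicate sph_mean_def)

text \<open>The single functionals \<open>L M\<close> need not respect the reflection, but the limit
  moments do, because it is an isometry and fixes the vectors x that come from the kernel.\<close>

lemma kernel_tendsto_span:
  fixes L :: "nat \<Rightarrow> (real^'n \<Rightarrow> real) \<Rightarrow> real"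
  assumes fp: "\<And>M. finpos {y. norm y = 1} (L M)"
    and lim: "\<And>as. length as \<le> D \<Longrightarrow> (\<lambda>M. L M (lprod as)) \<longlonglongrightarrow> sph_wick as"
    and D: "degree Q + d \<le> D" and x: "norm x = 1" and "lin_span d p"
  shows "\<exists>l. (\<lambda>M. L M (\<lambda>y. poly Q (x \<bullet> y) * p y)) \<longlonglongrightarrow> l \<and>
    (\<lambda>M. L M (\<lambda>y. poly Q (x \<bullet> y) * p (refl_vec x y))) \<longlonglongrightarrow> l"
proof -
  from assms(5) obtain ps where ps: "\<forall>(c,as)\<in>set ps. length as \<le> d" and p: "\<And>y. p y = (\<Sum>(c,as)\<leftarrow>ps. c * lprod as y)"
    unfolding lin_span_def by auto
  have lr: "lprod as (refl_vec x y) = lprod (map (refl_vec x) as) y" for as y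
    by (induction as) (auto simp: refl_vec_inner(3)[OF x])
  show ?thesis unfolding p using ps
  proof (induction ps)
    case Nil
    then show ?case by (auto simp: finpos_linear(5)[OF fp] intro: exI[of _ 0])
  next
    case (Cons q ps)
    obtain c as where q: "q = (c, as)" by force
    have las: "degree Q + length as \<le> D" using Cons.prems D by (simp add: q)
    let ?s = "\<Sum>i\<le>degree Q. coeff Q i * sph_wick (replicate i x @ as)"
    have 1: "(\<lambda>M. L M (\<lambda>y. poly Q (x \<bullet> y) * lprod as y)) \<longlonglongrightarrow> ?s"
      by (rule kernel_tendsto[OF fp lim las])
    have "sph_wick (replicate i x @ map (refl_vec x) as) = sph_wick (replicate i x @ as)" for i
    proof -
      have "replicate i x @ map (refl_vec x) as = map (refl_vec x) (replicate i x @ as)"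
        by (simp add: refl_vec_inner(2)[OF x])
      then show ?thesis
        unfolding sph_wick_def using wick_map_isometry[of "refl_vec x" "replicate i x @ as"] refl_vec_inner(1)[OF x] by (simp add: refl_vec_inner(2)[OF x])
    qed
    then have 2: "(\<lambda>M. L M (\<lambda>y. poly Q (x \<bullet> y) * lprod as (refl_vec x y))) \<longlonglongrightarrow> ?s"
      unfolding lr using kernel_tendsto[OF fp lim, where Q=Q and as="map (refl_vec x) as" and x=x] las by simp
    from Cons obtain l where l: "(\<lambda>M. L M (\<lambda>y. poly Q (x \<bullet> y) * (\<Sum>(c, as)\<leftarrow>ps. c * lprod as y))) \<longlonglongrightarrow> l"
      "(\<lambda>M. L M (\<lambda>y. poly Q (x \<bullet> y) * (\<Sum>(c, as)\<leftarrow>ps. c * lprod as (refl_vec x y)))) \<longlonglongrightarrow> l" by auto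
    have sp: "poly Q u * (\<Sum>(c, as)\<leftarrow>q # ps. c * lprod as z) = c * (poly Q u * lprod as z) + poly Q u * (\<Sum>(c, as)\<leftarrow>ps. c * lprod as z)" for u z
      by (simp add: q algebra_simps)
    show ?case unfolding sp finpos_linear(1,2)[OF fp]
      by (intro exI[of _ "c * ?s + l"] conjI tendsto_intros 1 2 l)
  qed
qed


text \<open>Collects what is used of the kernel: images of products are polynomials of no larger
  degree, constants are preserved in the limit, the operator is a contraction, and it is close to
  the identity.\<close>

lemma sphere_kernel:
  fixes t d :: nat
  assumes "t \<ge> 1" "d \<ge> 1"
  obtains P :: "real poly" and L :: "nat \<Rightarrow> (real^'n \<Rightarrow> real) \<Rightarrow> real" where
    "degree P \<le> t" "\<And>M. finpos {y. norm y = 1} (L M)"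
    "\<And>as. length as \<le> d \<Longrightarrow> \<exists>g. poly_vec (length as) g \<and>
       (\<forall>x. norm x = 1 \<longrightarrow> (\<lambda>M. L M (\<lambda>y. (poly P (x \<bullet> y))\<^sup>2 * lprod as y)) \<longlonglongrightarrow> g x)"
    "\<And>x. norm x = 1 \<Longrightarrow> (\<lambda>M. L M (\<lambda>y. (poly P (x \<bullet> y))\<^sup>2)) \<longlonglongrightarrow> 1"
    "\<And>x p B l. norm x = 1 \<Longrightarrow> lin_span d p \<Longrightarrow> \<forall>y. norm y = 1 \<longrightarrow> \<bar>p y\<bar> \<le> B \<Longrightarrow>
       (\<lambda>M. L M (\<lambda>y. (poly P (x \<bullet> y))\<^sup>2 * p y)) \<longlonglongrightarrow> l \<Longrightarrow>
       \<bar>l\<bar> \<le> B \<and> \<bar>l - p x\<bar> \<le> 2 * real d ^ 3 * (real CARD('n) ^ 2 / real t ^ 2) * B"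
proof -
  let ?n = "real CARD('n)"
  have n: "CARD('n) \<ge> 1" by (simp add: Suc_leI)
  obtain P where P: "degree P \<le> t" "sph_mean ?n (P\<^sup>2) = 1" "sph_mean ?n (P\<^sup>2 * [:1, -1:]) \<le> ?n ^ 2 / real t ^ 2"
    using exists_concentrated_square[OF n assms(1)] by metis
  \<comment> \<open>Moments are needed for the squared kernel times 1 - u, of degree 2 t + 1, and
    times polynomials of degree d.\<close>
  define D where "D = 2 * t + 1 + d"
  obtain L :: "nat \<Rightarrow> (real^'n \<Rightarrow> real) \<Rightarrow> real" where L: "\<And>M. finpos {y. norm y = 1} (L M)"
    "\<And>as. length as \<le> D \<Longrightarrow> (\<lambda>M. L M (lprod as)) \<longlonglongrightarrow> sph_wick as"
    using sphere_functional[of D] by metis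
  have degP2: "degree (P\<^sup>2) \<le> 2 * t" using degree_power_le[of P 2] P(1) by linarith
  then have degP3: "degree (P\<^sup>2 * [:1, -1:]) \<le> 2 * t + 1" using degree_mult_le[of "P\<^sup>2" "[:1, -1:]"] by simp
  have pw: "(poly P u)\<^sup>2 = poly (P\<^sup>2) u" for u by simp
  have one: "(\<lambda>M. L M (\<lambda>y. (poly P (x \<bullet> y))\<^sup>2)) \<longlonglongrightarrow> 1" if "norm x = 1" for x
    unfolding pw using kernel_tendsto_mean[OF L, where Q="P\<^sup>2" and x=x] degP2 that P(2) by (simp add: D_def)
  show thesis
  proof (rule that[of P L])
    show "\<And>x. norm x = 1 \<Longrightarrow> (\<lambda>M. L M (\<lambda>y. (poly P (x \<bullet> y))\<^sup>2)) \<longlonglongrightarrow> 1" by (rule one)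
    show "degree P \<le> t" "\<And>M. finpos {y. norm y = 1} (L M)" by fact+
    fix as :: "(real^'n) list" assume las: "length as \<le> d"
    have "\<exists>g. \<forall>i. poly_vec (length as) (g i) \<and> (\<forall>x. norm x = 1 \<longrightarrow> sph_wick (replicate i x @ as) = g i x)"
      by (rule choice) (intro allI sph_wick_poly)
    then obtain g where g: "\<And>i. poly_vec (length as) (g i)" "\<And>i x. norm x = 1 \<Longrightarrow> sph_wick (replicate i x @ as) = g i x"
      by metis
    show "\<exists>g. poly_vec (length as) g \<and> (\<forall>x. norm x = 1 \<longrightarrow> (\<lambda>M. L M (\<lambda>y. (poly P (x \<bullet> y))\<^sup>2 * lprod as y)) \<longlonglongrightarrow> g x)"
    proof (intro exI[of _ "\<lambda>x. \<Sum>i\<le>degree (P\<^sup>2). coeff (P\<^sup>2) i * g i x"] conjI allI impI)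
      show "poly_vec (length as) (\<lambda>x. \<Sum>i\<le>degree (P\<^sup>2). coeff (P\<^sup>2) i * g i x)"
        by (intro poly_vec_sum poly_vec_cmult g)
      fix x :: "real^'n" assume x: "norm x = 1"
      have "degree (P\<^sup>2) + length as \<le> D" using degP2 las by (simp add: D_def)
      from kernel_tendsto[OF L this, where x=x]
      show "(\<lambda>M. L M (\<lambda>y. (poly P (x \<bullet> y))\<^sup>2 * lprod as y)) \<longlonglongrightarrow> (\<Sum>i\<le>degree (P\<^sup>2). coeff (P\<^sup>2) i * g i x)"
        unfolding pw by (simp only: g(2)[OF x])
    qed
  next
    fix x :: "real^'n" and p B l
    assume x: "norm x = 1" and p: "lin_span d p" and "\<forall>y. norm y = 1 \<longrightarrow> \<bar>p y\<bar> \<le> B"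
      and lim: "(\<lambda>M. L M (\<lambda>y. (poly P (x \<bullet> y))\<^sup>2 * p y)) \<longlonglongrightarrow> l"
    then have B: "\<And>y. norm y = 1 \<Longrightarrow> \<bar>p y\<bar> \<le> B" by blast
    have B0: "B \<ge> 0" using B[OF x] by linarith
    note one = one[OF x]
    have 1: "\<bar>l\<bar> \<le> B"
    proof (rule LIMSEQ_le[OF tendsto_rabs[OF lim]])
      show "(\<lambda>M. B * L M (\<lambda>y. (poly P (x \<bullet> y))\<^sup>2)) \<longlonglongrightarrow> B"
        using tendsto_mult_left[OF one, of B] by simp
      have "\<bar>L M (\<lambda>y. (poly P (x \<bullet> y))\<^sup>2 * p y)\<bar> \<le> B * L M (\<lambda>y. (poly P (x \<bullet> y))\<^sup>2)" for M
      proof (rule abs_leI)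
        have "(poly P (x \<bullet> y))\<^sup>2 * p y \<le> B * (poly P (x \<bullet> y))\<^sup>2"
          "(poly P (x \<bullet> y))\<^sup>2 * (- p y) \<le> B * (poly P (x \<bullet> y))\<^sup>2" if "norm y = 1" for y
          using mult_left_mono[of "p y" B "(poly P (x \<bullet> y))\<^sup>2"] mult_left_mono[of "- p y" B "(poly P (x \<bullet> y))\<^sup>2"] B[OF that]
          by (auto simp: mult.commute abs_le_iff)
        then show "L M (\<lambda>y. (poly P (x \<bullet> y))\<^sup>2 * p y) \<le> B * L M (\<lambda>y. (poly P (x \<bullet> y))\<^sup>2)"
          "- L M (\<lambda>y. (poly P (x \<bullet> y))\<^sup>2 * p y) \<le> B * L M (\<lambda>y. (poly P (x \<bullet> y))\<^sup>2)"
          using finpos_le[OF L(1), of "\<lambda>y. (poly P (x \<bullet> y))\<^sup>2 * p y" "\<lambda>y. B * (poly P (x \<bullet> y))\<^sup>2" M]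
            finpos_le[OF L(1), of "\<lambda>y. -1 * ((poly P (x \<bullet> y))\<^sup>2 * p y)" "\<lambda>y. B * (poly P (x \<bullet> y))\<^sup>2" M]
          unfolding finpos_linear(2)[OF L(1)] by auto
      qed
      then show "\<exists>N. \<forall>M\<ge>N. \<bar>L M (\<lambda>y. (poly P (x \<bullet> y))\<^sup>2 * p y)\<bar> \<le> B * L M (\<lambda>y. (poly P (x \<bullet> y))\<^sup>2)" by blast
    qed
    let ?c = "2 * real d ^ 3 * B"
    \<comment> \<open>By the reflection symmetry of the limit this integrand has the limit
      \<open>l - p x\<close>, and in contrast to the unsymmetrised one it is bounded pointwise by
      \<open>circle_bound\<close>.\<close>
    let ?f = "\<lambda>y. (poly P (x \<bullet> y))\<^sup>2 * ((p y + p (refl_vec x y)) / 2 - p x)"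
    have 2: "\<bar>l - p x\<bar> \<le> ?c * sph_mean ?n (P\<^sup>2 * [:1, -1:])"
    proof (rule LIMSEQ_le)
      have D: "degree (P\<^sup>2) + d \<le> D" using degP2 by (simp add: D_def)
      obtain l' where l': "(\<lambda>M. L M (\<lambda>y. (poly P (x \<bullet> y))\<^sup>2 * p y)) \<longlonglongrightarrow> l'"
         "(\<lambda>M. L M (\<lambda>y. (poly P (x \<bullet> y))\<^sup>2 * p (refl_vec x y))) \<longlonglongrightarrow> l'"
        using kernel_tendsto_span[OF L D x p] unfolding pw by auto
      have ll: "l' = l" using LIMSEQ_unique[OF l'(1) lim] .
      have "L M ?f = (L M (\<lambda>y. (poly P (x \<bullet> y))\<^sup>2 * p y) + L M (\<lambda>y. (poly P (x \<bullet> y))\<^sup>2 * p (refl_vec x y))) / 2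
         - p x * L M (\<lambda>y. (poly P (x \<bullet> y))\<^sup>2)" for M
        unfolding finpos_linear(1-4)[OF L(1), symmetric] by (rule arg_cong[where f="L M"]) (auto simp: algebra_simps add_divide_distrib)
      moreover have "(\<lambda>M. (L M (\<lambda>y. (poly P (x \<bullet> y))\<^sup>2 * p y) + L M (\<lambda>y. (poly P (x \<bullet> y))\<^sup>2 * p (refl_vec x y))) / 2
         - p x * L M (\<lambda>y. (poly P (x \<bullet> y))\<^sup>2)) \<longlonglongrightarrow> (l + l) / 2 - p x * 1"
        using l' unfolding ll by (intro tendsto_intros one) auto
      ultimately have "(\<lambda>M. L M ?f) \<longlonglongrightarrow> l - p x" by simp
      then show "(\<lambda>M. \<bar>L M ?f\<bar>) \<longlonglongrightarrow> \<bar>l - p x\<bar>" by (rule tendsto_rabs)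
      have "(\<lambda>M. L M (\<lambda>y. poly (P\<^sup>2 * [:1, -1:]) (x \<bullet> y))) \<longlonglongrightarrow> sph_mean ?n (P\<^sup>2 * [:1, -1:])"
        by (rule kernel_tendsto_mean[OF L]) (use degP3 x in \<open>auto simp: D_def\<close>)
      then show "(\<lambda>M. ?c * L M (\<lambda>y. poly (P\<^sup>2 * [:1, -1:]) (x \<bullet> y))) \<longlonglongrightarrow> ?c * sph_mean ?n (P\<^sup>2 * [:1, -1:])"
        by (intro tendsto_mult tendsto_const)
      have "\<bar>L M ?f\<bar> \<le> ?c * L M (\<lambda>y. poly (P\<^sup>2 * [:1, -1:]) (x \<bullet> y))" for M
      proof (rule abs_leI)
        let ?g = "\<lambda>y. ?c * poly (P\<^sup>2 * [:1, -1:]) (x \<bullet> y)"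
        have "?f y \<le> ?g y" "-1 * ?f y \<le> ?g y" if "norm y = 1" for y
        proof -
          have "\<bar>(p y + p (refl_vec x y)) / 2 - p x\<bar> \<le> ?c * (1 - x \<bullet> y)"
            by (rule circle_bound[OF p assms(2) B x that])
          then have "(poly P (x \<bullet> y))\<^sup>2 * \<bar>(p y + p (refl_vec x y)) / 2 - p x\<bar> \<le> (poly P (x \<bullet> y))\<^sup>2 * (?c * (1 - x \<bullet> y))"
            by (intro mult_left_mono) auto
          also have "\<dots> = ?g y" by (simp add: algebra_simps)
          finally have "\<bar>?f y\<bar> \<le> ?g y" by (simp add: abs_mult)
          then show "?f y \<le> ?g y" "-1 * ?f y \<le> ?g y" by (auto simp: abs_le_iff)
        qed
        then show "L M ?f \<le> ?c * L M (\<lambda>y. poly (P\<^sup>2 * [:1, -1:]) (x \<bullet> y))"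
          "- L M ?f \<le> ?c * L M (\<lambda>y. poly (P\<^sup>2 * [:1, -1:]) (x \<bullet> y))"
          using finpos_le[OF L(1), of ?f ?g M] finpos_le[OF L(1), of "\<lambda>y. -1 * ?f y" ?g M]
          unfolding finpos_linear(2)[OF L(1)] by auto
      qed
      then show "\<exists>N. \<forall>M\<ge>N. \<bar>L M ?f\<bar> \<le> ?c * L M (\<lambda>y. poly (P\<^sup>2 * [:1, -1:]) (x \<bullet> y))" by blast
    qed
    also have "\<dots> \<le> ?c * (?n ^ 2 / real t ^ 2)" by (intro mult_left_mono P(3)) (use B0 in auto)
    finally show "\<bar>l\<bar> \<le> B \<and> \<bar>l - p x\<bar> \<le> 2 * real d ^ 3 * (?n ^ 2 / real t ^ 2) * B"
      using 1 by (simp add: mult_ac)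
  qed
qed

section \<open>Kernel operators on products of spheres\<close>

definition upd_blk :: "'m \<Rightarrow> 'a \<Rightarrow> 'a^'m \<Rightarrow> 'a^'m" where
  "upd_blk j y x = (\<chi> i. if i = j then y else x $ i)"

lemma upd_blk_Xset: "x \<in> Xset \<Longrightarrow> norm y = 1 \<Longrightarrow> upd_blk j y x \<in> Xset"
  by (simp add: Xset_def upd_blk_def)

lemma upd_blk_same [simp]: "upd_blk j (x $ j) x = x"
  by (simp add: upd_blk_def vec_eq_iff)

lemma lin_span_add: "lin_span d p \<Longrightarrow> lin_span d q \<Longrightarrow> lin_span d (\<lambda>y. p y + q y)"
  unfolding lin_span_def
proof (elim exE conjE, goal_cases)
  case (1 ps qs)
  then show ?case by (intro exI[of _ "ps @ qs"]) auto
qed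

lemma lin_span_lprod: "length as \<le> d \<Longrightarrow> lin_span d (\<lambda>y. c * lprod as y)"
  unfolding lin_span_def by (intro exI[of _ "[(c, as)]"]) auto

lemma lin_span_sum: "(\<And>i. i \<in> I \<Longrightarrow> lin_span d (p i)) \<Longrightarrow> lin_span d (\<lambda>y. \<Sum>i\<in>I. p i y)"
proof (induction I rule: infinite_finite_induct)
  case (insert i I)
  then show ?case by (simp add: lin_span_add)
qed (auto simp: lin_span_def intro!: exI[of _ "[]"])

lemma monomial_lprod:
  "finite S \<Longrightarrow> \<exists>as. length as = (\<Sum>i\<in>S. a i) \<and> (\<forall>y::real^'n. (\<Prod>i\<in>S. (y $ i) ^ a i) = lprod as y)"
proof (induction S rule: finite_induct)
  case empty
  show ?case by (intro exI[of _ "[]"]) simp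
next
  case (insert i S)
  then obtain as where "length as = (\<Sum>i\<in>S. a i)" "\<And>y::real^'n. (\<Prod>i\<in>S. (y $ i) ^ a i) = lprod as y" by auto
  moreover have "lprod (replicate k (axis i 1)) y = (y $ i) ^ k" for k and y :: "real^'n"
    by (induction k) (auto simp: inner_axis')
  ultimately show ?case using insert.hyps
    by (intro exI[of _ "replicate (a i) (axis i 1) @ as"]) auto
qed

definition rest_mon :: "'m \<Rightarrow> ('m \<times> 'n \<Rightarrow> nat) \<Rightarrow> real^'n^'m \<Rightarrow> real" where
  "rest_mon j \<alpha> x = (\<Prod>v\<in>(UNIV - {j}) \<times> UNIV. (x $ fst v $ snd v) ^ \<alpha> v)"

lemma block_split: "(UNIV :: ('m \<times> 'n) set) = (UNIV - {j}) \<times> UNIV \<union> {j} \<times> UNIV"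
  by auto

lemma bmon_split: "bmon \<alpha> x = rest_mon j \<alpha> x * (\<Prod>i\<in>UNIV. (x $ j $ i) ^ \<alpha> (j, i))"
proof -
  have "bmon \<alpha> x = rest_mon j \<alpha> x * (\<Prod>v\<in>{j} \<times> UNIV. (x $ fst v $ snd v) ^ \<alpha> v)"
    unfolding bmon_def rest_mon_def by (subst block_split[of j], rule prod.union_disjoint) auto
  also have "(\<Prod>v\<in>{j} \<times> UNIV. (x $ fst v $ snd v) ^ \<alpha> v) = (\<Prod>i\<in>UNIV. (x $ j $ i) ^ \<alpha> (j, i))"
    by (rule prod.reindex_bij_witness[of _ "\<lambda>i. (j, i)" snd]) auto
  finally show ?thesis .
qed

lemma exponent_sum_split: "(\<Sum>v\<in>UNIV. \<alpha> v) = (\<Sum>v\<in>(UNIV - {j}) \<times> UNIV. \<alpha> v) + (\<Sum>i\<in>UNIV. \<alpha> (j, i) :: nat)"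
  for j :: "'m::finite" and \<alpha> :: "'m \<times> 'n::finite \<Rightarrow> nat"
proof -
  have "(\<Sum>v\<in>UNIV. \<alpha> v) = (\<Sum>v\<in>(UNIV - {j}) \<times> UNIV. \<alpha> v) + (\<Sum>v\<in>{j} \<times> UNIV. \<alpha> v)"
    by (subst block_split[of j], rule sum.union_disjoint) auto
  also have "(\<Sum>v\<in>{j} \<times> UNIV. \<alpha> v) = (\<Sum>i\<in>UNIV. \<alpha> (j, i))"
    by (rule sum.reindex_bij_witness[of _ "\<lambda>i. (j, i)" snd]) auto
  finally show ?thesis .
qed

lemma rest_mon_upd: "rest_mon j \<alpha> (upd_blk j y x) = rest_mon j \<alpha> x"
  unfolding rest_mon_def by (intro prod.cong) (auto simp: upd_blk_def)

lemma poly_blk_rest_mon: "poly_blk (\<Sum>v\<in>(UNIV - {j}) \<times> UNIV. \<alpha> v) (rest_mon j \<alpha> :: real^'n^'m \<Rightarrow> real)"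
proof -
  have "poly_blk (\<alpha> v) (\<lambda>x::real^'n^'m. (x $ fst v $ snd v) ^ \<alpha> v)" for v
    using poly_blk_power[OF poly_blk_coord, of 1 "\<alpha> v"] by simp
  then show ?thesis unfolding rest_mon_def[abs_def] by (intro poly_blk_prod)
qed

lemma poly_blk_of_poly_vec:
  fixes g :: "real^'n \<Rightarrow> real" and j :: "'m::finite"
  assumes "poly_vec k g" shows "poly_blk k (\<lambda>x::real^'n^'m. g (x $ j))"
proof -
  obtain A c where A: "finite A" "\<And>\<alpha>. \<alpha> \<in> A \<Longrightarrow> (\<Sum>v\<in>UNIV. \<alpha> v) \<le> k"
    "\<And>y::'n \<Rightarrow> real. g (vec_lambda y) = (\<Sum>\<alpha>\<in>A. c \<alpha> * (\<Prod>v\<in>UNIV. y v ^ \<alpha> v))"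
    using mpoly_fun_degE[OF assms[unfolded poly_vec_def]] by metis
  have g: "g (x $ j) = (\<Sum>\<alpha>\<in>A. c \<alpha> * (\<Prod>v\<in>UNIV. (x $ j $ v) ^ \<alpha> v))" for x :: "real^'n^'m"
    using A(3)[of "\<lambda>v. x $ j $ v"] by simp
  have m: "poly_blk k (\<lambda>x::real^'n^'m. \<Prod>v\<in>UNIV. (x $ j $ v) ^ \<alpha> v)" if "\<alpha> \<in> A" for \<alpha>
  proof (rule poly_blk_mono[OF poly_blk_prod A(2)[OF that]])
    show "poly_blk (\<alpha> v) (\<lambda>x::real^'n^'m. (x $ j $ v) ^ \<alpha> v)" for v
      using poly_blk_power[OF poly_blk_coord, of 1 "\<alpha> v"] by simp
  qed
  show ?thesis unfolding g by (intro poly_blk_sum poly_blk_cmult m)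
qed

lemma lin_span_block:
  fixes f :: "real^'n^'m \<Rightarrow> real"
  assumes "poly_blk d f" shows "lin_span d (\<lambda>y. f (upd_blk j y x))"
proof -
  obtain A c where A: "finite A" "\<And>\<alpha>. \<alpha> \<in> A \<Longrightarrow> (\<Sum>v\<in>UNIV. \<alpha> v) \<le> d"
    "\<And>x. f x = (\<Sum>\<alpha>\<in>A. c \<alpha> * bmon \<alpha> x)" using poly_blkE[OF assms] by metis
  show ?thesis unfolding A(3)
  proof (rule lin_span_sum)
    fix \<alpha> assume \<alpha>: "\<alpha> \<in> A"
    obtain as where "length as = (\<Sum>i\<in>UNIV. \<alpha> (j, i)) \<and> (\<forall>y::real^'n. (\<Prod>i\<in>UNIV. (y $ i) ^ \<alpha> (j, i)) = lprod as y)"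
      using monomial_lprod[OF finite, where S=UNIV and a="\<lambda>i. \<alpha> (j, i)"] ..
    then have as: "length as = (\<Sum>i\<in>UNIV. \<alpha> (j, i))" "\<And>y::real^'n. (\<Prod>i\<in>UNIV. (y $ i) ^ \<alpha> (j, i)) = lprod as y"
      by blast+
    have "c \<alpha> * bmon \<alpha> (upd_blk j y x) = (c \<alpha> * rest_mon j \<alpha> x) * lprod as y" for y
      unfolding bmon_split[of _ _ j] rest_mon_upd by (simp add: upd_blk_def as(2))
    moreover have "lin_span d (\<lambda>y. (c \<alpha> * rest_mon j \<alpha> x) * lprod as y)"
      using A(2)[OF \<alpha>] exponent_sum_split[of \<alpha> j] as(1) by (intro lin_span_lprod) simp
    ultimately show "lin_span d (\<lambda>y. c \<alpha> * bmon \<alpha> (upd_blk j y x))" by (simp only:)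
  qed
qed

text \<open>Coordinates outside block j are constants for the average over that block, so each
  monomial reduces to the result on one sphere.\<close>

lemma block_kernel_exists:
  fixes f :: "real^'n^'m \<Rightarrow> real" and L :: "nat \<Rightarrow> (real^'n \<Rightarrow> real) \<Rightarrow> real"
  assumes fp: "\<And>M. finpos {y. norm y = 1} (L M)"
    and lim: "\<And>as. length as \<le> d \<Longrightarrow> \<exists>g. poly_vec (length as) g \<and>
       (\<forall>x. norm x = 1 \<longrightarrow> (\<lambda>M. L M (\<lambda>y. (poly P (x \<bullet> y))\<^sup>2 * lprod as y)) \<longlonglongrightarrow> g x)"
    and "poly_blk d f"
  shows "\<exists>g. poly_blk d g \<and> (\<forall>x\<in>Xset. (\<lambda>M. L M (\<lambda>y. (poly P (x $ j \<bullet> y))\<^sup>2 * f (upd_blk j y x))) \<longlonglongrightarrow> g x)"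
proof -
  obtain A c where A: "finite A" "\<And>\<alpha>. \<alpha> \<in> A \<Longrightarrow> (\<Sum>v\<in>UNIV. \<alpha> v) \<le> d"
    "\<And>x. f x = (\<Sum>\<alpha>\<in>A. c \<alpha> * bmon \<alpha> x)" using poly_blkE[OF assms(3)] by metis
  have "\<forall>\<alpha>\<in>A. \<exists>g. poly_blk d g \<and> (\<forall>x\<in>Xset. (\<lambda>M. L M (\<lambda>y. (poly P (x $ j \<bullet> y))\<^sup>2 * bmon \<alpha> (upd_blk j y x))) \<longlonglongrightarrow> g x)"
  proof
    fix \<alpha> assume \<alpha>: "\<alpha> \<in> A"
    obtain as where "length as = (\<Sum>i\<in>UNIV. \<alpha> (j, i)) \<and> (\<forall>y::real^'n. (\<Prod>i\<in>UNIV. (y $ i) ^ \<alpha> (j, i)) = lprod as y)"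
      using monomial_lprod[OF finite, where S=UNIV and a="\<lambda>i. \<alpha> (j, i)"] ..
    then have as: "length as = (\<Sum>i\<in>UNIV. \<alpha> (j, i))" "\<And>y::real^'n. (\<Prod>i\<in>UNIV. (y $ i) ^ \<alpha> (j, i)) = lprod as y"
      by blast+
    have las: "length as \<le> d" using A(2)[OF \<alpha>] exponent_sum_split[of \<alpha> j] as(1) by simp
    obtain g where g: "poly_vec (length as) g" "\<And>x. norm x = 1 \<Longrightarrow> (\<lambda>M. L M (\<lambda>y. (poly P (x \<bullet> y))\<^sup>2 * lprod as y)) \<longlonglongrightarrow> g x"
      using lim[OF las] by auto
    show "\<exists>g. poly_blk d g \<and> (\<forall>x\<in>Xset. (\<lambda>M. L M (\<lambda>y. (poly P (x $ j \<bullet> y))\<^sup>2 * bmon \<alpha> (upd_blk j y x))) \<longlonglongrightarrow> g x)"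
    proof (intro exI[of _ "\<lambda>x. rest_mon j \<alpha> x * g (x $ j)"] conjI ballI)
      show "poly_blk d (\<lambda>x. rest_mon j \<alpha> x * g (x $ j))"
        by (rule poly_blk_mono[OF poly_blk_mult[OF poly_blk_rest_mon poly_blk_of_poly_vec[OF g(1)]]])
          (use A(2)[OF \<alpha>] exponent_sum_split[of \<alpha> j] as(1) in simp)
      fix x :: "real^'n^'m" assume "x \<in> Xset"
      then have x: "norm (x $ j) = 1" by (simp add: Xset_def)
      have "(poly P (x $ j \<bullet> y))\<^sup>2 * bmon \<alpha> (upd_blk j y x) = rest_mon j \<alpha> x * ((poly P (x $ j \<bullet> y))\<^sup>2 * lprod as y)" for y
        unfolding bmon_split[of _ _ j] rest_mon_upd by (simp add: upd_blk_def as(2))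
      then show "(\<lambda>M. L M (\<lambda>y. (poly P (x $ j \<bullet> y))\<^sup>2 * bmon \<alpha> (upd_blk j y x))) \<longlonglongrightarrow> rest_mon j \<alpha> x * g (x $ j)"
        using tendsto_mult_left[OF g(2)[OF x]] by (simp only: finpos_linear(2)[OF fp])
    qed
  qed
  from bchoice[OF this] obtain G where GG: "\<forall>\<alpha>\<in>A. poly_blk d (G \<alpha>) \<and>
     (\<forall>x\<in>Xset. (\<lambda>M. L M (\<lambda>y. (poly P (x $ j \<bullet> y))\<^sup>2 * bmon \<alpha> (upd_blk j y x))) \<longlonglongrightarrow> G \<alpha> x)" ..
  then have G: "\<And>\<alpha>. \<alpha> \<in> A \<Longrightarrow> poly_blk d (G \<alpha>)"
    "\<And>\<alpha> x. \<alpha> \<in> A \<Longrightarrow> x \<in> Xset \<Longrightarrow> (\<lambda>M. L M (\<lambda>y. (poly P (x $ j \<bullet> y))\<^sup>2 * bmon \<alpha> (upd_blk j y x))) \<longlonglongrightarrow> G \<alpha> x"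
    by simp_all
  show ?thesis
  proof (intro exI[of _ "\<lambda>x. \<Sum>\<alpha>\<in>A. c \<alpha> * G \<alpha> x"] conjI ballI)
    show "poly_blk d (\<lambda>x. \<Sum>\<alpha>\<in>A. c \<alpha> * G \<alpha> x)" by (intro poly_blk_sum poly_blk_cmult G)
    fix x :: "real^'n^'m" assume x: "x \<in> Xset"
    have "(poly P (x $ j \<bullet> y))\<^sup>2 * f (upd_blk j y x) = (\<Sum>\<alpha>\<in>A. c \<alpha> * ((poly P (x $ j \<bullet> y))\<^sup>2 * bmon \<alpha> (upd_blk j y x)))" for y
      unfolding A(3) sum_distrib_left by (intro sum.cong refl) (simp only: mult_ac)
    then have "(\<lambda>M. L M (\<lambda>y. (poly P (x $ j \<bullet> y))\<^sup>2 * f (upd_blk j y x))) =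
        (\<lambda>M. \<Sum>\<alpha>\<in>A. c \<alpha> * L M (\<lambda>y. (poly P (x $ j \<bullet> y))\<^sup>2 * bmon \<alpha> (upd_blk j y x)))"
      by (simp only: finpos_linear(2)[OF fp] finpos_commute_sum[OF fp])
    then show "(\<lambda>M. L M (\<lambda>y. (poly P (x $ j \<bullet> y))\<^sup>2 * f (upd_blk j y x))) \<longlonglongrightarrow> (\<Sum>\<alpha>\<in>A. c \<alpha> * G \<alpha> x)"
      by (simp only:) (intro tendsto_sum tendsto_mult tendsto_const G x)
  qed
qed

text \<open>The argument at which f is evaluated once the blocks in \<open>js\<close> have been
  averaged; it is y itself when \<open>js\<close> lists every block.\<close>

definition override_blks :: "'m list \<Rightarrow> 'a^'m \<Rightarrow> 'a^'m \<Rightarrow> 'a^'m" where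
  "override_blks js y x = (\<chi> j. if j \<in> set js then y $ j else x $ j)"

primrec kcomp :: "('m \<Rightarrow> ('f \<Rightarrow> 'f)) \<Rightarrow> 'm list \<Rightarrow> 'f \<Rightarrow> 'f" where
  "kcomp K [] f = f"
| "kcomp K (j # js) f = K j (kcomp K js f)"

section \<open>Inverting and sampling the composed operators\<close>

text \<open>\<open>K j f\<close> is some polynomial that agrees with the limit on
  \<open>Xset\<close>. Nothing is known of it elsewhere, so linearity and congruence are stated on
  \<open>Xset\<close> and derived from the limits and from \<open>K_le\<close>.\<close>

context
  fixes P :: "real poly" and L :: "nat \<Rightarrow> (real^'n \<Rightarrow> real) \<Rightarrow> real" and d :: nat and \<delta> :: real
    and K :: "'m \<Rightarrow> (real^'n^'m \<Rightarrow> real) \<Rightarrow> real^'n^'m \<Rightarrow> real"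
  assumes fp: "\<And>M. finpos {y. norm y = 1} (L M)"
    and K_poly: "\<And>j f. poly_blk d f \<Longrightarrow> poly_blk d (K j f)"
    and K_lim: "\<And>j f x. poly_blk d f \<Longrightarrow> x \<in> Xset \<Longrightarrow>
      (\<lambda>M. L M (\<lambda>y. (poly P (x $ j \<bullet> y))\<^sup>2 * f (upd_blk j y x))) \<longlonglongrightarrow> K j f x"
    and K_le: "\<And>j f B x. poly_blk d f \<Longrightarrow> (\<And>x. x \<in> Xset \<Longrightarrow> \<bar>f x\<bar> \<le> B) \<Longrightarrow> x \<in> Xset \<Longrightarrow> \<bar>K j f x\<bar> \<le> B"
    and K_near: "\<And>j f B x. poly_blk d f \<Longrightarrow> (\<And>x. x \<in> Xset \<Longrightarrow> \<bar>f x\<bar> \<le> B) \<Longrightarrow> x \<in> Xset \<Longrightarrow> \<bar>K j f x - f x\<bar> \<le> \<delta> * B"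
    and K_const: "\<And>j c x. x \<in> Xset \<Longrightarrow> K j (\<lambda>x. c) x = c"
    and \<delta>: "0 \<le> \<delta>" "\<delta> < 1"
begin

lemma K_add:
  assumes "poly_blk d f" "poly_blk d g" "x \<in> Xset"
  shows "K j (\<lambda>x. f x + g x) x = K j f x + K j g x"
proof (rule LIMSEQ_unique[OF K_lim[OF poly_blk_add[OF assms(1,2)] assms(3)]])
  show "(\<lambda>M. L M (\<lambda>y. (poly P (x $ j \<bullet> y))\<^sup>2 * (f (upd_blk j y x) + g (upd_blk j y x)))) \<longlonglongrightarrow> K j f x + K j g x"
    unfolding distrib_left finpos_linear(1)[OF fp] by (intro tendsto_add K_lim assms)
qed

lemma K_diff:
  assumes "poly_blk d f" "poly_blk d g" "x \<in> Xset"
  shows "K j (\<lambda>x. f x - g x) x = K j f x - K j g x"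
  using K_add[OF poly_blk_diff[OF assms(1,2)] assms(2,3), of j] by simp

lemma K_cong:
  assumes "poly_blk d f" "poly_blk d g" "\<And>x. x \<in> Xset \<Longrightarrow> f x = g x" "x \<in> Xset"
  shows "K j f x = K j g x"
proof -
  have "\<bar>K j (\<lambda>x. f x - g x) x\<bar> \<le> 0"
    by (rule K_le[OF poly_blk_diff[OF assms(1,2)] _ assms(4)]) (simp add: assms(3))
  then show ?thesis using K_diff[OF assms(1,2,4), of j] by simp
qed

text \<open>Partial sums of the Neumann series: the residual \<open>f - K j g\<close> is added to g,
  and by \<open>K_near\<close> the new residual is smaller by the factor \<delta>.\<close>

lemma K_neumann:
  assumes "poly_blk d f" "\<And>x. x \<in> Xset \<Longrightarrow> \<bar>f x\<bar> \<le> B"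
  shows "\<exists>g. poly_blk d g \<and> (\<forall>x\<in>Xset. \<bar>K j g x - f x\<bar> \<le> \<delta> ^ Suc N * B \<and> \<bar>g x - f x\<bar> \<le> (\<Sum>i<N. \<delta> ^ Suc i) * B)"
proof (induction N)
  case 0
  show ?case using assms K_near[OF assms] by (intro exI[of _ f]) auto
next
  case (Suc N)
  then obtain g where g: "poly_blk d g" "\<And>x. x \<in> Xset \<Longrightarrow> \<bar>K j g x - f x\<bar> \<le> \<delta> ^ Suc N * B"
    "\<And>x. x \<in> Xset \<Longrightarrow> \<bar>g x - f x\<bar> \<le> (\<Sum>i<N. \<delta> ^ Suc i) * B" by blast
  define r where "r = (\<lambda>x. f x - K j g x)"
  have r: "poly_blk d r" unfolding r_def by (intro poly_blk_diff assms K_poly g)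
  have rB: "\<bar>r x\<bar> \<le> \<delta> ^ Suc N * B" if "x \<in> Xset" for x
    using g(2)[OF that] by (simp add: r_def abs_minus_commute)
  show ?case
  proof (intro exI[of _ "\<lambda>x. g x + r x"] conjI ballI)
    show "poly_blk d (\<lambda>x. g x + r x)" by (intro poly_blk_add g r)
    fix x :: "real^'n^'m" assume x: "x \<in> Xset"
    have "K j (\<lambda>x. g x + r x) x - f x = K j r x - r x"
      unfolding K_add[OF g(1) r x] by (simp add: r_def)
    then show "\<bar>K j (\<lambda>x. g x + r x) x - f x\<bar> \<le> \<delta> ^ Suc (Suc N) * B"
      using K_near[OF r rB x, of j] by (simp add: mult.assoc)
    have "\<bar>g x + r x - f x\<bar> \<le> \<bar>g x - f x\<bar> + \<bar>r x\<bar>" by linarith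
    then show "\<bar>g x + r x - f x\<bar> \<le> (\<Sum>i<Suc N. \<delta> ^ Suc i) * B"
      using g(3)[OF x] rB[OF x] by (simp add: distrib_right)
  qed
qed

lemma K_approx_inverse:
  assumes "poly_blk d f" "\<And>x. x \<in> Xset \<Longrightarrow> \<bar>f x\<bar> \<le> B" "B \<ge> 0" "\<epsilon> > 0"
  shows "\<exists>g. poly_blk d g \<and> (\<forall>x\<in>Xset. \<bar>K j g x - f x\<bar> \<le> \<epsilon> \<and> \<bar>g x - f x\<bar> \<le> \<delta> / (1 - \<delta>) * B)"
proof -
  have "(\<lambda>N. \<delta> ^ Suc N * B) \<longlonglongrightarrow> 0 * B"
    using \<delta> by (intro tendsto_mult tendsto_const LIMSEQ_Suc[OF LIMSEQ_power_zero]) auto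
  then have "\<forall>\<^sub>F N in sequentially. \<delta> ^ Suc N * B < \<epsilon>" using assms(4) by (intro order_tendstoD(2)) auto
  then obtain N where N: "\<delta> ^ Suc N * B < \<epsilon>" by (auto simp: eventually_sequentially)
  have "(\<Sum>i<N. \<delta> ^ Suc i) = \<delta> * (\<Sum>i<N. \<delta> ^ i)" by (simp add: sum_distrib_left)
  also have "(\<Sum>i<N. \<delta> ^ i) = (1 - \<delta> ^ N) / (1 - \<delta>)"
    using \<delta> geometric_sum[of \<delta> N] by (simp add: field_simps)
  also have "\<delta> * ((1 - \<delta> ^ N) / (1 - \<delta>)) \<le> \<delta> * (1 / (1 - \<delta>))"
    using \<delta> by (intro mult_left_mono divide_right_mono) auto
  finally have S: "(\<Sum>i<N. \<delta> ^ Suc i) * B \<le> \<delta> / (1 - \<delta>) * B" using assms(3) by (intro mult_right_mono) auto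
  show ?thesis using K_neumann[OF assms(1,2), of j N] N S by (meson order_trans less_imp_le)
qed

lemma kcomp_poly: "poly_blk d f \<Longrightarrow> poly_blk d (kcomp K js f)"
  by (induction js) (auto intro: K_poly)

lemma kcomp_add_const:
  assumes "poly_blk d f" shows "x \<in> Xset \<Longrightarrow> kcomp K js (\<lambda>x. f x + c) x = kcomp K js f x + c"
proof (induction js arbitrary: x)
  case (Cons j js)
  have "K j (kcomp K js (\<lambda>x. f x + c)) x = K j (\<lambda>x. kcomp K js f x + c) x"
    by (rule K_cong) (intro kcomp_poly poly_blk_add poly_blk_const assms Cons | simp add: Cons)+
  also have "\<dots> = K j (kcomp K js f) x + c"
    by (simp add: K_add[OF kcomp_poly[OF assms] poly_blk_const Cons.prems] K_const[OF Cons.prems])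
  finally show ?case by simp
qed simp

text \<open>The outermost operator is inverted first. With q = 1/(1 - \<delta>) its preimage is
  bounded by q B, and (q - 1) B + (q^k - 1) q B = (q^(k+1) - 1) B. The error of the inner inversion
  passes through \<open>K j\<close> without growing.\<close>

lemma kcomp_approx_inverse:
  assumes "poly_blk d f" "\<And>x. x \<in> Xset \<Longrightarrow> \<bar>f x\<bar> \<le> B" "B \<ge> 0" "\<epsilon> > 0"
  shows "\<exists>g. poly_blk d g \<and> (\<forall>x\<in>Xset. \<bar>kcomp K js g x - f x\<bar> \<le> \<epsilon> \<and> \<bar>g x - f x\<bar> \<le> ((1 / (1 - \<delta>)) ^ length js - 1) * B)"
  using assms
proof (induction js arbitrary: f B \<epsilon>)
  case Nil
  then show ?case by (intro exI[of _ f]) auto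
next
  case (Cons j js)
  define q where "q = 1 / (1 - \<delta>)"
  have q: "q \<ge> 1" "\<delta> / (1 - \<delta>) = q - 1" using \<delta> by (auto simp: q_def field_simps)
  obtain g1 where g1: "poly_blk d g1" "\<And>x. x \<in> Xset \<Longrightarrow> \<bar>K j g1 x - f x\<bar> \<le> \<epsilon> / 2"
    "\<And>x. x \<in> Xset \<Longrightarrow> \<bar>g1 x - f x\<bar> \<le> (q - 1) * B"
    using K_approx_inverse[OF Cons.prems(1-3), of "\<epsilon> / 2" j] Cons.prems(4) unfolding q by auto
  have B1: "\<bar>g1 x\<bar> \<le> q * B" if "x \<in> Xset" for x
    using g1(3)[OF that] Cons.prems(2)[OF that] by (simp add: algebra_simps)
  obtain g where g: "poly_blk d g" "\<And>x. x \<in> Xset \<Longrightarrow> \<bar>kcomp K js g x - g1 x\<bar> \<le> \<epsilon> / 2"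
    "\<And>x. x \<in> Xset \<Longrightarrow> \<bar>g x - g1 x\<bar> \<le> (q ^ length js - 1) * (q * B)"
    using Cons.IH[OF g1(1) B1, of "\<epsilon> / 2"] Cons.prems(3,4) q unfolding q_def[symmetric] by auto
  show ?case
  proof (intro exI[of _ g] conjI ballI g(1))
    fix x :: "real^'n^'m" assume x: "x \<in> Xset"
    have "\<bar>K j (\<lambda>x. kcomp K js g x - g1 x) x\<bar> \<le> \<epsilon> / 2"
      by (rule K_le[OF poly_blk_diff[OF kcomp_poly[OF g(1)] g1(1)] g(2) x])
    then show "\<bar>kcomp K (j # js) g x - f x\<bar> \<le> \<epsilon>"
      using g1(2)[OF x] unfolding K_diff[OF kcomp_poly[OF g(1)] g1(1) x] kcomp.simps by linarith
    have "\<bar>g x - f x\<bar> \<le> (q ^ length js - 1) * (q * B) + (q - 1) * B"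
      using g(3)[OF x] g1(3)[OF x] by linarith
    then show "\<bar>g x - f x\<bar> \<le> ((1 / (1 - \<delta>)) ^ length (j # js) - 1) * B"
      unfolding q_def[symmetric] by (simp add: algebra_simps)
  qed
qed

text \<open>M is fixed for the outermost block first. The finite sum it gives evaluates the inner
  composition at finitely many points, and the induction hypothesis is used at exactly these, with a
  smaller tolerance.\<close>

lemma kcomp_sampled:
  fixes X0 :: "(real^'n^'m) set"
  assumes "poly_blk d f" "distinct js" "finite X0" "X0 \<subseteq> Xset" "\<epsilon> > 0"
  shows "\<exists>ps. (\<forall>(c,y)\<in>set ps. 0 \<le> c \<and> y \<in> Xset) \<and>
    (\<forall>x\<in>X0. \<bar>kcomp K js f x - (\<Sum>(c,y)\<leftarrow>ps. c * (\<Prod>j\<in>set js. (poly P (x $ j \<bullet> y $ j))\<^sup>2) * f (override_blks js y x))\<bar> \<le> \<epsilon>)"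
  using assms(2-)
proof (induction js arbitrary: X0 \<epsilon>)
  case Nil
  obtain y where y: "y \<in> (Xset :: (real^'n^'m) set)"
  proof
    show "(\<chi> j. axis undefined 1) \<in> (Xset :: (real^'n^'m) set)" by (simp add: Xset_def)
  qed
  have "override_blks [] y x = x" for x :: "real^'n^'m" by (simp add: override_blks_def vec_eq_iff)
  then show ?case using y Nil by (intro exI[of _ "[(1, y)]"]) auto
next
  case (Cons j js)
  let ?F = "kcomp K js f"
  let ?\<phi> = "\<lambda>x y. (poly P (x $ j \<bullet> y))\<^sup>2"
  have F: "poly_blk d ?F" by (rule kcomp_poly[OF assms(1)])
  have "\<forall>\<^sub>F M in sequentially. \<forall>x\<in>X0. dist (L M (\<lambda>y. ?\<phi> x y * ?F (upd_blk j y x))) (K j ?F x) < \<epsilon> / 2"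
    using Cons.prems by (intro eventually_ball_finite ballI tendstoD K_lim F) auto
  then obtain M where M: "\<And>x. x \<in> X0 \<Longrightarrow> \<bar>L M (\<lambda>y. ?\<phi> x y * ?F (upd_blk j y x)) - K j ?F x\<bar> < \<epsilon> / 2"
    unfolding dist_real_def by (auto simp: eventually_sequentially)
  obtain qs where qs: "\<And>c y. (c,y) \<in> set qs \<Longrightarrow> 0 \<le> c" "\<And>c y. (c,y) \<in> set qs \<Longrightarrow> norm y = 1"
    "\<And>f. L M f = (\<Sum>(c,y)\<leftarrow>qs. c * f y)" using finposE[OF fp[of M]] by auto
  have Lnn: "L M (?\<phi> x) \<ge> 0" for x
    using finpos_le[OF fp, of "\<lambda>_. 0" "?\<phi> x" M] by (simp add: finpos_linear(5)[OF fp])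
  define S where "S = (\<Sum>x\<in>X0. L M (?\<phi> x))"
  have S: "S \<ge> 0" unfolding S_def by (intro sum_nonneg Lnn)
  \<comment> \<open>The inner error is multiplied by the mass of the outer kernel, at most S; adding
    1 keeps the denominator positive.\<close>
  define e where "e = \<epsilon> / (2 * (1 + S))"
  have e: "e > 0" "S * e \<le> \<epsilon> / 2" using S Cons.prems(4) by (auto simp: e_def field_simps)
  define X1 where "X1 = (\<lambda>(x,q). upd_blk j (snd q) x) ` (X0 \<times> set qs)"
  have X1: "finite X1" "X1 \<subseteq> Xset" using Cons.prems(2,3) qs(2) by (auto simp: X1_def intro!: upd_blk_Xset)
  have "distinct js" using Cons.prems(1) by simp
  from Cons.IH[OF this X1 e(1)] obtain ps where pp: "(\<forall>(c,y)\<in>set ps. 0 \<le> c \<and> y \<in> Xset) \<and>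
    (\<forall>x\<in>X1. \<bar>?F x - (\<Sum>(c,y)\<leftarrow>ps. c * (\<Prod>j\<in>set js. (poly P (x $ j \<bullet> y $ j))\<^sup>2) * f (override_blks js y x))\<bar> \<le> e)" ..
  from conjunct1[OF pp] have ps: "\<And>c y. (c,y) \<in> set ps \<Longrightarrow> 0 \<le> c" "\<And>c y. (c,y) \<in> set ps \<Longrightarrow> y \<in> Xset"
    by auto
  define G where "G = (\<lambda>x. \<Sum>(c,y)\<leftarrow>ps. c * (\<Prod>j\<in>set js. (poly P (x $ j \<bullet> y $ j))\<^sup>2) * f (override_blks js y x))"
  \<comment> \<open>The product measure: weights multiply, and the outer sample fills block j of the
    inner one.\<close>
  define rs where "rs = concat (map (\<lambda>(c,y). map (\<lambda>(c',y'). (c * c', upd_blk j y y')) ps) qs)"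
  have j: "j \<notin> set js" using Cons.prems(1) by simp
  have rs: "(\<Sum>(c,y)\<leftarrow>rs. c * (\<Prod>i\<in>set (j # js). (poly P (x $ i \<bullet> y $ i))\<^sup>2) * f (override_blks (j # js) y x))
     = L M (\<lambda>y. ?\<phi> x y * G (upd_blk j y x))" for x
  proof -
    have inner: "(\<Sum>(c,y)\<leftarrow>map (\<lambda>(c',y'). (c0 * c', upd_blk j y0 y')) ps. c * (\<Prod>i\<in>set (j # js). (poly P (x $ i \<bullet> y $ i))\<^sup>2) * f (override_blks (j # js) y x))
      = c0 * (?\<phi> x y0 * G (upd_blk j y0 x))" for c0 y0
    proof -
      have "(\<Prod>i\<in>set js. (poly P (x $ i \<bullet> upd_blk j y0 y' $ i))\<^sup>2) = (\<Prod>i\<in>set js. (poly P (upd_blk j y0 x $ i \<bullet> y' $ i))\<^sup>2)" for y'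
        using j by (intro prod.cong) (auto simp: upd_blk_def)
      moreover have "override_blks (j # js) (upd_blk j y0 y') x = override_blks js y' (upd_blk j y0 x)" for y'
        using j by (auto simp: override_blks_def upd_blk_def vec_eq_iff)
      moreover have "upd_blk j y0 y' $ j = y0" for y' by (simp add: upd_blk_def)
      ultimately show ?thesis
        unfolding G_def using j by (induction ps) (auto simp: algebra_simps)
    qed
    show ?thesis unfolding qs(3) rs_def
    proof (induction qs)
      case (Cons q qs)
      then show ?case using inner[of "fst q" "snd q"] by (simp add: case_prod_unfold)
    qed simp
  qed
  show ?case
  proof (intro exI[of _ rs] conjI ballI)
    show "case p of (c, y) \<Rightarrow> 0 \<le> c \<and> y \<in> Xset" if "p \<in> set rs" for p
      using that ps(1,2) qs(1,2) by (auto simp: rs_def intro!: upd_blk_Xset) 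
    fix x assume x: "x \<in> X0"
    have "\<bar>L M (\<lambda>y. ?\<phi> x y * ?F (upd_blk j y x)) - L M (\<lambda>y. ?\<phi> x y * G (upd_blk j y x))\<bar> \<le> L M (?\<phi> x) * e"
    proof -
      have claim: "\<bar>\<Sum>(c,y)\<leftarrow>qs'. c * (?\<phi> x y * ?F (upd_blk j y x) - ?\<phi> x y * G (upd_blk j y x))\<bar> \<le> (\<Sum>(c,y)\<leftarrow>qs'. c * ?\<phi> x y) * e"
        if "set qs' \<subseteq> set qs" for qs'
        using that
      proof (induction qs')
        case (Cons q qs')
        obtain c y where q: "q = (c, y)" by force
        have cy: "(c, y) \<in> set qs" using Cons.prems q by simp
        have "upd_blk j y x \<in> X1" unfolding X1_def using x cy by force
        then have "\<bar>?F (upd_blk j y x) - G (upd_blk j y x)\<bar> \<le> e" unfolding G_def by (rule bspec[OF conjunct2[OF pp]])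
        then have "(c * ?\<phi> x y) * \<bar>?F (upd_blk j y x) - G (upd_blk j y x)\<bar> \<le> (c * ?\<phi> x y) * e"
          using qs(1)[OF cy] by (intro mult_left_mono) auto
        moreover have "\<bar>c * (?\<phi> x y * ?F (upd_blk j y x) - ?\<phi> x y * G (upd_blk j y x))\<bar> = (c * ?\<phi> x y) * \<bar>?F (upd_blk j y x) - G (upd_blk j y x)\<bar>"
          using qs(1)[OF cy] by (simp add: abs_mult mult.assoc flip: right_diff_distrib)
        ultimately have "\<bar>c * (?\<phi> x y * ?F (upd_blk j y x) - ?\<phi> x y * G (upd_blk j y x))\<bar> \<le> (c * ?\<phi> x y) * e" by simp
        moreover have "\<bar>\<Sum>(c,y)\<leftarrow>qs'. c * (?\<phi> x y * ?F (upd_blk j y x) - ?\<phi> x y * G (upd_blk j y x))\<bar> \<le> (\<Sum>(c,y)\<leftarrow>qs'. c * ?\<phi> x y) * e"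
          using Cons by simp
        ultimately show ?case unfolding q by (simp only: list.map sum_list.Cons prod.case distrib_right)
      qed simp
      show ?thesis
        unfolding finpos_linear(3)[OF fp, symmetric] unfolding qs(3) by (rule claim[OF subset_refl])
    qed
    also have "\<dots> \<le> S * e"
      unfolding S_def using e(1) Cons.prems(2) x Lnn by (intro mult_right_mono member_le_sum) auto
    finally have 1: "\<bar>L M (\<lambda>y. ?\<phi> x y * ?F (upd_blk j y x)) - L M (\<lambda>y. ?\<phi> x y * G (upd_blk j y x))\<bar> \<le> \<epsilon> / 2"
      using e(2) by linarith
    have tri: "\<bar>a - b\<bar> \<le> \<epsilon> / 2 \<Longrightarrow> \<bar>a - c\<bar> < \<epsilon> / 2 \<Longrightarrow> \<bar>c - b\<bar> \<le> \<epsilon>" for a b c :: real by linarith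
    show "\<bar>kcomp K (j # js) f x - (\<Sum>(c,y)\<leftarrow>rs. c * (\<Prod>i\<in>set (j # js). (poly P (x $ i \<bullet> y $ i))\<^sup>2) * f (override_blks (j # js) y x))\<bar> \<le> \<epsilon>"
      unfolding rs kcomp.simps by (rule tri[OF 1 M[OF x]])
  qed
qed

end

section \<open>The harmonic constant\<close>

lemma poly_vec_bounded:
  assumes "poly_vec d (f :: real^'n \<Rightarrow> real)"
  obtains C where "\<And>x. norm x \<le> 1 \<Longrightarrow> \<bar>f x\<bar> \<le> C"
proof -
  obtain A c where A: "finite A" "\<And>y::'n \<Rightarrow> real. f (vec_lambda y) = (\<Sum>\<alpha>\<in>A. c \<alpha> * (\<Prod>v\<in>UNIV. y v ^ \<alpha> v))"
    using mpoly_fun_degE[OF assms[unfolded poly_vec_def]] by metis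
  show thesis
  proof (rule that[of "\<Sum>\<alpha>\<in>A. \<bar>c \<alpha>\<bar>"])
    fix x :: "real^'n" assume x: "norm x \<le> 1"
    have "\<bar>x $ v\<bar> \<le> 1" for v using component_le_norm_cart[of x v] x by linarith
    then have p: "\<bar>\<Prod>v\<in>UNIV. x $ v ^ \<alpha> v\<bar> \<le> 1" for \<alpha>
      unfolding abs_prod power_abs by (intro prod_le_1) (auto intro: power_le_one)
    have "\<bar>f x\<bar> = \<bar>\<Sum>\<alpha>\<in>A. c \<alpha> * (\<Prod>v\<in>UNIV. x $ v ^ \<alpha> v)\<bar>" using A(2)[of "\<lambda>v. x $ v"] by simp
    also have "\<dots> \<le> (\<Sum>\<alpha>\<in>A. \<bar>c \<alpha>\<bar>)"
      by (rule order_trans[OF sum_abs], rule sum_mono) (use p in \<open>simp add: abs_mult mult_left_le\<close>)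
    finally show "\<bar>f x\<bar> \<le> (\<Sum>\<alpha>\<in>A. \<bar>c \<alpha>\<bar>)" .
  qed
qed

lemma poly_blk_bounded:
  assumes "poly_blk d (f :: real^'n^'m \<Rightarrow> real)"
  obtains C where "\<And>x. x \<in> Xset \<Longrightarrow> \<bar>f x\<bar> \<le> C"
proof -
  obtain A c where A: "finite A" "\<And>\<alpha>. \<alpha> \<in> A \<Longrightarrow> (\<Sum>v\<in>UNIV. \<alpha> v) \<le> d"
    "\<And>x. f x = (\<Sum>\<alpha>\<in>A. c \<alpha> * bmon \<alpha> x)" using poly_blkE[OF assms] by metis
  show thesis
  proof (rule that[of "\<Sum>\<alpha>\<in>A. \<bar>c \<alpha>\<bar>"])
    fix x :: "real^'n^'m" assume "x \<in> Xset"
    then have "\<bar>x $ j $ i\<bar> \<le> 1" for j i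
      using component_le_norm_cart[of "x $ j" i] by (simp add: Xset_def)
    then have p: "\<bar>bmon \<alpha> x\<bar> \<le> 1" for \<alpha>
      unfolding bmon_def abs_prod power_abs by (intro prod_le_1) (auto intro: power_le_one)
    show "\<bar>f x\<bar> \<le> (\<Sum>\<alpha>\<in>A. \<bar>c \<alpha>\<bar>)" unfolding A(3)
      by (rule order_trans[OF sum_abs], rule sum_mono) (use p in \<open>simp add: abs_mult mult_left_le\<close>)
  qed
qed

lemma poly_vec_line:
  assumes "poly_vec d f" shows "\<exists>Q::real poly. \<forall>t. f (x + t *\<^sub>R v) = poly Q t"
proof -
  obtain Q :: "real poly" where "\<And>t. f (vec_lambda (\<lambda>i. x $ i + t * v $ i)) = poly Q t"
    using mpoly_line[OF assms[unfolded poly_vec_def], of "\<lambda>i. x $ i" "\<lambda>i. v $ i"] by blast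
  moreover have "vec_lambda (\<lambda>i. x $ i + t * v $ i) = x + t *\<^sub>R v" for t
    by (simp add: vec_eq_iff)
  ultimately show ?thesis by metis
qed

lemma deriv_poly: "deriv (poly Q) = poly (pderiv Q)" for Q :: "real poly"
  by (rule ext) (rule DERIV_imp_deriv[OF poly_DERIV])

lemma poly_local_max_second_deriv:
  fixes Q :: "real poly"
  assumes "e > 0" "\<And>t. \<bar>t\<bar> < e \<Longrightarrow> poly Q t \<le> poly Q 0"
  shows "poly (pderiv (pderiv Q)) 0 \<le> 0"
proof (rule ccontr)
  assume "\<not> ?thesis"
  then have pos: "poly (pderiv (pderiv Q)) 0 > 0" by simp
  have 0: "poly (pderiv Q) 0 = 0"
    by (rule DERIV_local_max[OF poly_DERIV assms(1)]) (use assms(2) in auto)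
  obtain s where s: "s > 0" "\<And>h. 0 < h \<Longrightarrow> h < s \<Longrightarrow> poly (pderiv Q) 0 < poly (pderiv Q) (0 + h)"
    using DERIV_pos_inc_right[OF poly_DERIV pos] by auto
  define h where "h = min e s / 2"
  have h: "0 < h" "h < e" "h < s" using assms(1) s(1) by (auto simp: h_def)
  obtain z where z: "0 < z" "z < h" "poly Q h - poly Q 0 = (h - 0) * poly (pderiv Q) z"
    using MVT2[OF h(1), of "poly Q" "poly (pderiv Q)"] poly_DERIV by blast
  have "poly (pderiv Q) z > 0" using s(2)[of z] z h 0 by simp
  then have "poly Q h > poly Q 0" using z(3) h(1) by (simp add: algebra_simps)
  then show False using assms(2)[of h] h by simp
qed

text \<open>Adding \<open>e * (x \<bullet> x)\<close> makes the Laplacian positive, which rules out an interior maximum.\<close>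
lemma harmonic_max_principle:
  fixes u :: "real^'n \<Rightarrow> real"
  assumes u: "poly_vec d u" "harmonic_fun u" and B: "\<And>x. norm x = 1 \<Longrightarrow> u x \<le> B" and x: "norm x \<le> 1"
  shows "u x \<le> B"
proof -
  have cont: "continuous_on UNIV u"
  proof -
    obtain A c where A: "\<And>y::'n \<Rightarrow> real. u (vec_lambda y) = (\<Sum>\<alpha>\<in>A. c \<alpha> * (\<Prod>v\<in>UNIV. y v ^ \<alpha> v))"
      using mpoly_fun_degE[OF u(1)[unfolded poly_vec_def]] by metis
    have "u = (\<lambda>x. \<Sum>\<alpha>\<in>A. c \<alpha> * (\<Prod>v\<in>UNIV. x $ v ^ \<alpha> v))"
      using A[of "\<lambda>v. _ $ v"] by (intro ext) simp
    then show ?thesis by (simp only:) (intro continuous_intros)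
  qed
  have "u x \<le> B + e" if e: "e > 0" for e
  proof -
    let ?w = "\<lambda>x. u x + e * (x \<bullet> x)"
    have "continuous_on (cball 0 1) ?w"
      by (intro continuous_intros continuous_on_subset[OF cont]) auto
    then obtain z :: "real^'n" where z: "norm z \<le> 1" "\<And>y. norm y \<le> 1 \<Longrightarrow> ?w y \<le> ?w z"
      using continuous_attains_sup[OF compact_cball, of "0::real^'n" 1 ?w] by (auto simp: dist_norm)
    have "norm z = 1"
    proof (rule ccontr)
      assume "norm z \<noteq> 1"
      then have zl: "norm z < 1" using z(1) by simp
      have nonpos: "deriv (deriv (\<lambda>t. u (z + t *\<^sub>R axis i 1))) 0 + 2 * e \<le> 0" for i
      proof -
        obtain Q :: "real poly" where Q: "\<And>t. u (z + t *\<^sub>R axis i 1) = poly Q t"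
          using poly_vec_line[OF u(1)] by blast
        \<comment> \<open>The list is the squared norm of \<open>z + t *\<^sub>R axis i 1\<close> as
          a polynomial in t; its second derivative gives the 2 e.\<close>
        define R where "R = Q + smult e [:z \<bullet> z, 2 * (z $ i), 1:]"
        have R: "poly R t = ?w (z + t *\<^sub>R axis i 1)" for t
          by (simp add: R_def Q[symmetric] inner_add_left inner_add_right inner_axis inner_axis' algebra_simps)
        have "poly (pderiv (pderiv R)) 0 \<le> 0"
        proof (rule poly_local_max_second_deriv)
          show "1 - norm z > 0" using zl by simp
          fix t assume t: "\<bar>t\<bar> < 1 - norm z"
          have "norm (z + t *\<^sub>R axis i 1) \<le> norm z + \<bar>t\<bar>"
            using norm_triangle_ineq[of z "t *\<^sub>R axis i 1"] by simp
          then have "?w (z + t *\<^sub>R axis i 1) \<le> ?w z" using t by (intro z(2)) simp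
          then show "poly R t \<le> poly R 0" unfolding R by simp
        qed
        then show ?thesis unfolding Q[abs_def] deriv_poly
          by (simp add: R_def pderiv_add pderiv_smult pderiv_pCons)
      qed
      have "(\<Sum>i\<in>UNIV. deriv (deriv (\<lambda>t. u (z + t *\<^sub>R axis i 1))) 0 + 2 * e) \<le> 0"
        by (intro sum_nonpos nonpos)
      moreover have "(\<Sum>i\<in>UNIV. deriv (deriv (\<lambda>t. u (z + t *\<^sub>R axis i 1))) 0) = 0"
        using u(2) unfolding harmonic_fun_def by blast
      ultimately show False using e by (simp add: sum.distrib mult_le_0_iff)
    qed
    then have "?w z \<le> B + e" using B[of z] by (simp add: norm_eq_1)
    moreover have "?w x \<le> ?w z" using z(2) x .
    moreover have "e * (x \<bullet> x) \<ge> 0" using e by simp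
    ultimately show ?thesis by linarith
  qed
  then show ?thesis by (rule field_le_epsilon)
qed

lemma harmonic_fun_cmult:
  fixes f :: "real^'n \<Rightarrow> real"
  assumes "poly_vec d f" "harmonic_fun f" shows "harmonic_fun (\<lambda>x. c * f x)"
  unfolding harmonic_fun_def
proof
  fix x :: "real^'n"
  have "deriv (deriv (\<lambda>t. c * f (x + t *\<^sub>R axis i 1))) 0 = c * deriv (deriv (\<lambda>t. f (x + t *\<^sub>R axis i 1))) 0" for i
  proof -
    obtain Q :: "real poly" where Q: "\<And>t. f (x + t *\<^sub>R axis i 1) = poly Q t"
      using poly_vec_line[OF assms(1)] by blast
    have "(\<lambda>t. c * poly Q t) = poly (smult c Q)" by (rule ext) simp
    then show ?thesis unfolding Q by (simp add: deriv_poly pderiv_smult)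
  qed
  then show "(\<Sum>i\<in>UNIV. deriv (deriv (\<lambda>t. c * f (x + t *\<^sub>R axis i 1))) 0) = 0"
    using assms(2) unfolding harmonic_fun_def by (simp flip: sum_distrib_left)
qed

lemma harmonic_fun_sum:
  fixes f :: "'j \<Rightarrow> real^'n \<Rightarrow> real"
  assumes "finite J" "\<And>j. j \<in> J \<Longrightarrow> poly_vec d (f j)" "\<And>j. j \<in> J \<Longrightarrow> harmonic_fun (f j)"
  shows "harmonic_fun (\<lambda>x. \<Sum>j\<in>J. f j x)"
  unfolding harmonic_fun_def
proof
  fix x :: "real^'n"
  have "deriv (deriv (\<lambda>t. \<Sum>j\<in>J. f j (x + t *\<^sub>R axis i 1))) 0 = (\<Sum>j\<in>J. deriv (deriv (\<lambda>t. f j (x + t *\<^sub>R axis i 1))) 0)" for i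
  proof -
    have "\<forall>j\<in>J. \<exists>Q::real poly. \<forall>t. f j (x + t *\<^sub>R axis i 1) = poly Q t"
      using poly_vec_line assms(2) by blast
    then obtain Q :: "_ \<Rightarrow> real poly" where Q: "\<And>j t. j \<in> J \<Longrightarrow> f j (x + t *\<^sub>R axis i 1) = poly (Q j) t" by metis
    have 1: "(\<lambda>t. \<Sum>j\<in>J. f j (x + t *\<^sub>R axis i 1)) = poly (\<Sum>j\<in>J. Q j)"
      by (rule ext) (simp add: poly_sum Q)
    have pd: "pderiv (\<Sum>j\<in>J. g j) = (\<Sum>j\<in>J. pderiv (g j))" for g :: "_ \<Rightarrow> real poly"
      using assms(1) by (induction J rule: finite_induct) (auto simp: pderiv_add)
    have "(\<lambda>t. f j (x + t *\<^sub>R axis i 1)) = poly (Q j)" if "j \<in> J" for j using Q[OF that] by (rule ext)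
    then show ?thesis unfolding 1 deriv_poly pd poly_sum by (simp add: deriv_poly)
  qed
  then have "(\<Sum>i\<in>UNIV. deriv (deriv (\<lambda>t. \<Sum>j\<in>J. f j (x + t *\<^sub>R axis i 1))) 0)
    = (\<Sum>j\<in>J. \<Sum>i\<in>UNIV. deriv (deriv (\<lambda>t. f j (x + t *\<^sub>R axis i 1))) 0)"
    by (simp add: sum.swap[of _ J])
  then show "(\<Sum>i\<in>UNIV. deriv (deriv (\<lambda>t. \<Sum>j\<in>J. f j (x + t *\<^sub>R axis i 1))) 0) = 0"
    using assms(3) unfolding harmonic_fun_def by simp
qed

lemma hom_vec_poly_vec: "hom_vec k f \<Longrightarrow> poly_vec k f"
  unfolding hom_vec_def poly_vec_def mpoly_fun_hom_def mpoly_fun_deg_def by (metis order_refl)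

lemma hom_vec_scale:
  assumes "hom_vec k (f :: real^'n \<Rightarrow> real)" shows "f (r *\<^sub>R x) = r ^ k * f x"
proof -
  obtain A c where A: "\<And>\<alpha>. \<alpha> \<in> A \<Longrightarrow> (\<Sum>v\<in>UNIV. \<alpha> v) = k"
    "\<And>y::'n \<Rightarrow> real. f (vec_lambda y) = (\<Sum>\<alpha>\<in>A. c \<alpha> * (\<Prod>v\<in>UNIV. y v ^ \<alpha> v))"
    using assms unfolding hom_vec_def mpoly_fun_hom_def by metis
  have f: "f x = (\<Sum>\<alpha>\<in>A. c \<alpha> * (\<Prod>v\<in>UNIV. x $ v ^ \<alpha> v))" for x
    using A(2)[of "\<lambda>v. x $ v"] by simp
  show ?thesis unfolding f sum_distrib_left
    by (intro sum.cong refl) (simp add: power_mult_distrib prod.distrib A(1) flip: power_sum)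
qed

lemma sph_norm_upper:
  assumes "\<And>x. norm x = 1 \<Longrightarrow> \<bar>p x\<bar> \<le> C" shows "sph_norm (p :: real^'n \<Rightarrow> real) \<le> C"
  unfolding sph_norm_def
proof (rule cSup_least)
  have "norm (axis undefined 1 :: real^'n) = 1" by simp
  then show "(\<lambda>x. \<bar>p x\<bar>) ` {x. norm x = 1} \<noteq> {}" by blast
qed (use assms in auto)

text \<open>\<open>sph_norm\<close> is a supremum of reals, hence the a priori bound C.\<close>

lemma sph_norm_ge:
  assumes "\<And>x. norm x = 1 \<Longrightarrow> \<bar>p x\<bar> \<le> C" "norm x = 1" shows "\<bar>p x\<bar> \<le> sph_norm p"
  unfolding sph_norm_def by (rule cSup_upper) (use assms in \<open>auto intro!: bdd_aboveI[of _ C]\<close>)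

text \<open>The components of \<open>p = \<Sum>j. H j\<close> are bounded uniformly: the harmonic extension
  \<open>r x \<mapsto> \<Sum>j. r^j H j x\<close> is bounded by the norm of \<open>p\<close> for \<open>r \<le> 1\<close>, hence so are its coefficients in \<open>r\<close>.\<close>
lemma gamma_sph_ge_1: "gamma_sph TYPE('n::finite) d \<ge> 1"
proof -
  let ?S = "{sph_norm h / sph_norm p | (p :: real^'n \<Rightarrow> real) h k.
       poly_vec d p \<and> (\<exists>x. norm x = 1 \<and> p x \<noteq> 0) \<and> k \<le> d \<and>
       (\<exists>H. (\<forall>j\<le>d. is_sph_harm j (H j)) \<and>
            (\<forall>x. norm x = 1 \<longrightarrow> p x = (\<Sum>j\<le>d. H j x)) \<and> h = H k)}"
  \<comment> \<open>This yields a constant that depends on d only and bounds the coefficients of a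
    polynomial in r by its values at finitely many radii below 1.\<close>
  have "\<forall>a\<in>{..d}. c a = 0" if "\<And>r. r \<in> {0<..<1::real} \<Longrightarrow> (\<Sum>a\<le>d. c a * r ^ a) = 0" for c
    by (rule powers_indep_infinite[of "{0<..<1}"]) (use that in auto)
  then obtain X0 C where X0: "finite X0" "X0 \<subseteq> {0<..<1::real}" "C \<ge> 0"
    "\<And>c a. a \<in> {..d} \<Longrightarrow> \<bar>c a\<bar> \<le> C * (\<Sum>r\<in>X0. \<bar>\<Sum>b\<le>d. c b * r ^ b\<bar>)"
  proof (rule coeff_bound[where A="{..d}" and X="{0<..<1::real}" and f="\<lambda>a r. r ^ a", OF finite_atMost])
  qed (assumption, rule that)
  have bdd: "sph_norm (H k) / sph_norm p \<le> C * real (card X0)"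
    if p: "poly_vec d p" "\<exists>x. norm x = 1 \<and> p x \<noteq> 0" and k: "k \<le> d"
      and H: "\<And>j. j \<le> d \<Longrightarrow> is_sph_harm j (H j)" "\<And>x. norm x = 1 \<Longrightarrow> p x = (\<Sum>j\<le>d. H j x)"
    for p :: "real^'n \<Rightarrow> real" and H k
  proof -
    obtain Cp where Cp: "\<And>x. norm x = 1 \<Longrightarrow> \<bar>p x\<bar> \<le> Cp" using poly_vec_bounded[OF p(1)] order_refl by metis
    let ?N = "sph_norm p"
    have N: "\<bar>p x\<bar> \<le> ?N" if "norm x = 1" for x by (rule sph_norm_ge[OF Cp that])
    obtain x0 where "norm x0 = 1" "p x0 \<noteq> 0" using p(2) by blast
    then have N0: "?N > 0" using N[of x0] by simp
    have "\<forall>j. \<exists>f. j \<le> d \<longrightarrow> hom_vec j f \<and> harmonic_fun f \<and> (\<forall>x. norm x = 1 \<longrightarrow> H j x = f x)"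
      using H(1) unfolding is_sph_harm_def by blast
    from choice[OF this] obtain f
      where ff: "\<forall>j. j \<le> d \<longrightarrow> hom_vec j (f j) \<and> harmonic_fun (f j) \<and> (\<forall>x. norm x = 1 \<longrightarrow> H j x = f j x)" ..
    then have f: "\<And>j. j \<le> d \<Longrightarrow> hom_vec j (f j)" "\<And>j. j \<le> d \<Longrightarrow> harmonic_fun (f j)"
      "\<And>j x. j \<le> d \<Longrightarrow> norm x = 1 \<Longrightarrow> H j x = f j x"
      by simp_all
    define u where "u = (\<lambda>x. \<Sum>j\<in>{..d}. f j x)"
    have fp: "poly_vec d (f j)" if "j \<in> {..d}" for j
      using poly_vec_mono[OF hom_vec_poly_vec[OF f(1)]] that by simp
    have up: "poly_vec d u" unfolding u_def by (intro poly_vec_sum fp)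
    have uh: "harmonic_fun u" unfolding u_def by (rule harmonic_fun_sum[OF _ fp]) (auto intro: f)
    have us: "u x = p x" if "norm x = 1" for x using H(2)[OF that] f(3)[OF _ that] by (simp add: u_def)
    have ub: "\<bar>u x\<bar> \<le> ?N" if x: "norm x \<le> 1" for x
    proof -
      have "u x \<le> ?N" by (rule harmonic_max_principle[OF up uh _ x]) (use us N in \<open>fastforce simp: abs_le_iff\<close>)
      moreover have "-1 * u x \<le> ?N"
        by (rule harmonic_max_principle[OF poly_vec_cmult[OF up] harmonic_fun_cmult[OF up uh] _ x])
          (use us N in \<open>fastforce simp: abs_le_iff\<close>)
      ultimately show ?thesis by (simp add: abs_le_iff)
    qed
    have "\<bar>H k x\<bar> \<le> C * real (card X0) * ?N" if x: "norm x = 1" for x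
    proof -
      have "\<bar>f k x\<bar> \<le> C * (\<Sum>r\<in>X0. \<bar>\<Sum>b\<le>d. f b x * r ^ b\<bar>)" using X0(4)[of k "\<lambda>b. f b x"] k by simp
      also have "\<dots> \<le> C * (\<Sum>r\<in>X0. ?N)"
      proof (intro mult_left_mono sum_mono X0(3))
        fix r assume r: "r \<in> X0"
        have "(\<Sum>b\<le>d. f b x * r ^ b) = u (r *\<^sub>R x)"
          unfolding u_def by (intro sum.cong refl) (simp add: hom_vec_scale[OF f(1)])
        moreover have "norm (r *\<^sub>R x) \<le> 1" using r X0(2) x by auto
        ultimately show "\<bar>\<Sum>b\<le>d. f b x * r ^ b\<bar> \<le> ?N" using ub by simp
      qed
      finally show ?thesis using f(3)[OF k x] by (simp add: mult.assoc)
    qed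
    then have "sph_norm (H k) \<le> C * real (card X0) * ?N" by (rule sph_norm_upper)
    then show ?thesis using N0 by (simp add: divide_le_eq)
  qed
  have h0: "hom_vec 0 (\<lambda>x::real^'n. 1)"
    unfolding hom_vec_def mpoly_fun_hom_def by (intro exI[of _ "{\<lambda>_. 0}"] exI[of _ "\<lambda>_. 1"]) auto
  have hz: "hom_vec j (\<lambda>x::real^'n. 0)" for j
    unfolding hom_vec_def mpoly_fun_hom_def by (intro exI[of _ "{}"] exI[of _ "\<lambda>_. 1"]) auto
  have hc: "harmonic_fun (\<lambda>x::real^'n. c)" for c by (simp add: harmonic_fun_def)
  \<comment> \<open>The constant 1 is its own component of degree 0, so the ratio 1 occurs in the
    set.\<close>
  define H where "H = (\<lambda>j::nat. if j = 0 then (\<lambda>x::real^'n. 1::real) else (\<lambda>x. 0))"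
  have Hs: "is_sph_harm j (H j)" for j
    unfolding is_sph_harm_def H_def using h0 hz hc by (cases "j = 0") auto
  have Hsum: "(\<Sum>j\<le>d. H j x) = 1" for x
  proof -
    have "(\<Sum>j\<le>d. H j x) = (\<Sum>j\<le>d. if j = 0 then 1 else 0)" by (intro sum.cong) (auto simp: H_def)
    then show ?thesis by simp
  qed
  have e: "\<exists>x::real^'n. norm x = 1" using norm_axis_1 by blast
  then have "(\<lambda>x::real^'n. \<bar>1::real\<bar>) ` {x. norm x = 1} = {1}" by auto
  then have n1: "sph_norm (\<lambda>x::real^'n. 1) = 1" by (simp only: sph_norm_def cSup_singleton)
  have "sph_norm (H 0) / sph_norm (\<lambda>x::real^'n. 1) \<in> ?S"
    by (rule CollectI, rule exI[of _ "\<lambda>x. 1"], rule exI[of _ "H 0"], rule exI[of _ 0])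
      (use e Hs Hsum in \<open>auto intro: poly_vec_const\<close>)
  then have "1 \<in> ?S" by (simp add: H_def n1)
  then have "1 \<le> Sup ?S"
  proof (rule cSup_upper)
    show "bdd_above ?S"
    proof (rule bdd_aboveI)
      fix z assume "z \<in> ?S"
      then show "z \<le> C * real (card X0)"
      proof (elim CollectE exE conjE, goal_cases)
        case (1 p h k x H)
        show ?case unfolding 1(1) 1(8) by (rule bdd) (use 1 in auto)
      qed
    qed
  qed
  then show ?thesis unfolding gamma_sph_def .
qed

section \<open>The convergence bound\<close>

lemma poly_blk_poly_inner:
  fixes P :: "real poly" and a :: "real^'n" and j :: "'m::finite"
  assumes "degree P \<le> t"
  shows "poly_blk t (\<lambda>x::real^'n^'m. poly P (x $ j \<bullet> a))"
proof -
  have i: "poly_blk 1 (\<lambda>x::real^'n^'m. x $ j \<bullet> a)"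
    using poly_blk_of_poly_vec[OF poly_vec_inner, of a j] by (simp add: inner_commute)
  have "poly_blk t (\<lambda>x::real^'n^'m. (x $ j \<bullet> a) ^ k)" if "k \<le> degree P" for k
    using poly_blk_mono[OF poly_blk_power[OF i, of k], of t] that assms by simp
  then show ?thesis unfolding poly_altdef by (intro poly_blk_sum poly_blk_cmult) auto
qed

text \<open>A product of squares is the square of a product, here of degree m t; this is where the
  level m t comes from.\<close>

lemma sos_deg_kernel_sum:
  fixes P :: "real poly" and ps :: "(real \<times> (real^'n^'m)) list"
  assumes "degree P \<le> t" "\<And>c y. (c, y) \<in> set ps \<Longrightarrow> 0 \<le> c \<and> 0 \<le> g y"
  shows "sos_deg (2 * (CARD('m) * t)) (\<lambda>x. \<Sum>(c,y)\<leftarrow>ps. c * (\<Prod>j\<in>UNIV. (poly P (x $ j \<bullet> y $ j))\<^sup>2) * g y)"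
  using assms(2)
proof (induction ps)
  case (Cons q ps)
  obtain c y where q: "q = (c, y)" by force
  have cy: "0 \<le> c * g y" using Cons.prems[of c y] q by simp
  have "poly_blk (\<Sum>j\<in>(UNIV::'m set). t) (\<lambda>x::real^'n^'m. \<Prod>j\<in>UNIV. poly P (x $ j \<bullet> y $ j))"
    by (intro poly_blk_prod poly_blk_poly_inner assms)
  then have p: "poly_blk (CARD('m) * t) (\<lambda>x::real^'n^'m. \<Prod>j\<in>UNIV. poly P (x $ j \<bullet> y $ j))" by simp
  have "sos_deg (2 * (CARD('m) * t)) (\<lambda>x::real^'n^'m. (c * g y) * (\<Prod>j\<in>UNIV. poly P (x $ j \<bullet> y $ j))\<^sup>2)"
    by (intro sos_deg_cmult sos_deg_square p cy)
  moreover have "(c * g y) * (\<Prod>j\<in>UNIV. poly P (x $ j \<bullet> y $ j))\<^sup>2 = c * (\<Prod>j\<in>UNIV. (poly P (x $ j \<bullet> y $ j))\<^sup>2) * g y" for x :: "real^'n^'m"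
    by (simp add: prod_power_distrib)
  ultimately have "sos_deg (2 * (CARD('m) * t)) (\<lambda>x::real^'n^'m. c * (\<Prod>j\<in>UNIV. (poly P (x $ j \<bullet> y $ j))\<^sup>2) * g y)"
    by (simp only:)
  moreover have "sos_deg (2 * (CARD('m) * t)) (\<lambda>x. \<Sum>(c,y)\<leftarrow>ps. c * (\<Prod>j\<in>UNIV. (poly P (x $ j \<bullet> y $ j))\<^sup>2) * g y)"
    using Cons.prems by (intro Cons.IH) auto
  ultimately show ?case unfolding q list.map sum_list.Cons prod.case by (rule sos_deg_add)
qed (simp add: sos_deg_0)

lemma Xset_nonempty: "\<exists>x::real^'n^'m. x \<in> Xset"
  by (rule exI[of _ "\<chi> j. axis undefined 1"]) (simp add: Xset_def)

text \<open>A preimage of q - mid under the composed operators, raised by a constant, is nonnegative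
  on \<open>Xset\<close>. Its image is q minus a constant, and sampling that image gives a sum of
  squares F.\<close>

lemma in_T_shift:
  fixes q :: "real^'n^'m \<Rightarrow> real" and d t :: nat and \<delta> R B mid :: real
  assumes d: "d \<ge> 1" and t: "t \<ge> d" and q: "poly_blk d q"
    and \<delta>: "\<delta> = 2 * real d ^ 3 * (real CARD('n) ^ 2 / real t ^ 2)" "\<delta> < 1"
    and B: "\<And>x. x \<in> Xset \<Longrightarrow> \<bar>q x - mid\<bar> \<le> B" "B \<ge> 0" and \<epsilon>: "\<epsilon> > 0"
  shows "in_T (CARD('m) * t) (\<lambda>x. q x - (mid - (1 / (1 - \<delta>)) ^ CARD('m) * B - \<epsilon>))"
proof -
  have t1: "t \<ge> 1" using d t by simp
  have \<delta>0: "0 \<le> \<delta>" by (simp add: \<delta>(1))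
  obtain P :: "real poly" and L :: "nat \<Rightarrow> (real^'n \<Rightarrow> real) \<Rightarrow> real" where
    P: "degree P \<le> t" and fp: "\<And>M. finpos {y. norm y = 1} (L M)"
    and lim: "\<And>as. length as \<le> d \<Longrightarrow> \<exists>g. poly_vec (length as) g \<and>
       (\<forall>x. norm x = 1 \<longrightarrow> (\<lambda>M. L M (\<lambda>y. (poly P (x \<bullet> y))\<^sup>2 * lprod as y)) \<longlonglongrightarrow> g x)"
    and one: "\<And>x. norm x = 1 \<Longrightarrow> (\<lambda>M. L M (\<lambda>y. (poly P (x \<bullet> y))\<^sup>2)) \<longlonglongrightarrow> 1"
    and est: "\<And>x p B l. norm x = 1 \<Longrightarrow> lin_span d p \<Longrightarrow> \<forall>y. norm y = 1 \<longrightarrow> \<bar>p y\<bar> \<le> B \<Longrightarrow>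
       (\<lambda>M. L M (\<lambda>y. (poly P (x \<bullet> y))\<^sup>2 * p y)) \<longlonglongrightarrow> l \<Longrightarrow>
       \<bar>l\<bar> \<le> B \<and> \<bar>l - p x\<bar> \<le> 2 * real d ^ 3 * (real CARD('n) ^ 2 / real t ^ 2) * B"
    by (rule sphere_kernel[where ?'n='n, OF t1 d]) (rule that)
  \<comment> \<open>Guarding by \<open>poly_blk\<close> lets the choice of a representative run over
    all pairs of a block and a function.\<close>
  have "\<forall>jf::'m \<times> (real^'n^'m \<Rightarrow> real). \<exists>g. poly_blk d (snd jf) \<longrightarrow> (poly_blk d g \<and> (\<forall>x\<in>Xset. (\<lambda>M. L M (\<lambda>y. (poly P (x $ fst jf \<bullet> y))\<^sup>2 * snd jf (upd_blk (fst jf) y x))) \<longlonglongrightarrow> g x))"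
  proof
    fix jf :: "'m \<times> (real^'n^'m \<Rightarrow> real)"
    show "\<exists>g. poly_blk d (snd jf) \<longrightarrow> (poly_blk d g \<and> (\<forall>x\<in>Xset. (\<lambda>M. L M (\<lambda>y. (poly P (x $ fst jf \<bullet> y))\<^sup>2 * snd jf (upd_blk (fst jf) y x))) \<longlonglongrightarrow> g x))"
    proof (cases "poly_blk d (snd jf)")
      case True
      show ?thesis using block_kernel_exists[OF fp lim True, of "fst jf"] by (simp only: True simp_thms)
    qed simp
  qed
  from choice[OF this] obtain K0 where K0: "\<forall>jf::'m \<times> (real^'n^'m \<Rightarrow> real). poly_blk d (snd jf) \<longrightarrow> (poly_blk d (K0 jf) \<and> (\<forall>x\<in>Xset. (\<lambda>M. L M (\<lambda>y. (poly P (x $ fst jf \<bullet> y))\<^sup>2 * snd jf (upd_blk (fst jf) y x))) \<longlonglongrightarrow> K0 jf x))" ..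
  define K where "K = (\<lambda>j f. K0 (j, f))"
  have K_poly: "poly_blk d (K j f)" if "poly_blk d f" for j f
    using K0[rule_format, of "(j, f)"] that by (simp add: K_def)
  have K_lim: "(\<lambda>M. L M (\<lambda>y. (poly P (x $ j \<bullet> y))\<^sup>2 * f (upd_blk j y x))) \<longlonglongrightarrow> K j f x"
    if "poly_blk d f" "x \<in> Xset" for j f x
    using K0[rule_format, of "(j, f)"] that by (simp add: K_def)
  have K_est: "\<bar>K j f x\<bar> \<le> B \<and> \<bar>K j f x - f x\<bar> \<le> \<delta> * B"
    if f: "poly_blk d f" and B: "\<And>x. x \<in> Xset \<Longrightarrow> \<bar>f x\<bar> \<le> B" and x: "x \<in> Xset" for j f B x
  proof -
    have "norm (x $ j) = 1" using x by (simp add: Xset_def)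
    from est[OF this lin_span_block[OF f, of j x] _ K_lim[OF f x], of B]
    show ?thesis using B upd_blk_Xset[OF x] by (simp add: \<delta>(1))
  qed
  have K_le: "\<bar>K j f x\<bar> \<le> B" and K_near: "\<bar>K j f x - f x\<bar> \<le> \<delta> * B"
    if "poly_blk d f" "\<And>x. x \<in> Xset \<Longrightarrow> \<bar>f x\<bar> \<le> B" "x \<in> Xset" for j f B x
    using K_est[OF that] by auto
  have K_const: "K j (\<lambda>x. c) x = c" if x: "x \<in> Xset" for j c x
  proof (rule LIMSEQ_unique[OF K_lim[OF poly_blk_const x]])
    have "norm (x $ j) = 1" using x by (simp add: Xset_def)
    from tendsto_mult_left[OF one[OF this], of c]
    show "(\<lambda>M. L M (\<lambda>y. (poly P (x $ j \<bullet> y))\<^sup>2 * c)) \<longlonglongrightarrow> c"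
      by (simp add: mult.commute[of _ c] finpos_linear(2)[OF fp])
  qed
  note ctx = fp K_poly K_lim K_le K_near K_const \<delta>0 \<delta>(2)
  obtain js :: "'m list" where js: "distinct js" "set js = UNIV"
    using finite_distinct_list[OF finite] by metis
  have ljs: "length js = CARD('m)" using js by (metis distinct_card)
  define s where "s = CARD('m) * t"
  obtain X0 :: "(real^'n^'m) set" and C where X0: "finite X0" "X0 \<subseteq> Xset" "C \<ge> 0"
    "\<And>r. poly_blk (2 * s) r \<Longrightarrow> in_T s (\<lambda>x. r x + C * (\<Sum>z\<in>X0. \<bar>r z\<bar>))"
    by (rule in_T_from_samples[of s]) (rule that; assumption)
  define \<Q> where "\<Q> = (1 / (1 - \<delta>)) ^ CARD('m)"
  \<comment> \<open>At each sample the error is at most 2 e, one e from the approximate inverse and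
    one from sampling; the total cost must not exceed \<epsilon>.\<close>
  define e where "e = \<epsilon> / (2 * (1 + C * real (card X0)))"
  have CX: "0 \<le> C * real (card X0)" using X0(3) by simp
  have e: "e > 0" "C * (real (card X0) * (2 * e)) \<le> \<epsilon>"
    using \<epsilon> CX by (auto simp: e_def divide_simps)
  have f: "poly_blk d (\<lambda>x. q x - mid)" by (intro poly_blk_diff q poly_blk_const)
  obtain g where "poly_blk d g \<and> (\<forall>x\<in>Xset. \<bar>kcomp K js g x - (q x - mid)\<bar> \<le> e \<and> \<bar>g x - (q x - mid)\<bar> \<le> ((1 / (1 - \<delta>)) ^ length js - 1) * B)"
    using kcomp_approx_inverse[OF ctx f B e(1), where js=js] ..
  then have g: "poly_blk d g" "\<And>x. x \<in> Xset \<Longrightarrow> \<bar>kcomp K js g x - (q x - mid)\<bar> \<le> e"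
    "\<And>x. x \<in> Xset \<Longrightarrow> \<bar>g x - (q x - mid)\<bar> \<le> (\<Q> - 1) * B" by (simp_all add: ljs \<Q>_def)
  \<comment> \<open>On \<open>Xset\<close> g is at least -B - (\<Q> - 1) B = -\<Q> B.\<close>
  define h where "h = (\<lambda>x. g x + \<Q> * B)"
  have h: "poly_blk d h" unfolding h_def by (intro poly_blk_add g poly_blk_const)
  have h0: "h x \<ge> 0" if "x \<in> Xset" for x
    using g(3)[OF that] B(1)[OF that] unfolding h_def left_diff_distrib mult_1 by linarith
  obtain ps where pp: "(\<forall>(c,y)\<in>set ps. 0 \<le> c \<and> y \<in> Xset) \<and>
    (\<forall>x\<in>X0. \<bar>kcomp K js h x - (\<Sum>(c,y)\<leftarrow>ps. c * (\<Prod>j\<in>set js. (poly P (x $ j \<bullet> y $ j))\<^sup>2) * h (override_blks js y x))\<bar> \<le> e)"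
    using kcomp_sampled[OF ctx h js(1) X0(1,2) e(1)] ..
  define F where "F = (\<lambda>x. \<Sum>(c,y)\<leftarrow>ps. c * (\<Prod>j\<in>UNIV. (poly P (x $ j \<bullet> y $ j))\<^sup>2) * h y)"
  have ov: "override_blks js y x = y" for x y :: "real^'n^'m" by (simp add: override_blks_def js(2))
  have Fh: "\<bar>kcomp K js h x - F x\<bar> \<le> e" if "x \<in> X0" for x
    using bspec[OF conjunct2[OF pp] that] unfolding F_def ov js(2) .
  have F: "sos_deg (2 * s) F"
    unfolding F_def s_def by (rule sos_deg_kernel_sum[OF P]) (use conjunct1[OF pp] h0 in auto)
  \<comment> \<open>The exact identity is restored by this difference, of degree at most 2 s and
    small at the points of \<open>X0\<close>.\<close>
  define r where "r = (\<lambda>x. (q x - mid + \<Q> * B) - F x)"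
  have "d \<le> 2 * s"
  proof -
    have "t \<le> s" by (simp add: s_def Suc_leI)
    then show ?thesis using t by simp
  qed
  then have r: "poly_blk (2 * s) r"
    unfolding r_def using F by (intro poly_blk_diff poly_blk_add poly_blk_const poly_blk_mono[OF q]) (auto simp: sos_deg_def)
  have rX: "\<bar>r z\<bar> \<le> 2 * e" if z: "z \<in> X0" for z
  proof -
    have zX: "z \<in> Xset" using z X0(2) by blast
    have "kcomp K js h z = kcomp K js g z + \<Q> * B"
      unfolding h_def by (rule kcomp_add_const[OF ctx g(1) zX])
    then show ?thesis using Fh[OF z] g(2)[OF zX] unfolding r_def by linarith
  qed
  have sm: "C * (\<Sum>z\<in>X0. \<bar>r z\<bar>) \<le> \<epsilon>"
  proof -
    have "(\<Sum>z\<in>X0. \<bar>r z\<bar>) \<le> real (card X0) * (2 * e)" by (rule sum_bounded_above) (rule rX)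
    then have "C * (\<Sum>z\<in>X0. \<bar>r z\<bar>) \<le> C * (real (card X0) * (2 * e))" using X0(3) by (rule mult_left_mono)
    then show ?thesis using e(2) by linarith
  qed
  have "in_T s (\<lambda>x. (r x + C * (\<Sum>z\<in>X0. \<bar>r z\<bar>)) + (F x + (\<epsilon> - C * (\<Sum>z\<in>X0. \<bar>r z\<bar>))))"
    using sm by (intro in_T_add X0(4) r in_T_sos F in_T_const) simp
  moreover have "(r x + C * (\<Sum>z\<in>X0. \<bar>r z\<bar>)) + (F x + (\<epsilon> - C * (\<Sum>z\<in>X0. \<bar>r z\<bar>))) = q x - (mid - \<Q> * B - \<epsilon>)" for x
    by (simp add: r_def)
  ultimately show ?thesis unfolding s_def[symmetric] \<Q>_def[symmetric] by (simp only:)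
qed

text \<open>Centring at the midpoint gives norm B = half the range, and mid = qmin + B. The loss
  \<epsilon> is absorbed by the supremum.\<close>

lemma lb_T_lower_bound:
  fixes q :: "real^'n^'m \<Rightarrow> real" and d t :: nat
  assumes d: "d \<ge> 1" and t: "t \<ge> d" and q: "poly_blk d q"
    and \<delta>: "\<delta> = 2 * real d ^ 3 * (real CARD('n) ^ 2 / real t ^ 2)" "\<delta> < 1"
  shows "ereal (qmin q - ((1 / (1 - \<delta>)) ^ CARD('m) - 1) * ((qmax q - qmin q) / 2)) \<le> lb_T q (CARD('m) * t)"
    and "qmin q \<le> qmax q"
proof -
  obtain C where C: "\<And>x. x \<in> Xset \<Longrightarrow> \<bar>q x\<bar> \<le> C" by (rule poly_blk_bounded[OF q]) (rule that)
  have lo: "qmin q \<le> q x" if "x \<in> Xset" for x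
    unfolding qmin_def
  proof (rule cInf_lower[OF imageI[OF that] bdd_belowI])
    fix z assume "z \<in> q ` Xset"
    then obtain x where x: "x \<in> Xset" "z = q x" by auto
    show "- C \<le> z" using C[OF x(1)] unfolding x(2) by linarith
  qed
  have hi: "q x \<le> qmax q" if "x \<in> Xset" for x
    unfolding qmax_def
  proof (rule cSup_upper[OF imageI[OF that] bdd_aboveI])
    fix z assume "z \<in> q ` Xset"
    then obtain x where x: "x \<in> Xset" "z = q x" by auto
    show "z \<le> C" using C[OF x(1)] unfolding x(2) by linarith
  qed
  obtain x0 :: "real^'n^'m" where x0: "x0 \<in> Xset" using Xset_nonempty by blast
  show le: "qmin q \<le> qmax q" by (rule order_trans[OF lo[OF x0] hi[OF x0]])
  define mid B where "mid = (qmin q + qmax q) / 2" and "B = (qmax q - qmin q) / 2"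
  have b: "\<bar>q x - mid\<bar> \<le> B" if "x \<in> Xset" for x
    using lo[OF that] hi[OF that] by (simp add: mid_def B_def abs_le_iff field_simps)
  have B0: "B \<ge> 0" using le by (simp add: B_def)
  let ?\<tau> = "mid - (1 / (1 - \<delta>)) ^ CARD('m) * B"
  have ge: "ereal (?\<tau> - \<epsilon>) \<le> lb_T q (CARD('m) * t)" if "\<epsilon> > 0" for \<epsilon>
    unfolding lb_T_def by (rule Sup_upper) (rule imageI, rule CollectI, rule in_T_shift[OF d t q \<delta> b B0 that])
  have "ereal ?\<tau> \<le> lb_T q (CARD('m) * t) + ereal \<epsilon>" if "\<epsilon> > 0" for \<epsilon>
  proof -
    have "ereal ?\<tau> = ereal (?\<tau> - \<epsilon>) + ereal \<epsilon>" by simp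
    also have "\<dots> \<le> lb_T q (CARD('m) * t) + ereal \<epsilon>"
      by (rule add_right_mono[OF ge[OF that]])
    finally show ?thesis .
  qed
  then have "ereal ?\<tau> \<le> lb_T q (CARD('m) * t)" by (rule ereal_le_epsilon2)
  moreover have "?\<tau> = qmin q - ((1 / (1 - \<delta>)) ^ CARD('m) - 1) * ((qmax q - qmin q) / 2)"
  proof -
    have "mid = qmin q + B" by (simp add: mid_def B_def field_simps)
    then show ?thesis unfolding B_def[symmetric] by (simp add: algebra_simps)
  qed
  ultimately show "ereal (qmin q - ((1 / (1 - \<delta>)) ^ CARD('m) - 1) * ((qmax q - qmin q) / 2)) \<le> lb_T q (CARD('m) * t)"
    by simp
qed

text \<open>Source of m 2^m. With q = 1/(1 - \<delta>) \<le> 2 one has q^(m+1) - 1 = q (q^m - 1) +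
  \<delta> q, so each step doubles the bound and adds at most 2 \<delta>.\<close>

lemma power_inverse_bound:
  fixes \<delta> :: real
  assumes "0 \<le> \<delta>" "\<delta> \<le> 1 / 2"
  shows "(1 / (1 - \<delta>)) ^ m - 1 \<le> real m * 2 ^ m * \<delta>"
proof (induction m)
  case (Suc m)
  define q where "q = 1 / (1 - \<delta>)"
  have q: "q \<le> 2" "q \<ge> 0" "q - 1 = \<delta> * q" using assms by (auto simp: q_def field_simps)
  have "q ^ Suc m - 1 = q * (q ^ m - 1) + \<delta> * q" using q(3) by (simp add: algebra_simps)
  also have "\<dots> \<le> 2 * (real m * 2 ^ m * \<delta>) + \<delta> * 2"
  proof (intro add_mono)
    have "q * (q ^ m - 1) \<le> q * (real m * 2 ^ m * \<delta>)" using Suc q(2) unfolding q_def by (rule mult_left_mono)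
    also have "\<dots> \<le> 2 * (real m * 2 ^ m * \<delta>)" using q(1) assms(1) by (intro mult_right_mono) auto
    finally show "q * (q ^ m - 1) \<le> 2 * (real m * 2 ^ m * \<delta>)" .
    show "\<delta> * q \<le> \<delta> * 2" using q(1) assms(1) by (intro mult_left_mono)
  qed
  also have "\<dots> \<le> real (Suc m) * 2 ^ Suc m * \<delta>"
  proof -
    have "1 * \<delta> \<le> 2 ^ m * \<delta>" using assms(1) by (intro mult_right_mono) auto
    then show ?thesis by (simp add: algebra_simps)
  qed
  finally show ?case by (simp add: q_def)
qed simp

theorem theorem4:
  fixes q :: "real^'n^'m \<Rightarrow> real" and d t :: nat
  assumes "CARD('m) \<ge> 2" and "d \<ge> 1" and "poly_blk d q"
    and "real t \<ge> 2 * real CARD('n) * real d * sqrt (real d)"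
  shows "ereal (qmin q) - lb_T q (CARD('m) * t)
    \<le> ereal (C_X CARD('n) d CARD('m) (gamma_sph TYPE('n) d) / (real t)^2 * (qmax q - qmin q))"
proof -
  let ?n = "real CARD('n)" and ?m = "CARD('m)" and ?\<gamma> = "gamma_sph TYPE('n) d"
  have n: "?n \<ge> 1" by (simp add: Suc_leI)
  have d: "real d \<ge> 1" using assms(2) by simp
  have sd: "sqrt (real d) \<ge> 1" using d by simp
  have dt: "real d \<le> real t"
  proof -
    have n2: "1 \<le> 2 * ?n" using n by linarith
    have "1 * real d * 1 \<le> 2 * ?n * real d * sqrt (real d)" by (intro mult_mono order_refl sd n2) auto
    then show ?thesis using assms(4) by simp
  qed
  then have t: "t \<ge> d" by simp
  have t0: "real t > 0" using dt d by linarith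
  define s where "s = ?n ^ 2 * real d ^ 3 / real t ^ 2"
  have s0: "s \<ge> 0" by (simp add: s_def)
  have s4: "s \<le> 1 / 4"
  proof -
    \<comment> \<open>The square of the lower bound on t is 4 n^2 d^3; the factor sqrt d supplies
      the third power of d.\<close>
    have "(2 * ?n * real d * sqrt (real d)) ^ 2 \<le> real t ^ 2" using assms(4) by (intro power_mono) auto
    then have "4 * (?n ^ 2 * real d ^ 3) \<le> real t ^ 2"
      by (simp add: power_mult_distrib power3_eq_cube power2_eq_square[of "real d"] mult_ac)
    then show ?thesis using t0 by (simp add: s_def divide_le_eq)
  qed
  define \<delta> where "\<delta> = 2 * real d ^ 3 * (?n ^ 2 / real t ^ 2)"
  have \<delta>s: "\<delta> = 2 * s" by (simp add: \<delta>_def s_def)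
  have \<delta>: "0 \<le> \<delta>" "\<delta> \<le> 1 / 2" "\<delta> < 1" using s0 s4 by (auto simp: \<delta>s)
  let ?R = "qmax q - qmin q" and ?\<rho> = "(1 / (1 - \<delta>)) ^ ?m - 1"
  have lb: "ereal (qmin q - ?\<rho> * (?R / 2)) \<le> lb_T q (?m * t)" and R: "?R \<ge> 0"
    using lb_T_lower_bound[OF assms(2) t assms(3) \<delta>_def \<delta>(3)] by auto
  have bin: "real ((d + ?m) choose ?m) \<ge> 1" by (simp add: Suc_leI)
  have \<gamma>: "?\<gamma> ^ ?m \<ge> 1" using gamma_sph_ge_1 by (rule one_le_power)
  have "?\<rho> * (?R / 2) \<le> (real ?m * 2 ^ ?m * \<delta>) * (?R / 2)"
    using power_inverse_bound[OF \<delta>(1,2), of ?m] R by (intro mult_right_mono) auto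
  \<comment> \<open>The 2 in \<delta> = 2 s cancels against half the range.\<close>
  also have "\<dots> = (real ?m * 2 ^ ?m * ?n ^ 2 * real d ^ 3 * (1 * 1)) / real t ^ 2 * ?R"
    by (simp add: \<delta>s s_def)
  \<comment> \<open>The binomial coefficient and the power of the harmonic constant are both at
    least 1.\<close>
  also have "\<dots> \<le> (real ?m * 2 ^ ?m * ?n ^ 2 * real d ^ 3 * (real ((d + ?m) choose ?m) * ?\<gamma> ^ ?m)) / real t ^ 2 * ?R"
    using bin \<gamma> R by (intro mult_right_mono divide_right_mono mult_left_mono mult_mono) auto
  also have "\<dots> = C_X CARD('n) d ?m ?\<gamma> / real t ^ 2 * ?R" by (simp add: C_X_def mult.assoc)
  finally have fin: "?\<rho> * (?R / 2) \<le> C_X CARD('n) d ?m ?\<gamma> / real t ^ 2 * ?R" .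
  have "ereal (qmin q) - lb_T q (?m * t) \<le> ereal (qmin q) - ereal (qmin q - ?\<rho> * (?R / 2))"
    by (rule ereal_minus_mono[OF order_refl lb])
  also have "\<dots> = ereal (?\<rho> * (?R / 2))" by simp
  also have "\<dots> \<le> ereal (C_X CARD('n) d ?m ?\<gamma> / real t ^ 2 * ?R)" using fin by simp
  finally show ?thesis .
qed

end
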